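(* For each $t>0$ the limit $H(t)=\lim_{\varepsilon\to 0^+} H_\varepsilon(t)$ exists. Moreover, for any (small) $\delta>0$, $$H_\varepsilon(t)=H(t)+O_\delta\big(\varepsilon^{\frac18-\delta}\big)\qquad\text{as }\varepsilon\to0^+,$$ where $$H(t)=\begin{cases} 1-\dfrac{2t}{\zeta(2)} & \text{if } 0<t\le\frac12,\\[2mm] \dfrac{2}{\zeta(2)}\displaystyle\int_t^1\psi(x)\,dx & \text{if } \frac12\le t\le 1,\\[2mm] 0 & \text{if } t\ge 1.\end{cases}$$ In particular, $\tilde\mu_\varepsilon\to\tilde\mu$ weakly as $\varepsilon\to0^+$, where $\tilde\mu$ is the measure on $[0,\infty)$ with $d\tilde\mu(t)=h(t)\,dt$ and $$h(t)=-H'(t)=\frac{2}{\zeta(2)}\cdot\begin{cases}1 & \text{if } 0<t\le\frac12,\\ \psi(t) & \text{if } \frac12\le t<1,\\ 0&\text{if } t\ge1.\end{cases}$$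
   Context: Directions $\omega\in[0,2\pi)$ are identified with unit vectors $(\cos\omega,\sin\omega)$. For $\varepsilon\in(0,\frac12)$, a point particle starts at the origin $O=(0,0)$ and moves with unit speed in direction $\omega$ in $\mathbb{R}^2$, with circular scatterers of radius $\varepsilon$ centered at the nonzero lattice points. Its first exit time is $$\tilde\tau_\varepsilon(\omega)=\inf\{\tau>0 : \operatorname{dist}\big((\tau\cos\omega,\tau\sin\omega),\mathbb{Z}^2\setminus\{(0,0)\}\big)\le\varepsilon\}.$$ Equivalently, this is the length of the billiard trajectory starting at the corner $O$ of the unit square, with specular reflection in the sides, until the particle reaches one of the corner pockets (quarter disks of radius $\varepsilon$), the initial departure from the pocket at $O$ being disregarded. Define $$H_\varepsilon(t)=\frac4\pi\left|\left\{\omega\in[0,\tfrac\pi4] : \varepsilon\tilde\tau_\varepsilon(\omega)>t\right\}\right|,$$ where $|\cdot|$ is Lebesgue measure, and define probability measures $\tilde\mu_\varepsilon$ on $[0,\infty)$ by $$\tilde\mu_\varepsilon(f)=\frac1{2\pi}\int_0^{2\pi}f\big(\varepsilon\tilde\tau_\varepsilon(\omega)\big)\,d\omega,\qquad f\in C_c([0,\infty)).$$ The function $\psi$ is $$\psi(x)=\frac{1-x}{x}\left(1+\ln\frac{x}{1-x}\right),\qquad x\in[\tfrac12,1),$$ and $\zeta$ is the Riemann zeta function, so $\zeta(2)=\pi^2/6$. In $O_\delta$ the implied constant may depend on $\delta$ ($t$ being fixed). *)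

theory Defs
  imports "HOL-Probability.Probability" "HOL-Library.Landau_Symbols"
begin

definition exit_time :: "real \<Rightarrow> real \<Rightarrow> real" where
  "exit_time \<epsilon> \<omega> =
     Inf {\<tau>. \<tau> > 0 \<and> infdist (\<tau> * cos \<omega>, \<tau> * sin \<omega>) (\<int> \<times> \<int> - {(0, 0)}) \<le> \<epsilon>}"

definition exit_tail :: "real \<Rightarrow> real \<Rightarrow> real" where
  "exit_tail \<epsilon> t = 4 / pi * measure lborel {\<omega> \<in> {0..pi/4}. \<epsilon> * exit_time \<epsilon> \<omega> > t}"

(* The law of the scaled exit time for a uniformly distributed direction, as a measure on
   the half-line {0..}; integral_exit_measure below gives the corresponding functional. *)
definition exit_measure :: "real \<Rightarrow> real measure" where
  "exit_measure \<epsilon> =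
     distr (uniform_measure lborel {0..<2*pi}) (restrict_space borel {0..})
       (\<lambda>\<omega>. \<epsilon> * exit_time \<epsilon> \<omega>)"

(* Narrow convergence: all bounded continuous test functions, hence in particular the
   continuous compactly supported ones. Test functions only need to be continuous on the
   underlying space of the limit measure, here {0..}. *)
definition weakly_converges ::
    "('i \<Rightarrow> 'a::topological_space measure) \<Rightarrow> 'a measure \<Rightarrow> 'i filter \<Rightarrow> bool" where
  "weakly_converges M N F \<longleftrightarrow>
     (\<forall>f::'a \<Rightarrow> real. continuous_on (space N) f \<and> bounded (f ` space N) \<longrightarrow>
        ((\<lambda>i. \<integral>x. f x \<partial>M i) \<longlongrightarrow> (\<integral>x. f x \<partial>N)) F)"

definition real_zeta :: "real \<Rightarrow> real" where
  "real_zeta s = (\<Sum>n. 1 / real (Suc n) powr s)"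

(* Only the values on {1/2..<1} matter; in HOL, psi 1 = 0, which is also the limit at 1. *)
definition psi :: "real \<Rightarrow> real" where
  "psi x = (1 - x) / x * (1 + ln (x / (1 - x)))"

definition limit_density :: "real \<Rightarrow> real" where
  "limit_density t = 2 / real_zeta 2 *
     (if t \<le> 1/2 then 1 else if t < 1 then psi t else 0)"

definition limit_measure :: "real measure" where
  "limit_measure = density (restrict_space lborel {0..}) (\<lambda>t. ennreal (limit_density t))"

lemma real_zeta_2: "real_zeta 2 = pi\<^sup>2 / 6"
proof -
  have "(\<lambda>n. 1 / real (Suc n) powr 2) sums (pi\<^sup>2 / 6)"
    using inverse_squares_sums by (simp add: add.commute)
  then show ?thesis unfolding real_zeta_def by (rule sums_unique[symmetric])
qed

lemma psi_half: "psi (1/2) = 1"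
  by (simp add: psi_def)

lemma exit_set_nonempty:
  fixes \<omega> :: real
  assumes "\<epsilon> > 0"
  shows "{\<tau>. \<tau> > 0 \<and> infdist (\<tau> * cos \<omega>, \<tau> * sin \<omega>) (\<int> \<times> \<int> - {(0, 0)}) \<le> \<epsilon>} \<noteq> {}"
proof -
  obtain N where N: "N \<ge> 2" "2 / real N < \<epsilon>"
  proof -
    obtain n where n: "1 / real (Suc n) < \<epsilon> / 2"
      using nat_approx_posE[of "\<epsilon> / 2"] assms by auto
    have "1 / real (n + 2) \<le> 1 / real (Suc n)" by (intro divide_left_mono) auto
    with n have "1 / real (n + 2) < \<epsilon> / 2" by linarith
    then have "2 / real (n + 2) < \<epsilon>" by simp
    then show thesis by (intro that[of "n + 2"]) auto
  qed
  define \<theta> where "\<theta> = (\<lambda>i::nat. if i = 0 then cos \<omega> else sin \<omega>)"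
  have "N > 0" using N by simp
  then obtain q p where q: "0 < q"
    and *: "\<And>i. i < 2 \<Longrightarrow> \<bar>of_int q * \<theta> i - of_int (p i)\<bar> < 1 / N"
    by (rule Dirichlet_approx_simult[where n = 2 and \<theta> = \<theta>]) blast
  define \<tau> where "\<tau> = real_of_int q"
  define a where "a = real_of_int (p 0)"
  define b where "b = real_of_int (p 1)"
  have \<tau>: "\<tau> \<ge> 1" using q unfolding \<tau>_def by linarith
  have A: "\<bar>\<tau> * cos \<omega> - a\<bar> < 1 / N" using *[of 0] unfolding \<theta>_def \<tau>_def a_def by simp
  have B: "\<bar>\<tau> * sin \<omega> - b\<bar> < 1 / N" using *[of 1] unfolding \<theta>_def \<tau>_def b_def by simp
  have half: "1 / real N \<le> 1 / 2" using N by (intro divide_left_mono) auto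
  have ne: "(a, b) \<noteq> (0, 0)"
  proof
    assume "(a, b) = (0, 0)"
    then have "\<bar>\<tau> * cos \<omega>\<bar> \<le> 1/2" "\<bar>\<tau> * sin \<omega>\<bar> \<le> 1/2" using A B half by auto
    then have "(\<tau> * cos \<omega>)\<^sup>2 \<le> (1/2)\<^sup>2" "(\<tau> * sin \<omega>)\<^sup>2 \<le> (1/2)\<^sup>2"
      by (metis abs_ge_zero power2_abs power_mono)+
    moreover have "(\<tau> * cos \<omega>)\<^sup>2 + (\<tau> * sin \<omega>)\<^sup>2 = \<tau>\<^sup>2"
      by (simp add: power_mult_distrib flip: distrib_left)
    ultimately have "\<tau>\<^sup>2 \<le> 1/2" by (simp add: power2_eq_square)
    moreover have "1 \<le> \<tau>\<^sup>2" using \<tau> by simp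
    ultimately show False by linarith
  qed
  have "infdist (\<tau> * cos \<omega>, \<tau> * sin \<omega>) (\<int> \<times> \<int> - {(0, 0)})
      \<le> dist (\<tau> * cos \<omega>, \<tau> * sin \<omega>) (a, b)"
    using ne by (intro infdist_le) (auto simp: a_def b_def)
  also have "\<dots> \<le> \<bar>\<tau> * cos \<omega> - a\<bar> + \<bar>\<tau> * sin \<omega> - b\<bar>"
    unfolding dist_prod_def by (simp add: dist_real_def sqrt_sum_squares_le_sum_abs[of "\<tau> * cos \<omega> - a", simplified])
  also have "\<dots> \<le> \<epsilon>" using A B N by simp
  finally show ?thesis using \<tau> by force
qed

lemma exit_time_nonneg:
  assumes "\<epsilon> > 0"
  shows "exit_time \<epsilon> \<omega> \<ge> 0"
  unfolding exit_time_def using exit_set_nonempty[OF assms, of \<omega>]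
  by (intro cInf_greatest) auto

lemma exit_time_measurable:
  assumes "\<epsilon> > 0"
  shows "exit_time \<epsilon> \<in> borel_measurable borel"
proof (rule borel_measurable_iff_less[THEN iffD2], rule allI)
  fix s :: real
  define g where "g = (\<lambda>(p::real\<times>real). infdist (fst p * cos (snd p), fst p * sin (snd p)) (\<int> \<times> \<int> - {(0, 0)}))"
  have cg: "continuous_on UNIV g"
    unfolding g_def by (intro continuous_intros)
  define K where "K = (\<lambda>n::nat. {p \<in> {1/real (Suc n)..s - 1/real (Suc n)} \<times> {-real n..real n}. g p \<le> \<epsilon>})"
  have "compact (K n)" for n
  proof -
    have "closed {p. g p \<le> \<epsilon>}"
      using cg by (intro closed_Collect_le) auto
    moreover have "K n = ({1/real (Suc n)..s - 1/real (Suc n)} \<times> {-real n..real n}) \<inter> {p. g p \<le> \<epsilon>}"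
      unfolding K_def by auto
    ultimately show ?thesis by (simp add: compact_Int_closed compact_Times)
  qed
  then have "compact (snd ` K n)" for n
    by (intro compact_continuous_image continuous_intros)
  then have "(\<Union>n. snd ` K n) \<in> sets borel"
    by (intro sets.countable_UN) (auto intro: borel_compact)
  moreover have "{\<omega> \<in> space borel. exit_time \<epsilon> \<omega> < s} = (\<Union>n. snd ` K n)"
  proof (intro set_eqI iffI)
    fix \<omega> assume "\<omega> \<in> {\<omega> \<in> space borel. exit_time \<epsilon> \<omega> < s}"
    then have "exit_time \<epsilon> \<omega> < s" by simp
    then obtain \<tau> where \<tau>: "\<tau> > 0" "g (\<tau>, \<omega>) \<le> \<epsilon>" "\<tau> < s"
      unfolding exit_time_def g_def
      using cInf_lessD[OF exit_set_nonempty[OF assms, of \<omega>], of s] that by auto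
    obtain n1 where n1: "1 / real (Suc n1) < min \<tau> (s - \<tau>)"
      using \<tau> nat_approx_posE[of "min \<tau> (s - \<tau>)"] by auto
    obtain n2 where n2: "\<bar>\<omega>\<bar> \<le> real n2" using real_arch_simple by blast
    define n where "n = max n1 n2"
    have "1 / real (Suc n) \<le> 1 / real (Suc n1)" unfolding n_def by (simp add: frac_le)
    moreover have "\<bar>\<omega>\<bar> \<le> real n" using n2 unfolding n_def by simp
    ultimately have "(\<tau>, \<omega>) \<in> K n" using n1 \<tau> unfolding K_def by auto
    then show "\<omega> \<in> (\<Union>n. snd ` K n)" by force
  next
    fix \<omega> assume "\<omega> \<in> (\<Union>n. snd ` K n)"
    then obtain n \<tau> where \<tau>: "1/real (Suc n) \<le> \<tau>" "\<tau> \<le> s - 1/real (Suc n)" "g (\<tau>, \<omega>) \<le> \<epsilon>"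
      unfolding K_def by auto
    have "1/real (Suc n) > 0" by simp
    then have pos: "\<tau> > 0" "\<tau> < s" using \<tau> by linarith+
    have "exit_time \<epsilon> \<omega> \<le> \<tau>"
      unfolding exit_time_def
      using pos \<tau>(3) by (intro cInf_lower bdd_belowI[of _ 0]) (auto simp: g_def)
    then show "\<omega> \<in> {\<omega> \<in> space borel. exit_time \<epsilon> \<omega> < s}" using pos by simp
  qed
  ultimately show "{\<omega> \<in> space borel. exit_time \<epsilon> \<omega> < s} \<in> sets borel" by simp
qed

lemma scaled_exit_time_measurable:
  assumes "\<epsilon> > 0"
  shows "(\<lambda>\<omega>. \<epsilon> * exit_time \<epsilon> \<omega>) \<in>
    uniform_measure lborel {0..<2*pi} \<rightarrow>\<^sub>M restrict_space borel {0..}"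
proof (rule measurable_restrict_space2)
  show "(\<lambda>\<omega>. \<epsilon> * exit_time \<epsilon> \<omega>) \<in> space (uniform_measure lborel {0..<2*pi}) \<rightarrow> {0..}"
    using exit_time_nonneg[OF assms] assms by auto
  have "(\<lambda>\<omega>. \<epsilon> * exit_time \<epsilon> \<omega>) \<in> borel_measurable borel"
    using exit_time_measurable[OF assms] by (intro borel_measurable_times) auto
  then show "(\<lambda>\<omega>. \<epsilon> * exit_time \<epsilon> \<omega>) \<in> borel_measurable (uniform_measure lborel {0..<2*pi})"
    by (simp cong: measurable_cong_sets)
qed

lemma prob_space_exit_measure:
  assumes "\<epsilon> > 0"
  shows "prob_space (exit_measure \<epsilon>)"
  unfolding exit_measure_def
  by (intro prob_space.prob_space_distr prob_space_uniform_measure scaled_exit_time_measurable assms)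
     (auto simp: )

lemma integral_exit_measure:
  fixes f :: "real \<Rightarrow> real"
  assumes "\<epsilon> > 0" and "continuous_on {0..} f"
  shows "(\<integral>x. f x \<partial>exit_measure \<epsilon>) =
    1 / (2*pi) * (LINT \<omega>:{0..<2*pi}|lborel. f (\<epsilon> * exit_time \<epsilon> \<omega>))"
proof -
  have f: "f \<in> borel_measurable (restrict_space borel {0..})"
    using assms(2) by (rule borel_measurable_continuous_on_restrict)
  have g: "(\<lambda>\<omega>. f (\<epsilon> * exit_time \<epsilon> \<omega>)) \<in> borel_measurable lborel"
    using measurable_compose[OF scaled_exit_time_measurable[OF assms(1)] f]
    by (simp cong: measurable_cong_sets)
  have dens: "uniform_measure lborel {0..<2*pi} =
      density lborel (\<lambda>\<omega>. ennreal (indicator {0..<2*pi} \<omega> / (2*pi)))"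
    unfolding uniform_measure_def
    by (intro arg_cong[where f = "density lborel"] ext)
       (auto simp: indicator_def divide_ennreal[symmetric] ennreal_mult)
  have "(\<integral>x. f x \<partial>exit_measure \<epsilon>) =
      (\<integral>\<omega>. f (\<epsilon> * exit_time \<epsilon> \<omega>) \<partial>uniform_measure lborel {0..<2*pi})"
    unfolding exit_measure_def
    by (rule integral_distr[OF scaled_exit_time_measurable[OF assms(1)] f])
  also have "\<dots> = (\<integral>\<omega>. (indicator {0..<2*pi} \<omega> / (2*pi)) *\<^sub>R f (\<epsilon> * exit_time \<epsilon> \<omega>) \<partial>lborel)"
    unfolding dens by (rule integral_density) (use g in \<open>auto\<close>)
  also have "\<dots> = 1 / (2*pi) * (LINT \<omega>:{0..<2*pi}|lborel. f (\<epsilon> * exit_time \<epsilon> \<omega>))"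
    unfolding set_lebesgue_integral_def
    by (subst integral_mult_right_zero[symmetric]) (simp add: field_simps)
  finally show ?thesis .
qed

end

theory Submission
  imports Defs "HOL-Number_Theory.Number_Theory" "HOL-Real_Asymp.Real_Asymp"
begin

text \<open>
  Put \<open>x = tan \<omega>\<close>. Up to \<open>O(\<epsilon>)\<close>, the particle is stopped before time \<open>t / \<epsilon>\<close> iff some \<open>q \<le> N\<close> has
  \<open>q x\<close> within \<open>\<eta>\<close> of an integer, where \<open>N = (t / \<epsilon>) cos \<omega>\<close> and \<open>\<eta> = \<epsilon> / cos \<omega>\<close>. The product
  \<open>N \<eta> = t\<close> does not depend on \<open>\<omega>\<close>, so cutting \<open>[0, 1]\<close> into about \<open>\<epsilon> powr (- 1/8)\<close> intervals makes
  \<open>N\<close> and \<open>\<eta>\<close> constant on each of them at the cost of an error \<open>O(\<epsilon> powr (1/8))\<close>.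

  Each Farey fraction \<open>a / q\<close> of order \<open>N\<close> owns two cells, on which \<open>q\<close> is the best denominator; the one
  towards the neighbour with denominator \<open>q'\<close> contributes \<open>min \<eta> (1 / (q + q')) / q\<close>. Writing the minimum as
  an integral over \<open>\<sigma> \<in> [0, t]\<close> leaves, for every \<open>q\<close> and \<open>\<sigma>\<close>, the number of solutions of
  \<open>a q' = \<plusminus>1 (mod q)\<close> in a box, because \<open>q'\<close> runs through \<open>{N - q<..N}\<close>. Kloosterman's elementary
  fourth-moment bound counts these up to \<open>q powr (3/4 + \<delta>)\<close>, which is exactly enough for the exponent
  \<open>1/8 - \<delta>\<close>. The normalisation \<open>integral {0..1} limit_density = 1\<close> is not computed: it follows from
  Dirichlet's theorem, by which everything is covered at \<open>t = 1\<close>.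
\<close>

section \<open>Divisor sums\<close>

text \<open>The obstacle is that the Kloosterman error does not shrink with the interval. For one
  denominator it is q powr (3/4 + \<delta>); divided by q, summed over q \<le> N and divided by N it
  leaves N powr (\<delta> - 1/4) for every interval, however short. Over K intervals this adds up to
  about K * \<epsilon> powr (1/4 - \<delta>), whereas freezing N and \<eta> costs the squared length
  of each interval, 1 / K altogether. Both balance at K = \<epsilon> powr (- 1/8). The averages of
  totient q / q have an error proportional to the length of the interval, so there a relative error
  N powr (- 1/8) suffices and a crude induction supplies it. The logarithm in the limit arises as
  follows. For 1/2 \<le> \<sigma> \<le> 1 the q' in the window {N - q<..N} with \<sigma> * (q + q')
  < N form an initial segment of length about min q (w * N), where w = 1 / \<sigma> - 1. Averaging
  this minimum over q with weight totient q / q^2 produces 6 / pi^2 times w - w * ln w, and w - w *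
  ln w is \<open>psi\<close> at \<sigma>. The two sides of a fraction give the factor 2.\<close>

definition tau :: "nat \<Rightarrow> nat" where
  "tau n = card {d. d dvd n}"

lemma tau_pos: "n > 0 \<Longrightarrow> tau n \<ge> 1"
proof -
  assume "n > 0"
  then have "card {1::nat} \<le> card {d. d dvd n}"
    by (intro card_mono) auto
  then show ?thesis by (simp add: tau_def)
qed

text \<open>In the divisor sum of \<open>totient\<close>, which adds up to n, every term is at most
  \<open>totient n\<close>. This is the lower bound for \<open>totient\<close> by which the fourth
  moment is later divided.\<close>

lemma le_totient_tau: "n \<le> totient n * tau n"
proof (cases "n = 0")
  case False
  have "n = (\<Sum>d | d dvd n. totient d)" by (rule totient_divisor_sum[symmetric])
  also have "\<dots> \<le> (\<Sum>d | d dvd n. totient n)"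
    using False by (intro sum_mono dvd_imp_le totient_dvd) auto
  finally show ?thesis by (simp add: tau_def mult.commute)
qed simp

text \<open>The gcd is one of the summands. Trading it for a sum over divisors of q allows an
  exchange of summations.\<close>

lemma gcd_le_sum_divisors:
  fixes m :: int and q :: nat
  assumes "q > 0"
  shows "gcd m (int q) \<le> (\<Sum>d | d dvd q \<and> int d dvd m. int d)"
proof -
  have "int (nat (gcd m (int q))) \<le> (\<Sum>d | d dvd q \<and> int d dvd m. int d)"
  proof (rule member_le_sum)
    have "int (nat (gcd m (int q))) dvd int q" by simp
    then have "nat (gcd m (int q)) dvd q" by (simp only: of_nat_dvd_iff)
    then show "nat (gcd m (int q)) \<in> {d. d dvd q \<and> int d dvd m}" by simp
    show "finite {d. d dvd q \<and> int d dvd m}"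
      by (rule finite_subset[of _ "{d. d dvd q}"]) (use assms in auto)
  qed auto
  then show ?thesis by simp
qed

lemma card_multiples_le:
  fixes d n :: nat
  assumes "d > 0" "d dvd n"
  shows "card {x \<in> {0..<int n}. int d dvd x} \<le> n div d"
proof -
  have "{x \<in> {0..<int n}. int d dvd x} \<subseteq> (\<lambda>k. int d * int k) ` {..<n div d}"
  proof
    fix x assume "x \<in> {x \<in> {0..<int n}. int d dvd x}"
    then obtain k where k: "x = int d * k" "0 \<le> x" "x < int n" by auto
    have "k \<ge> 0" using k assms by (simp add: zero_le_mult_iff)
    moreover have "int d * k < int d * int (n div d)" using k assms by (metis dvd_mult_div_cancel of_nat_mult)
    then have "k < int (n div d)" using assms by simp
    ultimately show "x \<in> (\<lambda>k. int d * int k) ` {..<n div d}"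
      using k by (intro image_eqI[of _ _ "nat k"]) auto
  qed
  then have "card {x \<in> {0..<int n}. int d dvd x} \<le> card ((\<lambda>k. int d * int k) ` {..<n div d})"
    by (intro card_mono) auto
  also have "\<dots> \<le> n div d" using card_image_le[of "{..<n div d}"] by simp
  finally show ?thesis .
qed

lemma sum_gcd_le:
  assumes "q > 0"
  shows "(\<Sum>x\<in>{0..<int q}. gcd x (int q)) \<le> int q * int (tau q)"
proof -
  have "(\<Sum>x\<in>{0..<int q}. gcd x (int q)) \<le> (\<Sum>x\<in>{0..<int q}. \<Sum>d | d dvd q \<and> int d dvd x. int d)"
    by (intro sum_mono gcd_le_sum_divisors assms)
  also have "\<dots> = (\<Sum>x\<in>{0..<int q}. \<Sum>d | d dvd q. if int d dvd x then int d else 0)"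
    using assms sum.inter_filter[of "{d. d dvd q}" int "\<lambda>d. int d dvd x" for x] by simp
  also have "\<dots> = (\<Sum>d | d dvd q. \<Sum>x\<in>{0..<int q}. if int d dvd x then int d else 0)"
    by (rule sum.swap)
  also have "\<dots> = (\<Sum>d | d dvd q. int (card {x \<in> {0..<int q}. int d dvd x}) * int d)"
    by (intro sum.cong refl) (simp add: sum.If_cases Int_def)
  also have "\<dots> \<le> (\<Sum>d | d dvd q. int q)"
  proof (rule sum_mono)
    fix d assume d: "d \<in> {d. d dvd q}"
    then have "d > 0" using assms by (auto intro: Nat.gr0I)
    then have "card {x \<in> {0..<int q}. int d dvd x} * d \<le> q div d * d"
      using card_multiples_le[of d q] d by (intro mult_right_mono) auto
    also have "\<dots> = q" using d by simp
    finally show "int (card {x \<in> {0..<int q}. int d dvd x}) * int d \<le> int q"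
      by (metis of_nat_le_iff of_nat_mult)
  qed
  also have "\<dots> = int q * int (tau q)" by (simp add: tau_def)
  finally show ?thesis .
qed

text \<open>For each divisor d of q the multiples of d below q contribute at most a harmonic sum, so
  the total is one logarithm per divisor.\<close>

lemma sum_gcd_div_le:
  assumes "q > 0"
  shows "(\<Sum>m\<in>{1..<q}. real (gcd m q) / real m) \<le> real (tau q) * (1 + ln (real q))"
proof -
  have harm_le: "(\<Sum>k\<in>{1..n}. 1 / real k) \<le> 1 + ln (real q)" if "n \<le> q" for n
  proof (cases "n = 0")
    case False
    \<comment> \<open>The sequence harm n - ln n decreases from its value 1 at n = 1.\<close>
    have "harm n \<le> 1 + ln (real n)"
      using False decseqD[OF decseq_harm_diff_ln, of 0 "n - 1"] by (simp add: harm_expand)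
    also have "\<dots> \<le> 1 + ln (real q)" using that False by simp
    finally show ?thesis by (simp add: harm_def inverse_eq_divide)
  qed (use assms in auto)
  have "(\<Sum>m\<in>{1..<q}. real (gcd m q) / real m) \<le> (\<Sum>m\<in>{1..<q}. \<Sum>d | d dvd q. if d dvd m then real d / real m else 0)"
  proof (rule sum_mono)
    fix m assume "m \<in> {1..<q}"
    have "(if gcd m q dvd m then real (gcd m q) / real m else 0) \<le> (\<Sum>d | d dvd q. if d dvd m then real d / real m else 0)"
      using assms by (intro member_le_sum) auto
    then show "real (gcd m q) / real m \<le> (\<Sum>d | d dvd q. if d dvd m then real d / real m else 0)" by simp
  qed
  also have "\<dots> = (\<Sum>d | d dvd q. \<Sum>m\<in>{1..<q}. if d dvd m then real d / real m else 0)"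
    by (rule sum.swap)
  also have "\<dots> \<le> (\<Sum>d | d dvd q. 1 + ln (real q))"
  proof (rule sum_mono)
    fix d assume d: "d \<in> {d. d dvd q}"
    then have d0: "d > 0" using assms by (auto intro: Nat.gr0I)
    have "(\<Sum>m\<in>{1..<q}. if d dvd m then real d / real m else 0) = (\<Sum>m\<in>{m\<in>{1..<q}. d dvd m}. real d / real m)"
      by (simp add: sum.If_cases Int_def)
    also have "\<dots> \<le> (\<Sum>m\<in>(\<lambda>k. d * k) ` {1..q}. real d / real m)"
    proof (rule sum_mono2)
      show "{m \<in> {1..<q}. d dvd m} \<subseteq> (\<lambda>k. d * k) ` {1..q}"
      proof
        fix m assume "m \<in> {m \<in> {1..<q}. d dvd m}"
        then obtain k where k: "m = d * k" "1 \<le> m" "m < q" by auto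
        then have "k \<ge> 1" "k \<le> d * k" using d0 by (auto intro: Nat.gr0I)
        then have "k \<le> q" using k by linarith
        then show "m \<in> (\<lambda>k. d * k) ` {1..q}" using k \<open>k \<ge> 1\<close> by (intro image_eqI[of _ _ k]) auto
      qed
    qed auto
    also have "\<dots> = (\<Sum>k\<in>{1..q}. 1 / real k)"
      using d0 by (subst sum.reindex) (auto simp: inj_on_def)
    also have "\<dots> \<le> 1 + ln (real q)" by (rule harm_le) simp
    finally show "(\<Sum>m\<in>{1..<q}. if d dvd m then real d / real m else 0) \<le> 1 + ln (real q)" .
  qed
  also have "\<dots> = real (tau q) * (1 + ln (real q))" by (simp add: tau_def)
  finally show ?thesis .
qed

section \<open>The divisor bound\<close>

lemma tau_coprime_mult:
  assumes "coprime a b" "a > 0" "b > 0"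
  shows "tau (a * b) \<le> tau a * tau b"
proof -
  have "{d. d dvd a * b} \<subseteq> (\<lambda>(x,y). x * y) ` ({d. d dvd a} \<times> {d. d dvd b})"
  proof
    fix d assume "d \<in> {d. d dvd a * b}"
    then obtain x y where "d = x * y" "x dvd a" "y dvd b"
      using division_decomp[of d a b] by auto
    then show "d \<in> (\<lambda>(x,y). x * y) ` ({d. d dvd a} \<times> {d. d dvd b})" by auto
  qed
  then have "card {d. d dvd a * b} \<le> card ((\<lambda>(x,y). x * y) ` ({d. d dvd a} \<times> {d. d dvd b}))"
    using assms by (intro card_mono) auto
  also have "\<dots> \<le> card ({d. d dvd a} \<times> {d. d dvd b})"
    using assms by (intro card_image_le) auto
  finally show ?thesis by (simp add: tau_def card_cartesian_product)
qed

lemma tau_prime_power: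
  assumes "prime p"
  shows "tau (p ^ k) \<le> k + 1"
proof -
  have "{d. d dvd p ^ k} \<subseteq> (\<lambda>i. p ^ i) ` {..k}"
    using assms divides_primepow_nat[of p] by auto
  then have "card {d. d dvd p ^ k} \<le> card ((\<lambda>i. p ^ i) ` {..k})" by (intro card_mono) auto
  also have "\<dots> \<le> k + 1" using card_image_le[of "{..k}" "\<lambda>i. p ^ i"] by simp
  finally show ?thesis by (simp add: tau_def)
qed

text \<open>Split off prime powers: k + 1 is at most (p ^ k) powr \<delta> once p powr \<delta>
  \<ge> 2, and at most B times that for every prime p. Only primes up to P cost a factor B, and
  there are at most P + 1 of them.\<close>

lemma tau_bound:
  assumes "\<delta> > 0"
  obtains C where "C \<ge> 1" "\<And>n. n > 0 \<Longrightarrow> real (tau n) \<le> C * real n powr \<delta>"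
proof -
  \<comment> \<open>With this B, k + 1 \<le> B * (1 + k * \<delta> * ln 2), and the second factor is
    at most (2 ^ k) powr \<delta>.\<close>
  define B where "B = 1 + 1 / (\<delta> * ln 2)"
  define P where "P = nat \<lceil>2 powr (1 / \<delta>)\<rceil>"
  have B1: "B \<ge> 1" using assms by (simp add: B_def)
  have small: "real (k + 1) \<le> B * (real p ^ k) powr \<delta>" if "p \<ge> 2" for k p :: nat
  proof -
    have "1 + real k * (\<delta> * ln 2) \<le> exp (real k * (\<delta> * ln 2))" by (rule exp_ge_add_one_self)
    also have "\<dots> = (2 ^ k) powr \<delta>" by (simp add: powr_def ln_realpow mult_ac)
    also have "\<dots> \<le> (real p ^ k) powr \<delta>"
      using that assms by (intro powr_mono2 power_mono) auto
    finally have 1: "1 + real k * (\<delta> * ln 2) \<le> (real p ^ k) powr \<delta>" .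
    have "real (k + 1) \<le> B * (1 + real k * (\<delta> * ln 2))"
      using assms by (simp add: B_def field_simps)
    also have "\<dots> \<le> B * (real p ^ k) powr \<delta>" using 1 B1 by (intro mult_left_mono) auto
    finally show ?thesis .
  qed
  have large: "real (k + 1) \<le> (real p ^ k) powr \<delta>" if "p > P" for k p :: nat
  proof -
    have "2 powr (1 / \<delta>) \<le> real p" using that unfolding P_def by linarith
    then have "(2 powr (1 / \<delta>)) powr \<delta> \<le> real p powr \<delta>" using assms by (intro powr_mono2) auto
    then have 2: "2 \<le> real p powr \<delta>" using assms by (simp add: powr_powr)
    have p0: "p > 0" using that by simp
    have "real (k + 1) \<le> 2 ^ k"
      using less_exp[of k] by (metis Suc_eq_plus1 Suc_leI of_nat_le_iff of_nat_numeral of_nat_power)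
    also have "\<dots> \<le> (real p powr \<delta>) ^ k" using 2 by (intro power_mono) auto
    also have "\<dots> = (real p ^ k) powr \<delta>" using p0 by (simp add: powr_power powr_realpow[symmetric] powr_powr mult.commute)
    finally show ?thesis .
  qed
  have main: "real (tau n) \<le> B ^ card (prime_factors n \<inter> {..P}) * real n powr \<delta>" if "n > 0" for n
    using that
  proof (induction n rule: less_induct)
    case (less n)
    show ?case
    proof (cases "n = 1")
      case True then show ?thesis by (simp add: tau_def)
    next
      case False
      then obtain p where p: "prime p" "p dvd n" using prime_factor_nat by blast
      define k where "k = multiplicity p n"
      obtain m where m: "n = p ^ k * m" "\<not> p dvd m"
        using multiplicity_decompose'[of n p] p less.prems unfolding k_def
        by (metis not_prime_unit gr_implies_not0)
      have m0: "m > 0" using m less.prems by (auto intro: Nat.gr0I)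
      have k0: "k \<ge> 1" using m p by (cases k) auto
      have "p ^ k > 1" using one_less_power[OF prime_gt_1_nat[OF p(1)], of k] k0 by simp
      then have mn: "m < n" using m m0 by simp
      have cop: "coprime (p ^ k) m" using m p by (simp add: prime_imp_coprime)
      have pf: "prime_factors n = insert p (prime_factors m)"
      proof -
        have "prime_factors n = prime_factors (p ^ k) \<union> prime_factors m"
          unfolding m(1) using m0 p prime_gt_0_nat[OF p(1)] by (intro prime_factors_product) auto
        then show ?thesis using k0 p by (simp add: prime_factors_power prime_prime_factors)
      qed
      have pm: "p \<notin> prime_factors m" using m by auto
      have "real (tau n) \<le> real (tau (p ^ k)) * real (tau m)"
        using tau_coprime_mult[OF cop] m m0 p prime_gt_0_nat[OF p(1)] by (simp flip: of_nat_mult)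
      also have "\<dots> \<le> real (k + 1) * (B ^ card (prime_factors m \<inter> {..P}) * real m powr \<delta>)"
        using tau_prime_power[OF p(1), of k] less.IH[OF mn m0] by (intro mult_mono) auto
      also have "\<dots> \<le> B ^ card (prime_factors n \<inter> {..P}) * real n powr \<delta>"
      proof (cases "p \<le> P")
        case True
        have "prime_factors n \<inter> {..P} = insert p (prime_factors m \<inter> {..P})" using True pf by auto
        then have c: "card (prime_factors n \<inter> {..P}) = Suc (card (prime_factors m \<inter> {..P}))"
          using pm by simp
        have "real (k + 1) * (B ^ card (prime_factors m \<inter> {..P}) * real m powr \<delta>) \<le>
          (B * (real p ^ k) powr \<delta>) * (B ^ card (prime_factors m \<inter> {..P}) * real m powr \<delta>)"
          using small[of p k] prime_ge_2_nat[OF p(1)] B1 by (intro mult_right_mono) auto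
        also have "\<dots> = B ^ card (prime_factors n \<inter> {..P}) * real n powr \<delta>"
          unfolding c using m by (simp add: powr_mult)
        finally show ?thesis .
      next
        case False
        have c: "prime_factors n \<inter> {..P} = prime_factors m \<inter> {..P}" using False pf by auto
        have "real (k + 1) * (B ^ card (prime_factors m \<inter> {..P}) * real m powr \<delta>) \<le>
          ((real p ^ k) powr \<delta>) * (B ^ card (prime_factors m \<inter> {..P}) * real m powr \<delta>)"
          using large[of p k] False B1 by (intro mult_right_mono) auto
        also have "\<dots> = B ^ card (prime_factors n \<inter> {..P}) * real n powr \<delta>"
          unfolding c using m by (simp add: powr_mult)
        finally show ?thesis .
      qed
      finally show ?thesis .
    qed
  qed
  show thesis
  proof (rule that)
    show "B ^ Suc P \<ge> 1" using B1 by (rule one_le_power)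
    fix n :: nat assume n: "n > 0"
    have "card (prime_factors n \<inter> {..P}) \<le> card {..P}" by (intro card_mono) auto
    then have "B ^ card (prime_factors n \<inter> {..P}) \<le> B ^ Suc P" using B1 by (intro power_increasing) auto
    then have "B ^ card (prime_factors n \<inter> {..P}) * real n powr \<delta> \<le> B ^ Suc P * real n powr \<delta>"
      by (intro mult_right_mono) auto
    with main[OF n] show "real (tau n) \<le> B ^ Suc P * real n powr \<delta>" by linarith
  qed
qed

section \<open>Kloosterman sums\<close>

text \<open>The standard additive character modulo q.\<close>

definition ephase :: "nat \<Rightarrow> int \<Rightarrow> complex" where
  "ephase q k = cis (2 * pi * of_int k / of_nat q)"

lemma ephase_add: "ephase q (k + l) = ephase q k * ephase q l"
  by (simp add: ephase_def cis_mult add_divide_distrib ring_distribs)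

lemma ephase_0 [simp]: "ephase q 0 = 1"
  by (simp add: ephase_def)

lemma norm_ephase [simp]: "norm (ephase q k) = 1"
  by (simp add: ephase_def)

lemma cnj_ephase: "cnj (ephase q k) = ephase q (- k)"
  by (simp add: ephase_def cis_cnj)

lemma ephase_eq_1_iff:
  assumes "q > 0"
  shows "ephase q k = 1 \<longleftrightarrow> int q dvd k"
proof
  assume "ephase q k = 1"
  then have "cos (2 * pi * of_int k / of_nat q) = 1"
    by (metis ephase_def cis.sel(1) one_complex.sel(1))
  then obtain n :: int where "2 * pi * of_int k / of_nat q = of_int n * 2 * pi"
    using cos_one_2pi_int by auto
  then have "real_of_int k = real_of_int (n * int q)"
    using assms by (simp add: field_simps)
  then have "k = n * int q" by (simp only: of_int_eq_iff)
  then show "int q dvd k" by simp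
next
  assume "int q dvd k"
  then obtain n where "k = int q * n" by auto
  then have "2 * pi * of_int k / of_nat q = 2 * pi * of_int n" using assms by simp
  then show "ephase q k = 1" by (simp add: ephase_def cis_multiple_2pi)
qed

lemma ephase_cong:
  assumes "q > 0" "[k = l] (mod int q)"
  shows "ephase q k = ephase q l"
proof -
  have "ephase q (k - l) = 1"
    using assms by (simp add: ephase_eq_1_iff cong_iff_dvd_diff)
  then show ?thesis using ephase_add[of q "k - l" l] by simp
qed

lemma ephase_power: "ephase q k ^ n = ephase q (int n * k)"
  unfolding ephase_def Complex.DeMoivre by (simp add: mult_ac)

lemma sum_ephase_nat:
  "(\<Sum>j<n. ephase q (int j * k)) = (if ephase q k = 1 then of_nat n else (1 - ephase q (int n * k)) / (1 - ephase q k))"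
  using sum_gp_strict[of "ephase q k" n] by (simp add: ephase_power)

lemma sum_ephase_interval:
  "(\<Sum>a\<in>{a0..<a0 + int n}. ephase q (a * k)) = ephase q (a0 * k) * (\<Sum>j<n. ephase q (int j * k))"
proof -
  have "(\<Sum>a\<in>{a0..<a0 + int n}. ephase q (a * k)) = (\<Sum>j<n. ephase q ((a0 + int j) * k))"
    by (intro sum.reindex_bij_witness[of _ "\<lambda>j. a0 + int j" "\<lambda>a. nat (a - a0)"]) auto
  then show ?thesis by (simp add: sum_distrib_left ring_distribs ephase_add)
qed

lemma sum_ephase_complete:
  assumes "q > 0"
  shows "(\<Sum>m\<in>{0..<int q}. ephase q (m * k)) = (if int q dvd k then of_nat q else 0)"
proof -
  have "(\<Sum>m\<in>{0..<int q}. ephase q (m * k)) = (\<Sum>j<q. ephase q (int j * k))"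
    using sum_ephase_interval[of q k 0 q] by simp
  moreover have "ephase q (int q * k) = 1" using assms by (simp add: ephase_eq_1_iff)
  ultimately show ?thesis using assms by (simp add: sum_ephase_nat ephase_eq_1_iff)
qed

text \<open>Orthogonality in both frequencies: in the expanded square a pair (k, l) survives the
  sums over m and n only if f and g both agree on it modulo q. The index set is abstract so that K
  can consist of pairs of hyperbola points.\<close>

lemma sum_norm_ephase_square:
  fixes f g :: "'a \<Rightarrow> int"
  assumes "q > 0" "finite K"
  shows "(\<Sum>m\<in>{0..<int q}. \<Sum>n\<in>{0..<int q}. (cmod (\<Sum>k\<in>K. ephase q (m * f k + n * g k)))\<^sup>2)
    = real q ^ 2 * real (card {(k,l) \<in> K \<times> K. int q dvd f k - f l \<and> int q dvd g k - g l})"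
    (is "?L = ?R")
proof -
  let ?Z = "{0..<int q}"
  have *: "complex_of_real ((cmod (\<Sum>k\<in>K. ephase q (m * f k + n * g k)))\<^sup>2)
     = (\<Sum>k\<in>K. \<Sum>l\<in>K. ephase q (m * (f k - f l)) * ephase q (n * (g k - g l)))" for m n
  proof -
    have "complex_of_real ((cmod (\<Sum>k\<in>K. ephase q (m * f k + n * g k)))\<^sup>2)
      = (\<Sum>k\<in>K. ephase q (m * f k + n * g k)) * cnj (\<Sum>k\<in>K. ephase q (m * f k + n * g k))"
      by (simp only: complex_norm_square)
    also have "\<dots> = (\<Sum>k\<in>K. \<Sum>l\<in>K. ephase q (m * f k + n * g k) * ephase q (- (m * f l + n * g l)))"
      by (simp only: cnj_sum cnj_ephase sum_product)
    also have "\<dots> = (\<Sum>k\<in>K. \<Sum>l\<in>K. ephase q (m * (f k - f l)) * ephase q (n * (g k - g l)))"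
      unfolding ephase_add[symmetric] by (intro sum.cong refl arg_cong[where f = "ephase q"]) (simp add: algebra_simps)
    finally show ?thesis .
  qed
  have "complex_of_real ?L = (\<Sum>m\<in>?Z. \<Sum>n\<in>?Z. \<Sum>k\<in>K. \<Sum>l\<in>K. ephase q (m * (f k - f l)) * ephase q (n * (g k - g l)))"
    by (simp only: of_real_sum *)
  also have "\<dots> = (\<Sum>m\<in>?Z. \<Sum>k\<in>K. \<Sum>n\<in>?Z. \<Sum>l\<in>K. ephase q (m * (f k - f l)) * ephase q (n * (g k - g l)))"
    by (intro sum.cong refl, rule sum.swap)
  also have "\<dots> = (\<Sum>k\<in>K. \<Sum>m\<in>?Z. \<Sum>n\<in>?Z. \<Sum>l\<in>K. ephase q (m * (f k - f l)) * ephase q (n * (g k - g l)))"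
    by (rule sum.swap)
  also have "\<dots> = (\<Sum>k\<in>K. \<Sum>m\<in>?Z. \<Sum>l\<in>K. \<Sum>n\<in>?Z. ephase q (m * (f k - f l)) * ephase q (n * (g k - g l)))"
    by (intro sum.cong refl, rule sum.swap)
  also have "\<dots> = (\<Sum>k\<in>K. \<Sum>l\<in>K. \<Sum>m\<in>?Z. \<Sum>n\<in>?Z. ephase q (m * (f k - f l)) * ephase q (n * (g k - g l)))"
    by (intro sum.cong refl, rule sum.swap)
  also have "\<dots> = (\<Sum>k\<in>K. \<Sum>l\<in>K. (\<Sum>m\<in>?Z. ephase q (m * (f k - f l))) * (\<Sum>n\<in>?Z. ephase q (n * (g k - g l))))"
    by (simp only: sum_product)
  also have "\<dots> = (\<Sum>k\<in>K. \<Sum>l\<in>K. if int q dvd f k - f l \<and> int q dvd g k - g l then of_nat q ^ 2 else 0)"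
    unfolding sum_ephase_complete[OF assms(1)] by (intro sum.cong refl) (simp add: power2_eq_square)
  also have "\<dots> = (\<Sum>p\<in>K \<times> K. if int q dvd f (fst p) - f (snd p) \<and> int q dvd g (fst p) - g (snd p) then of_nat q ^ 2 else 0)"
    by (simp add: sum.cartesian_product case_prod_beta)
  also have "\<dots> = (\<Sum>p\<in>{p\<in>K \<times> K. int q dvd f (fst p) - f (snd p) \<and> int q dvd g (fst p) - g (snd p)}. of_nat q ^ 2)"
    using assms by (intro sum.inter_filter[symmetric]) auto
  also have "{p\<in>K \<times> K. int q dvd f (fst p) - f (snd p) \<and> int q dvd g (fst p) - g (snd p)}
      = {(k,l) \<in> K \<times> K. int q dvd f k - f l \<and> int q dvd g k - g l}" by auto
  also have "(\<Sum>p\<in>{(k,l) \<in> K \<times> K. int q dvd f k - f l \<and> int q dvd g k - g l}. complex_of_nat q ^ 2) = complex_of_real ?R"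
    by simp
  finally show ?thesis by (simp only: of_real_eq_iff)
qed

section \<open>Modular hyperbolas and Kloosterman sums\<close>

definition hyperbola :: "nat \<Rightarrow> int \<Rightarrow> (int \<times> int) set" where
  "hyperbola q u = {(x, y) \<in> {0..<int q} \<times> {0..<int q}. int q dvd x * y - u}"

text \<open>For coprime u and q this is the classical sum over units x with y = u / x modulo q. A
  general u is kept because a neighbour on side s satisfies a * y = - s.\<close>

definition kloosterman :: "nat \<Rightarrow> int \<Rightarrow> int \<Rightarrow> int \<Rightarrow> complex" where
  "kloosterman q u m n = (\<Sum>(x, y) \<in> hyperbola q u. ephase q (m * x + n * y))"

lemma finite_hyperbola [simp]: "finite (hyperbola q u)"
  by (rule finite_subset[of _ "{0..<int q} \<times> {0..<int q}"]) (auto simp: hyperbola_def)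

lemma hyperbola_unit:
  assumes "(x, y) \<in> hyperbola q u" "coprime u (int q)"
  shows "coprime x (int q)" "coprime y (int q)"
proof -
  have "coprime (x * y) (int q)"
  proof -
    have "[x * y = u] (mod int q)" using assms(1) by (auto simp: hyperbola_def cong_iff_dvd_diff)
    then show ?thesis using assms(2) by (metis cong_imp_coprime cong_sym)
  qed
  then show "coprime x (int q)" "coprime y (int q)" by auto
qed

lemma residues_eq:
  fixes x y :: int
  assumes "int q dvd x - y" "x \<in> {0..<int q}" "y \<in> {0..<int q}"
  shows "x = y"
  using assms zdvd_not_zless[of "x - y" "int q"] zdvd_not_zless[of "y - x" "int q"]
  by (metis atLeastLessThan_iff cong_iff_dvd_diff cong_less_imp_eq_int)

lemma unit_mult_cancel:
  fixes x :: int
  assumes "int q dvd x * z" "coprime x (int q)"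
  shows "int q dvd z"
  using assms by (metis coprime_commute coprime_dvd_mult_right_iff)

lemma hyperbola_inj:
  assumes "(x, y) \<in> hyperbola q u" "(x, y') \<in> hyperbola q u" "coprime u (int q)"
  shows "y = y'"
proof (rule residues_eq)
  have "int q dvd x * y - u" "int q dvd x * y' - u" using assms by (auto simp: hyperbola_def)
  then have "int q dvd (x * y - u) - (x * y' - u)" by (rule dvd_diff)
  then have "int q dvd x * (y - y')" by (simp add: algebra_simps)
  then show "int q dvd y - y'" using hyperbola_unit(1)[OF assms(1,3)] by (rule unit_mult_cancel)
qed (use assms in \<open>auto simp: hyperbola_def\<close>)

lemma hyperbola_ex:
  assumes "q > 0" "coprime x (int q)"
  obtains y where "y \<in> {0..<int q}" "int q dvd x * y - u"
proof -
  obtain z where z: "[x * z = 1] (mod int q)"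
    using assms(2) cong_solve_coprime_int by blast
  have "[x * ((z * u) mod int q) = x * (z * u)] (mod int q)"
    by (intro cong_mult cong_refl) (simp add: cong_def)
  also have "[x * (z * u) = 1 * u] (mod int q)" unfolding mult.assoc[symmetric]
    using z by (intro cong_mult cong_refl)
  finally show thesis using assms by (intro that[of "(z * u) mod int q"]) (auto simp: cong_iff_dvd_diff)
qed

lemma card_hyperbola:
  assumes "q > 0" "coprime u (int q)"
  shows "card (hyperbola q u) = totient q"
\<comment> \<open>For q = 1 the only residue is 0 while \<open>totatives 1\<close> is {1}, so the
  projection used below would miss it.\<close>
proof (cases "q = 1")
  case True
  have "hyperbola q u = {(0, 0)}" unfolding True by (auto simp: hyperbola_def)
  then show ?thesis using True by simp
next
  case False
  have "bij_betw (\<lambda>(x, y). nat x) (hyperbola q u) (totatives q)"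
    unfolding bij_betw_def
  proof
    show "inj_on (\<lambda>(x, y). nat x) (hyperbola q u)"
    proof (rule inj_onI, clarify)
      fix x y x' y' assume *: "(x, y) \<in> hyperbola q u" "(x', y') \<in> hyperbola q u" "nat x = nat x'"
      then have "x = x'" by (auto simp: hyperbola_def)
      with * show "x = x' \<and> y = y'" using hyperbola_inj assms by auto
    qed
    show "(\<lambda>(x, y). nat x) ` hyperbola q u = totatives q"
    proof (intro Set.set_eqI iffI)
      fix a assume "a \<in> (\<lambda>(x, y). nat x) ` hyperbola q u"
      then obtain x y where xy: "(x, y) \<in> hyperbola q u" "a = nat x" by auto
      have "0 \<le> x" "x < int q" using xy by (auto simp: hyperbola_def)
      then have xa: "x = int a" using xy by simp
      have "coprime a q" using hyperbola_unit(1)[OF xy(1) assms(2)] xa by simp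
      moreover from this have "a > 0" using False by (intro Nat.gr0I) auto
      ultimately show "a \<in> totatives q" using \<open>x < int q\<close> xa by (simp add: totatives_def)
    next
      fix a assume "a \<in> totatives q"
      then have a: "coprime (int a) (int q)" "0 < a" "a \<le> q" by (auto simp: totatives_def)
      have "a \<noteq> q" using a False by auto
      obtain y where "y \<in> {0..<int q}" "int q dvd int a * y - u" using hyperbola_ex[OF assms(1) a(1)] by blast
      then have "(int a, y) \<in> hyperbola q u" using a \<open>a \<noteq> q\<close> by (auto simp: hyperbola_def)
      then show "a \<in> (\<lambda>(x, y). nat x) ` hyperbola q u" by (intro image_eqI[of _ _ "(int a, y)"]) auto
    qed
  qed
  then show ?thesis by (simp add: bij_betw_same_card totient_def)
qed

lemma kloosterman_cong:
  assumes "q > 0" "[m = m'] (mod int q)" "[n = n'] (mod int q)"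
  shows "kloosterman q u m n = kloosterman q u m' n'"
  unfolding kloosterman_def
  by (intro sum.cong refl) (auto intro!: ephase_cong cong_add cong_mult assms)

lemma kloosterman_swap: "kloosterman q u m n = kloosterman q u n m"
  unfolding kloosterman_def
  by (rule sum.reindex_bij_witness[of _ prod.swap prod.swap]) (auto simp: hyperbola_def mult.commute add.commute)

text \<open>Substituting \<open>(x, y) \<mapsto> (a x, b y)\<close> with \<open>a b = 1\<close> permutes the hyperbola.\<close>

lemma kloosterman_scale:
  assumes "q > 0" "(a, b) \<in> hyperbola q 1"
  shows "kloosterman q u (m * a) (n * b) = kloosterman q u m n"
  unfolding kloosterman_def
proof (rule sum.reindex_bij_witness[of _ "\<lambda>(x, y). (b * x mod int q, a * y mod int q)" "\<lambda>(x, y). (a * x mod int q, b * y mod int q)"])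
  have ab: "[a * b = 1] (mod int q)" using assms by (auto simp: hyperbola_def cong_iff_dvd_diff)
  have mem: "(c * x mod int q, d * y mod int q) \<in> hyperbola q u" if "(x, y) \<in> hyperbola q u" "[c * d = 1] (mod int q)" for c d x y
  proof -
    have "[(c * x mod int q) * (d * y mod int q) = (c * x) * (d * y)] (mod int q)"
      by (intro cong_mult) (auto simp: cong_def)
    also have "(c * x) * (d * y) = (c * d) * (x * y)" by (simp add: mult_ac)
    also have "[(c * d) * (x * y) = 1 * u] (mod int q)"
      using that by (intro cong_mult) (auto simp: hyperbola_def cong_iff_dvd_diff)
    finally show ?thesis using assms by (simp add: hyperbola_def cong_iff_dvd_diff)
  qed
  have unscale: "c * (d * x mod int q) mod int q = x" if "0 \<le> x" "x < int q" "[c * d = 1] (mod int q)" for c d x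
  proof -
    have "[c * (d * x mod int q) = c * (d * x)] (mod int q)" by (intro cong_mult cong_refl) (auto simp: cong_def)
    also have "c * (d * x) = (c * d) * x" by simp
    also have "[(c * d) * x = 1 * x] (mod int q)" using that by (intro cong_mult cong_refl)
    finally have "c * (d * x mod int q) mod int q = x mod int q" by (simp only: Cong.cong_def mult_1)
    then show ?thesis using that(1,2) by simp
  qed
  have ba: "[b * a = 1] (mod int q)" using ab by (simp add: mult.commute)
  fix p assume p: "p \<in> hyperbola q u"
  obtain x y where xy: "p = (x, y)" by fastforce
  show "(\<lambda>(x, y). (b * x mod int q, a * y mod int q)) ((\<lambda>(x, y). (a * x mod int q, b * y mod int q)) p) = p"
    "(\<lambda>(x, y). (a * x mod int q, b * y mod int q)) ((\<lambda>(x, y). (b * x mod int q, a * y mod int q)) p) = p"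
    using p unscale ab ba unfolding xy by (auto simp: hyperbola_def)
  show "(\<lambda>(x, y). (a * x mod int q, b * y mod int q)) p \<in> hyperbola q u"
    and "(\<lambda>(x, y). (b * x mod int q, a * y mod int q)) p \<in> hyperbola q u"
    using p mem ab ba unfolding xy by auto
  have "ephase q (m * (a * x mod int q) + n * (b * y mod int q)) = ephase q (m * (a * x) + n * (b * y))"
    by (intro ephase_cong assms cong_add cong_mult cong_refl) (auto simp: cong_def)
  then show "(case (\<lambda>(x, y). (a * x mod int q, b * y mod int q)) p of (x, y) \<Rightarrow> ephase q (m * x + n * y)) =
      (case p of (x, y) \<Rightarrow> ephase q (m * a * x + n * b * y))"
    unfolding xy by (simp add: mult.assoc)
qed

section \<open>Fourth moment through additive energy\<close>

lemma card_dvd_mult_le: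
  assumes "q > 0"
  shows "int (card {w \<in> {0..<int q}. int q dvd k * w}) \<le> gcd k (int q)"
proof -
  have gne: "gcd k (int q) \<noteq> 0" using assms by simp
  obtain k' q' where kq: "k = k' * gcd k (int q)" "int q = q' * gcd k (int q)" "coprime k' q'"
    using gcd_coprime_exists[OF gne] by blast
  define g where "g = nat (gcd k (int q))"
  have g: "int g = gcd k (int q)" by (simp add: g_def)
  have g0: "g > 0" using gne g by (intro Nat.gr0I) auto
  define r where "r = nat q'"
  have "q' > 0" using kq(2) g g0 assms by (metis of_nat_0_less_iff zero_less_mult_pos2)
  then have r: "int r = q'" "r > 0" by (simp_all add: r_def)
  have qr: "q = g * r" using kq(2) g r(1) by (metis mult.commute of_nat_eq_iff of_nat_mult)
  have "{w \<in> {0..<int q}. int q dvd k * w} \<subseteq> {w \<in> {0..<int q}. int r dvd w}"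
  proof safe
    fix w assume "int q dvd k * w"
    then have "q' * gcd k (int q) dvd k' * gcd k (int q) * w" using kq(1,2) by metis
    then have "gcd k (int q) * q' dvd gcd k (int q) * (k' * w)" by (simp add: mult_ac)
    then have "q' dvd k' * w" using gne by (metis dvd_mult_cancel_left)
    then have "q' dvd w" using kq(3) by (metis coprime_commute coprime_dvd_mult_right_iff)
    then show "int r dvd w" using r by simp
  qed
  moreover have "finite {w \<in> {0..<int q}. int r dvd w}"
    by (rule finite_subset[of _ "{0..<int q}"]) auto
  ultimately have "card {w \<in> {0..<int q}. int q dvd k * w} \<le> card {w \<in> {0..<int q}. int r dvd w}"
    by (intro card_mono)
  also have "\<dots> \<le> q div r" using r qr by (intro card_multiples_le) auto
  also have "\<dots> = g" using r qr by simp
  finally show ?thesis using g by simp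
qed

text \<open>The solutions, if any, form a translate of the kernel of multiplication by k, which
  \<open>card_dvd_mult_le\<close> counts.\<close>

lemma card_cong_le:
  assumes "q > 0"
  shows "int (card {w \<in> {0..<int q}. [k * w = c] (mod int q)}) \<le> gcd k (int q)"
proof (cases "{w \<in> {0..<int q}. [k * w = c] (mod int q)} = {}")
  case True
  show ?thesis unfolding True by simp
next
  case False
  then obtain w0 where w0: "0 \<le> w0" "w0 < int q" "[k * w0 = c] (mod int q)" by auto
  have "card {w \<in> {0..<int q}. [k * w = c] (mod int q)} \<le> card {w \<in> {0..<int q}. int q dvd k * w}"
  proof (rule card_inj_on_le)
    show "inj_on (\<lambda>w. (w - w0) mod int q) {w \<in> {0..<int q}. [k * w = c] (mod int q)}"
    proof (rule inj_onI, clarify)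
      fix w w' assume *: "w \<in> {0..<int q}" "w' \<in> {0..<int q}" "(w - w0) mod int q = (w' - w0) mod int q"
      then have "int q dvd (w - w0) - (w' - w0)" by (simp only: mod_eq_dvd_iff)
      then have "int q dvd w - w'" by simp
      then show "w = w'" using * residues_eq by blast
    qed
    show "(\<lambda>w. (w - w0) mod int q) ` {w \<in> {0..<int q}. [k * w = c] (mod int q)} \<subseteq> {w \<in> {0..<int q}. int q dvd k * w}"
    proof clarify
      fix w assume w: "[k * w = c] (mod int q)"
      have "[k * ((w - w0) mod int q) = k * (w - w0)] (mod int q)"
        by (intro cong_mult cong_refl) (simp add: cong_def)
      also have "k * (w - w0) = k * w - k * w0" by (simp add: algebra_simps)
      also have "[k * w - k * w0 = c - c] (mod int q)" by (intro cong_diff w w0)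
      finally show "(w - w0) mod int q \<in> {0..<int q} \<and> int q dvd k * ((w - w0) mod int q)"
        using assms by (simp add: cong_0_iff)
    qed
    show "finite {w \<in> {0..<int q}. int q dvd k * w}"
      by (rule finite_subset[of _ "{0..<int q}"]) auto
  qed
  then show ?thesis using card_dvd_mult_le[OF assms, of k] by linarith
qed

text \<open>For given x and y the number of w is at most gcd (x * y) q, which divides gcd x q * gcd
  y q; the resulting double sum factors.\<close>

lemma card_triple_product_le:
  assumes "q > 0"
  shows "card {(x, y, w) \<in> {0..<int q} \<times> {0..<int q} \<times> {0..<int q}. int q dvd x * y * w} \<le> (q * tau q) ^ 2"
proof -
  let ?Z = "{0..<int q}"
  define W where "W x y = {w \<in> ?Z. int q dvd x * y * w}" for x y
  have fin: "finite (W x y)" for x y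
    by (rule finite_subset[of _ ?Z]) (auto simp: W_def)
  have eq: "{(x, y, w) \<in> ?Z \<times> ?Z \<times> ?Z. int q dvd x * y * w}
      = (SIGMA x:?Z. SIGMA y:?Z. W x y)" by (auto simp: W_def)
  have "int (card {(x, y, w) \<in> ?Z \<times> ?Z \<times> ?Z. int q dvd x * y * w})
      = (\<Sum>x\<in>?Z. \<Sum>y\<in>?Z. int (card (W x y)))"
    unfolding eq by (simp add: fin)
  also have "\<dots> \<le> (\<Sum>x\<in>?Z. \<Sum>y\<in>?Z. gcd x (int q) * gcd y (int q))"
  proof (intro sum_mono)
    fix x y :: int
    have "int (card (W x y)) \<le> gcd (x * y) (int q)"
      unfolding W_def by (rule card_dvd_mult_le[OF assms])
    also have "\<dots> \<le> gcd x (int q) * gcd y (int q)"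
    proof (rule zdvd_imp_le)
      show "gcd (x * y) (int q) dvd gcd x (int q) * gcd y (int q)"
      proof -
        have "gcd (x * y) (int q) dvd gcd (x * y) (int q * y)" by (simp add: dvd_mult2)
        also have "gcd (x * y) (int q * y) dvd gcd x (int q) * y" by (simp add: gcd_mult_right)
        finally have "gcd (x * y) (int q) dvd gcd (gcd x (int q) * y) (gcd x (int q) * int q)" by simp
        then show ?thesis by (simp add: gcd_mult_left)
      qed
      show "0 < gcd x (int q) * gcd y (int q)" using assms by simp
    qed
    finally show "int (card (W x y)) \<le> gcd x (int q) * gcd y (int q)" .
  qed
  also have "\<dots> = (\<Sum>x\<in>?Z. gcd x (int q)) * (\<Sum>y\<in>?Z. gcd y (int q))" by (simp only: sum_product)
  also have "\<dots> \<le> (int q * int (tau q)) * (int q * int (tau q))"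
    using sum_gcd_le[OF assms] by (intro mult_mono sum_nonneg) auto
  also have "\<dots> = int ((q * tau q) ^ 2)" by (simp add: power2_eq_square)
  finally show ?thesis by (simp only: of_nat_le_iff)
qed

text \<open>
  On the hyperbola \<open>x y = u\<close> the two congruences below force
  \<open>(x1 + x2) (x1 - x3) (x2 - x3) = 0\<close>, because \<open>x1 x2 - x3 x4 = (x1 - x3) (x2 - x3)\<close>
  once \<open>x4 = x1 + x2 - x3\<close>.
\<close>

lemma hyperbola_energy_dvd:
  fixes x1 x2 x3 x4 y1 y2 y3 y4 u k :: int
  assumes "k dvd x1 * y1 - u" "k dvd x2 * y2 - u" "k dvd x3 * y3 - u" "k dvd x4 * y4 - u"
    and "k dvd (x1 + x2) - (x3 + x4)" "k dvd (y1 + y2) - (y3 + y4)" "coprime u k"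
  shows "k dvd (x1 - x3) * (x2 - x3) * (x1 + x2)"
proof -
  obtain a1 where a1: "x1 * y1 - u = k * a1" using assms(1) by (rule dvdE)
  obtain a2 where a2: "x2 * y2 - u = k * a2" using assms(2) by (rule dvdE)
  obtain a3 where a3: "x3 * y3 - u = k * a3" using assms(3) by (rule dvdE)
  obtain a4 where a4: "x4 * y4 - u = k * a4" using assms(4) by (rule dvdE)
  obtain s where s: "(x1 + x2) - (x3 + x4) = k * s" using assms(5) by (rule dvdE)
  obtain r where r: "(y1 + y2) - (y3 + y4) = k * r" using assms(6) by (rule dvdE)
  have u: "u = x1 * y1 - k * a1" "u = x2 * y2 - k * a2" "u = x3 * y3 - k * a3" "u = x4 * y4 - k * a4"
    using a1 a2 a3 a4 by auto
  define M A B where "M = x1 * x2 * x3 * x4" and "A = (a1 * x2 + a2 * x1) * x3 * x4"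
    and "B = (a3 * x4 + a4 * x3) * x1 * x2"
  have P: "u * (x1 + x2) * x3 * x4 = M * (y1 + y2) - k * A"
  proof -
    have "M * (y1 + y2) - k * A = (x2 * y2 - k * a2) * x1 * x3 * x4 + (x1 * y1 - k * a1) * x2 * x3 * x4"
      by (simp add: M_def A_def algebra_simps)
    then show ?thesis unfolding u(1,2)[symmetric] by (simp add: algebra_simps)
  qed
  have Q: "u * (x3 + x4) * x1 * x2 = M * (y3 + y4) - k * B"
  proof -
    have "M * (y3 + y4) - k * B = (x4 * y4 - k * a4) * x3 * x1 * x2 + (x3 * y3 - k * a3) * x4 * x1 * x2"
      by (simp add: M_def B_def algebra_simps)
    then show ?thesis unfolding u(3,4)[symmetric] by (simp add: algebra_simps)
  qed
  have "u * ((x1 + x2) * (x1 * x2 - x3 * x4))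
      = u * (x3 + x4) * x1 * x2 - u * (x1 + x2) * x3 * x4 + u * x1 * x2 * ((x1 + x2) - (x3 + x4))"
    by (simp add: algebra_simps)
  also have "\<dots> = (M * (y3 + y4) - k * B) - (M * (y1 + y2) - k * A) + u * x1 * x2 * (k * s)"
    unfolding P Q s ..
  also have "\<dots> = k * (A - B + u * x1 * x2 * s) - M * ((y1 + y2) - (y3 + y4))"
    by (simp add: algebra_simps)
  also have "\<dots> = k * (A - B + u * x1 * x2 * s - M * r)"
    unfolding r by (simp add: algebra_simps)
  finally have "k dvd u * ((x1 + x2) * (x1 * x2 - x3 * x4))" by simp
  then have "k dvd (x1 + x2) * (x1 * x2 - x3 * x4)"
    using assms(7) by (metis coprime_commute coprime_dvd_mult_right_iff)
  then have "k dvd (x1 + x2) * (x1 * x2 - x3 * x4) - x3 * (x1 + x2) * ((x1 + x2) - (x3 + x4))"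
    by (rule dvd_diff) (rule dvd_mult[OF assms(5)])
  also have "(x1 + x2) * (x1 * x2 - x3 * x4) - x3 * (x1 + x2) * ((x1 + x2) - (x3 + x4))
      = (x1 - x3) * (x2 - x3) * (x1 + x2)"
    by (simp add: algebra_simps)
  finally show ?thesis .
qed

text \<open>The additive energy of the hyperbola: quadruples of its points with P1 + P2 = P3 + P4
  modulo q in both coordinates. The nesting as a pair of pairs fits
  \<open>sum_norm_ephase_square\<close>, with K the pairs of points.\<close>

definition energy_set :: "nat \<Rightarrow> int \<Rightarrow> (((int \<times> int) \<times> (int \<times> int)) \<times> ((int \<times> int) \<times> (int \<times> int))) set" where
  "energy_set q u = {(((x1,y1),(x2,y2)),((x3,y3),(x4,y4))) \<in> (hyperbola q u \<times> hyperbola q u) \<times> (hyperbola q u \<times> hyperbola q u).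
     int q dvd (x1 + x2) - (x3 + x4) \<and> int q dvd (y1 + y2) - (y3 + y4)}"

text \<open>A quadruple is encoded by the residues of x1 - x3, x2 - x3 and x1 + x2, whose product
  vanishes by \<open>hyperbola_energy_dvd\<close>, and by one bit. The bit accounts for the factor
  2.\<close>

lemma card_energy_set:
  assumes "q > 0" "coprime u (int q)"
  shows "card (energy_set q u) \<le> 2 * (q * tau q) ^ 2"
proof -
  let ?Z = "{0..<int q}"
  let ?T = "{(x, y, w) \<in> ?Z \<times> ?Z \<times> ?Z. int q dvd x * y * w} \<times> (UNIV :: bool set)"
  \<comment> \<open>The three residues determine only 2 * x3 modulo q, which for even q leaves two
    candidates differing by q / 2. The bit tells in which half of the period x3 lies.\<close>
  let ?f = "\<lambda>(((x1::int,y1::int),(x2::int,y2::int)),((x3::int,y3::int),(x4::int,y4::int))).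
     (((x1 - x3) mod int q, (x2 - x3) mod int q, (x1 + x2) mod int q), 2 * x3 < int q)"
  have "card (energy_set q u) \<le> card ?T"
  proof (rule card_inj_on_le)
    show "inj_on ?f (energy_set q u)"
    proof (rule inj_onI)
      fix p p' assume pp: "p \<in> energy_set q u" "p' \<in> energy_set q u" "?f p = ?f p'"
      obtain x1 y1 x2 y2 x3 y3 x4 y4 where p: "p = (((x1,y1),(x2,y2)),((x3,y3),(x4,y4)))"
        by (metis surj_pair)
      obtain x1' y1' x2' y2' x3' y3' x4' y4' where p': "p' = (((x1',y1'),(x2',y2')),((x3',y3'),(x4',y4')))"
        by (metis surj_pair)
      have A: "(((x1,y1),(x2,y2)),((x3,y3),(x4,y4))) \<in> energy_set q u"
        and B: "(((x1',y1'),(x2',y2')),((x3',y3'),(x4',y4'))) \<in> energy_set q u"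
        and C: "(x1 - x3) mod int q = (x1' - x3') mod int q" "(x2 - x3) mod int q = (x2' - x3') mod int q"
          "(x1 + x2) mod int q = (x1' + x2') mod int q" "(2 * x3 < int q) = (2 * x3' < int q)"
        using pp by (simp_all add: p p')
      have Z: "x1 \<in> ?Z" "x2 \<in> ?Z" "x3 \<in> ?Z" "x4 \<in> ?Z" "x1' \<in> ?Z" "x2' \<in> ?Z" "x3' \<in> ?Z" "x4' \<in> ?Z"
        using A B by (auto simp: energy_set_def hyperbola_def)
      have d: "int q dvd (x1 - x3) - (x1' - x3')" "int q dvd (x2 - x3) - (x2' - x3')"
          "int q dvd (x1 + x2) - (x1' + x2')" using C by (simp_all only: mod_eq_dvd_iff)
      have s: "int q dvd (x1 + x2) - (x3 + x4)" "int q dvd (x1' + x2') - (x3' + x4')"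
        using A B by (auto simp: energy_set_def)
      have "int q dvd ((x1 + x2) - (x1' + x2')) - ((x1 - x3) - (x1' - x3')) - ((x2 - x3) - (x2' - x3'))"
        by (intro dvd_diff d)
      then have "int q dvd 2 * x3 - 2 * x3'" by (simp add: algebra_simps)
      then have "\<bar>2 * x3 - 2 * x3'\<bar> < int q \<Longrightarrow> 2 * x3 - 2 * x3' = 0"
        using dvd_imp_le_int[of "2 * x3 - 2 * x3'" "int q"] by fastforce
      moreover have "\<bar>2 * x3 - 2 * x3'\<bar> < int q" using C(4) Z by auto
      ultimately have e3: "x3 = x3'" by simp
      have e1: "x1 = x1'" using d(1) e3 Z by (intro residues_eq[of q]) auto
      have e2: "x2 = x2'" using d(2) e3 Z by (intro residues_eq[of q]) auto
      have "int q dvd ((x1 + x2) - (x3 + x4)) - ((x1' + x2') - (x3' + x4'))" by (intro dvd_diff s)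
      then have "int q dvd x4' - x4" using e1 e2 e3 by simp
      then have e4: "x4 = x4'" using Z residues_eq by metis
      have "y1 = y1'" "y2 = y2'" "y3 = y3'" "y4 = y4'"
        using A B hyperbola_inj[OF _ _ assms(2)] unfolding e1 e2 e3 e4 energy_set_def by fast+
      then show "p = p'" using e1 e2 e3 e4 by (simp add: p p')
    qed
    show "?f ` energy_set q u \<subseteq> ?T"
    proof (rule image_subsetI)
      fix p assume "p \<in> energy_set q u"
      moreover obtain x1 y1 x2 y2 x3 y3 x4 y4 where p: "p = (((x1,y1),(x2,y2)),((x3,y3),(x4,y4)))"
        by (metis surj_pair)
      ultimately have "int q dvd (x1 - x3) * (x2 - x3) * (x1 + x2)"
        by (intro hyperbola_energy_dvd[of _ _ y1 u _ y2 _ y3 x4 y4] assms) (auto simp: energy_set_def hyperbola_def)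
      moreover have "[((x1 - x3) mod int q) * ((x2 - x3) mod int q) * ((x1 + x2) mod int q) = (x1 - x3) * (x2 - x3) * (x1 + x2)] (mod int q)"
        by (intro cong_mult) (auto simp: cong_def)
      ultimately have "int q dvd ((x1 - x3) mod int q) * ((x2 - x3) mod int q) * ((x1 + x2) mod int q)"
        using cong_dvd_iff by blast
      then show "?f p \<in> ?T"
        using assms by (simp add: p)
    qed
    show "finite ?T"
      by (rule finite_subset[of _ "({0..<int q} \<times> {0..<int q} \<times> {0..<int q}) \<times> UNIV"]) auto
  qed
  also have "\<dots> \<le> 2 * (q * tau q) ^ 2"
    using card_triple_product_le[OF assms(1)] by (simp add: card_cartesian_product)
  finally show ?thesis .
qed

text \<open>The fourth power is the squared modulus of the square, and the square is an exponential
  sum over pairs of hyperbola points. Orthogonality turns its second moment into the additive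
  energy.\<close>

lemma kloosterman_fourth_moment:
  assumes "q > 0" "coprime u (int q)"
  shows "(\<Sum>m\<in>{0..<int q}. \<Sum>n\<in>{0..<int q}. cmod (kloosterman q u m n) ^ 4) \<le> 2 * real q ^ 4 * real (tau q) ^ 2"
proof -
  let ?K = "hyperbola q u \<times> hyperbola q u"
  have sq: "kloosterman q u m n ^ 2 =
      (\<Sum>p\<in>?K. ephase q (m * (fst (fst p) + fst (snd p)) + n * (snd (fst p) + snd (snd p))))" for m n
  proof -
    have "kloosterman q u m n ^ 2 = (\<Sum>p\<in>hyperbola q u. \<Sum>p'\<in>hyperbola q u.
        ephase q (m * fst p + n * snd p) * ephase q (m * fst p' + n * snd p'))"
      unfolding power2_eq_square kloosterman_def by (simp only: sum_product case_prod_beta)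
    then show ?thesis unfolding sum.cartesian_product case_prod_beta ephase_add[symmetric]
      by (simp add: algebra_simps)
  qed
  have "(\<Sum>m\<in>{0..<int q}. \<Sum>n\<in>{0..<int q}. cmod (kloosterman q u m n) ^ 4)
     = (\<Sum>m\<in>{0..<int q}. \<Sum>n\<in>{0..<int q}. (cmod (kloosterman q u m n ^ 2))\<^sup>2)"
    by (simp add: norm_power flip: power_mult)
  also have "\<dots> = real q ^ 2 * real (card {(k,l) \<in> ?K \<times> ?K. int q dvd (fst (fst k) + fst (snd k)) - (fst (fst l) + fst (snd l))
      \<and> int q dvd (snd (fst k) + snd (snd k)) - (snd (fst l) + snd (snd l))})"
    unfolding sq by (rule sum_norm_ephase_square) (use assms in auto)
  also have "{(k,l) \<in> ?K \<times> ?K. int q dvd (fst (fst k) + fst (snd k)) - (fst (fst l) + fst (snd l))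
      \<and> int q dvd (snd (fst k) + snd (snd k)) - (snd (fst l) + snd (snd l))} = energy_set q u"
    unfolding energy_set_def by auto
  also have "real q ^ 2 * real (card (energy_set q u)) \<le> real q ^ 2 * real (2 * (q * tau q) ^ 2)"
    using card_energy_set[OF assms] by (intro mult_left_mono) (simp_all only: of_nat_le_iff, auto)
  also have "\<dots> = 2 * real q ^ 4 * real (tau q) ^ 2" by (simp add: power_mult_distrib) algebra
  finally show ?thesis .
qed

text \<open>Kloosterman's averaging trick: \<open>totient q\<close> scalings (m * a, n * b) leave
  the sum unchanged, so its value recurs in the complete fourth moment. A pair (c, d) is hit at most
  gcd m q times, because a solves m * a = c and determines b.\<close>

lemma kloosterman_fourth_power:
  assumes "q > 0" "coprime u (int q)"
  shows "real (totient q) * cmod (kloosterman q u m n) ^ 4 \<le> of_int (gcd m (int q)) * (2 * real q ^ 4 * real (tau q) ^ 2)"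
proof -
  let ?Z = "{0..<int q}"
  let ?S = "\<lambda>m n. cmod (kloosterman q u m n) ^ 4"
  let ?F = "\<lambda>(a, b). (m * a mod int q, n * b mod int q)"
  have "real (totient q) * ?S m n = (\<Sum>p\<in>hyperbola q 1. ?S m n)"
    using card_hyperbola[OF assms(1), of 1] by simp
  also have "\<dots> = (\<Sum>p\<in>hyperbola q 1. case_prod ?S (?F p))"
  proof (intro sum.cong refl)
    fix p assume "p \<in> hyperbola q 1"
    moreover obtain a b where p: "p = (a, b)" by fastforce
    ultimately have "kloosterman q u (m * a) (n * b) = kloosterman q u m n"
      using kloosterman_scale[OF assms(1)] by simp
    moreover have "kloosterman q u (m * a) (n * b) = kloosterman q u (m * a mod int q) (n * b mod int q)"
      using assms by (intro kloosterman_cong) (auto simp: cong_def)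
    ultimately show "?S m n = case_prod ?S (?F p)" by (simp add: p)
  qed
  also have "\<dots> = (\<Sum>z\<in>?Z \<times> ?Z. \<Sum>p\<in>{p\<in>hyperbola q 1. ?F p = z}. case_prod ?S (?F p))"
    by (rule sum.group[symmetric]) (use assms in auto)
  also have "\<dots> = (\<Sum>z\<in>?Z \<times> ?Z. real (card {p\<in>hyperbola q 1. ?F p = z}) * case_prod ?S z)"
    by (intro sum.cong refl) simp
  also have "\<dots> \<le> (\<Sum>z\<in>?Z \<times> ?Z. of_int (gcd m (int q)) * case_prod ?S z)"
  proof (intro sum_mono mult_right_mono)
    fix z assume "z \<in> ?Z \<times> ?Z"
    then obtain c d where z: "z = (c, d)" "0 \<le> c" "c < int q" by auto
    have "card {p\<in>hyperbola q 1. ?F p = z} \<le> card {w \<in> ?Z. [m * w = c] (mod int q)}"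
    proof (rule card_inj_on_le)
      show "inj_on fst {p\<in>hyperbola q 1. ?F p = z}"
      proof (rule inj_onI)
        fix p p' assume "p \<in> {p\<in>hyperbola q 1. ?F p = z}" "p' \<in> {p\<in>hyperbola q 1. ?F p = z}" "fst p = fst p'"
        then have p: "p \<in> hyperbola q 1" "p' \<in> hyperbola q 1" by simp_all
        have "(fst p, snd p) \<in> hyperbola q 1" using p by simp
        moreover have "(fst p, snd p') \<in> hyperbola q 1" unfolding \<open>fst p = fst p'\<close> using p by simp
        ultimately have "snd p = snd p'" by (rule hyperbola_inj) simp
        then show "p = p'" using \<open>fst p = fst p'\<close> by (simp add: prod_eq_iff)
      qed
      show "finite {w \<in> ?Z. [m * w = c] (mod int q)}" by (rule finite_subset[of _ ?Z]) auto
      show "fst ` {p\<in>hyperbola q 1. ?F p = z} \<subseteq> {w \<in> ?Z. [m * w = c] (mod int q)}"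
        using z by (auto simp: hyperbola_def Cong.cong_def)
    qed
    then have "int (card {p\<in>hyperbola q 1. ?F p = z}) \<le> gcd m (int q)"
      using card_cong_le[OF assms(1), of m c] by linarith
    then have "real_of_int (int (card {p\<in>hyperbola q 1. ?F p = z})) \<le> of_int (gcd m (int q))"
      by (simp only: of_int_le_iff)
    then show "real (card {p\<in>hyperbola q 1. ?F p = z}) \<le> of_int (gcd m (int q))"
      by (simp only: of_int_of_nat_eq)
  qed (auto simp: case_prod_beta)
  also have "\<dots> = of_int (gcd m (int q)) * (\<Sum>m\<in>?Z. \<Sum>n\<in>?Z. ?S m n)"
    by (simp only: sum_distrib_left sum.cartesian_product case_prod_beta)
  also have "\<dots> \<le> of_int (gcd m (int q)) * (2 * real q ^ 4 * real (tau q) ^ 2)"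
    using kloosterman_fourth_moment[OF assms] by (intro mult_left_mono) auto
  finally show ?thesis .
qed

lemma kloosterman_bound:
  assumes "q > 0" "coprime u (int q)"
  shows "cmod (kloosterman q u m n) \<le> 2 * of_int (gcd m (int q)) * real q powr (3/4) * real (tau q)"
proof -
  let ?S = "cmod (kloosterman q u m n)" and ?g = "real_of_int (gcd m (int q))"
  have g1: "?g \<ge> 1" using assms by (metis gcd_pos_int int_one_le_iff_zero_less of_int_1 of_int_le_iff of_nat_0_less_iff less_irrefl)
  have t1: "real (tau q) \<ge> 1" using tau_pos[OF assms(1)] by simp
  have "real q * ?S ^ 4 \<le> real (totient q * tau q) * ?S ^ 4"
    using le_totient_tau[of q] by (intro mult_right_mono) (simp_all only: of_nat_le_iff, auto)
  also have "\<dots> = real (tau q) * (real (totient q) * ?S ^ 4)" by simp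
  also have "\<dots> \<le> real (tau q) * (?g * (2 * real q ^ 4 * real (tau q) ^ 2))"
    using kloosterman_fourth_power[OF assms] by (intro mult_left_mono) auto
  also have "\<dots> = real q * (2 * ?g * real q ^ 3 * real (tau q) ^ 3)"
    by (simp add: power2_eq_square power3_eq_cube power4_eq_xxxx)
  finally have "?S ^ 4 \<le> 2 * ?g * real q ^ 3 * real (tau q) ^ 3" using assms(1) by simp
  \<comment> \<open>The factor 2, the gcd and \<open>tau\<close> are rounded up to fourth powers, so
    that only q keeps a fractional exponent when the root is taken.\<close>
  also have "\<dots> \<le> 2 ^ 4 * ?g ^ 4 * real q ^ 3 * real (tau q) ^ 4"
    using g1 t1 assms(1) by (intro mult_mono power_increasing self_le_power) auto
  also have "real q ^ 3 = (real q powr (3/4)) ^ 4"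
    using assms(1) by (simp add: powr_power)
  also have "2 ^ 4 * ?g ^ 4 * (real q powr (3/4)) ^ 4 * real (tau q) ^ 4 = (2 * ?g * real q powr (3/4) * real (tau q)) ^ 4"
    by (simp only: power_mult_distrib)
  finally show ?thesis using g1 by (subst (asm) power_mono_iff) auto
qed

section \<open>Completion: hyperbola points in a box\<close>

lemma sin_pi_ge:
  assumes "0 \<le> x" "x \<le> 1/2"
  shows "sin (pi * x) \<ge> 2 * x"
proof -
  \<comment> \<open>The sine is concave, so its chord from 0 to pi / 2 lies below the graph.\<close>
  have "convex_on {0..pi} (\<lambda>x. - sin x)"
    by (rule f''_ge0_imp_convex[where f' = "\<lambda>x. - cos x" and f'' = "\<lambda>x. sin x"])
       (auto intro!: derivative_eq_intros sin_ge_zero)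
  from convex_onD[OF this, of "2 * x" 0 "pi / 2"] show ?thesis
    using assms by (simp add: mult_ac)
qed

lemma cmod_1_minus_ephase:
  "cmod (1 - ephase q k) = 2 * \<bar>sin (pi * of_int k / of_nat q)\<bar>"
proof -
  let ?t = "pi * of_int k / real q"
  have trig: "(1 - (c\<^sup>2 - s\<^sup>2))\<^sup>2 + 2\<^sup>2 * s\<^sup>2 * c\<^sup>2 = 2\<^sup>2 * s\<^sup>2" if "s\<^sup>2 + c\<^sup>2 = 1" for s c :: real
  proof -
    have c: "c\<^sup>2 = 1 - s\<^sup>2" using that by simp
    show ?thesis unfolding c by (simp add: power2_eq_square algebra_simps)
  qed
  have "(cmod (1 - ephase q k))\<^sup>2 = (1 - cos (2 * ?t))\<^sup>2 + (sin (2 * ?t))\<^sup>2"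
    by (simp add: ephase_def cmod_power2 mult_ac)
  also have "\<dots> = (2 * \<bar>sin ?t\<bar>)\<^sup>2"
    using trig[OF sin_cos_squared_add[of ?t]] unfolding cos_double sin_double power_mult_distrib power2_abs .
  finally show ?thesis by (subst (asm) power2_eq_iff_nonneg) auto
qed

text \<open>A geometric sum is at most 2 divided by the distance of its ratio from 1, and 1 / sin
  (pi * m / q) is controlled by the distance of m / q to the nearest integer. Having both 1 / m and
  1 / (q - m) in the bound avoids a case distinction later.\<close>

lemma sum_ephase_interval_le:
  assumes "0 < m" "m < q"
  shows "cmod (\<Sum>a\<in>{a0..<a0 + int n}. ephase q (- (int m * a))) \<le> real q / 2 * (1 / real m + 1 / real (q - m))"
proof -
  have q: "q > 0" using assms by simp
  define x where "x = real m / real q"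
  have x: "0 < x" "x < 1" using assms by (auto simp: x_def)
  have s: "sin (pi * x) > 0" using x by (intro sin_gt_zero) auto
  have s2: "1 / sin (pi * x) \<le> real q / 2 * (1 / real m + 1 / real (q - m))"
  proof (cases "x \<le> 1/2")
    case True
    then have "1 / sin (pi * x) \<le> 1 / (2 * x)" using sin_pi_ge[of x] x s by (intro divide_left_mono) auto
    also have "\<dots> = real q / 2 * (1 / real m)" using assms by (simp add: x_def)
    also have "\<dots> \<le> real q / 2 * (1 / real m + 1 / real (q - m))" by (intro mult_left_mono) auto
    finally show ?thesis .
  next
    case False
    have "sin (pi * x) = sin (pi * (1 - x))" by (simp add: right_diff_distrib)
    then have "1 / sin (pi * x) \<le> 1 / (2 * (1 - x))" using sin_pi_ge[of "1 - x"] x s False by (intro divide_left_mono) auto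
    also have "\<dots> = real q / 2 * (1 / real (q - m))" using assms by (simp add: x_def field_simps of_nat_diff)
    also have "\<dots> \<le> real q / 2 * (1 / real m + 1 / real (q - m))" by (intro mult_left_mono) auto
    finally show ?thesis .
  qed
  have ne: "ephase q (- int m) \<noteq> 1"
    using assms q by (simp add: ephase_eq_1_iff) (meson nat_dvd_not_less)
  have "cmod (\<Sum>a\<in>{a0..<a0 + int n}. ephase q (a * (- int m)))
      = cmod (1 - ephase q (int n * (- int m))) / cmod (1 - ephase q (- int m))"
    unfolding sum_ephase_interval sum_ephase_nat using ne by (simp add: norm_mult norm_divide)
  also have "\<dots> \<le> 2 / cmod (1 - ephase q (- int m))"
    using norm_triangle_ineq4[of 1 "ephase q (int n * (- int m))"] by (intro divide_right_mono) auto
  also have "cmod (1 - ephase q (- int m)) = 2 * sin (pi * x)"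
    unfolding cmod_1_minus_ephase using s by (simp add: x_def)
  finally show ?thesis using s2 by (simp add: mult.commute)
qed

text \<open>The Fourier coefficients of an interval, weighted by the gcd that the Kloosterman bound
  costs. Since gcd (q - m) q = gcd m q, the reflection m \<mapsto> q - m identifies the sums over 1
  / m and 1 / (q - m).\<close>

lemma sum_dual_le:
  assumes "q > 0"
  shows "(\<Sum>m\<in>{1..<int q}. cmod (\<Sum>a\<in>{a0..<a0 + int n}. ephase q (- (m * a))) * of_int (gcd m (int q)))
    \<le> real q * real (tau q) * (1 + ln (real q))"
proof -
  have gcd_nat: "real (gcd (nat a) q) = of_int (gcd a (int q))" if "a \<ge> 1" for a
    using that by (metis gcd_int_int_eq int_nat_eq of_int_of_nat_eq order_trans zero_le_one)
  have "(\<Sum>m\<in>{1..<int q}. cmod (\<Sum>a\<in>{a0..<a0 + int n}. ephase q (- (m * a))) * of_int (gcd m (int q)))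
      = (\<Sum>m\<in>{1..<q}. cmod (\<Sum>a\<in>{a0..<a0 + int n}. ephase q (- (int m * a))) * real (gcd m q))"
    by (intro sum.reindex_bij_witness[of _ int nat]) (auto simp: gcd_nat)
  also have "\<dots> \<le> (\<Sum>m\<in>{1..<q}. real q / 2 * (1 / real m + 1 / real (q - m)) * real (gcd m q))"
    by (intro sum_mono mult_right_mono sum_ephase_interval_le) auto
  also have "\<dots> = real q / 2 * ((\<Sum>m\<in>{1..<q}. real (gcd m q) / real m) + (\<Sum>m\<in>{1..<q}. real (gcd m q) / real (q - m)))"
    by (simp add: sum.distrib[symmetric] sum_distrib_left field_simps)
  also have "(\<Sum>m\<in>{1..<q}. real (gcd m q) / real (q - m)) = (\<Sum>m\<in>{1..<q}. real (gcd m q) / real m)"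
  proof (rule sum.reindex_bij_witness[of _ "\<lambda>m. q - m" "\<lambda>m. q - m"])
    fix m assume "m \<in> {1..<q}"
    then have "gcd (q - m) q = gcd m q" by (metis atLeastLessThan_iff gcd.commute gcd_diff1_nat gcd_diff2_nat less_imp_le_nat diff_diff_cancel diff_le_self)
    then show "real (gcd (q - m) q) / real (q - m) = real (gcd m q) / real (q - m)" by simp
  qed auto
  also have "real q / 2 * ((\<Sum>m\<in>{1..<q}. real (gcd m q) / real m) + (\<Sum>m\<in>{1..<q}. real (gcd m q) / real m))
      = real q * (\<Sum>m\<in>{1..<q}. real (gcd m q) / real m)" by simp
  also have "\<dots> \<le> real q * (real (tau q) * (1 + ln (real q)))"
    using sum_gcd_div_le[OF assms] by (intro mult_left_mono) auto
  finally show ?thesis by simp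
qed

text \<open>For each point (a, y) of the box the characters detect hyperbola points with the same
  residues. There is exactly one if q divides a * y - u and none otherwise; the box may lie
  anywhere, not only among reduced residues.\<close>

lemma hyperbola_count_fourier:
  assumes "q > 0"
  shows "of_nat (q ^ 2 * card {(a, y) \<in> {a0..<a0 + int n1} \<times> {y0..<y0 + int n2}. int q dvd a * y - u})
    = (\<Sum>m\<in>{0..<int q}. \<Sum>n\<in>{0..<int q}. (\<Sum>a\<in>{a0..<a0 + int n1}. ephase q (- (m * a)))
        * (\<Sum>y\<in>{y0..<y0 + int n2}. ephase q (- (n * y))) * kloosterman q u m n)"
proof -
  let ?A = "{a0..<a0 + int n1}" and ?Y = "{y0..<y0 + int n2}" and ?Z = "{0..<int q}"
  let ?f = "\<lambda>m n p. ephase q (m * (fst (snd p) - fst (fst p))) * ephase q (n * (snd (snd p) - snd (fst p)))"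
  let ?P = "(?A \<times> ?Y) \<times> hyperbola q u"
  have 1: "(\<Sum>a\<in>?A. ephase q (- (m * a))) * (\<Sum>y\<in>?Y. ephase q (- (n * y))) * kloosterman q u m n
     = (\<Sum>p\<in>?P. ?f m n p)" for m n
  proof -
    have "(\<Sum>a\<in>?A. ephase q (- (m * a))) * (\<Sum>y\<in>?Y. ephase q (- (n * y))) * kloosterman q u m n
      = (\<Sum>p\<in>?A \<times> ?Y. \<Sum>r\<in>hyperbola q u. ephase q (- (m * fst p)) * ephase q (- (n * snd p)) * ephase q (m * fst r + n * snd r))"
      unfolding kloosterman_def case_prod_beta by (simp only: sum_product sum.cartesian_product case_prod_beta)
    also have "\<dots> = (\<Sum>p\<in>?A \<times> ?Y. \<Sum>r\<in>hyperbola q u. ?f m n (p, r))"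
      unfolding ephase_add[symmetric] by (intro sum.cong refl arg_cong[where f = "ephase q"]) (simp add: algebra_simps)
    finally show ?thesis by (simp add: sum.cartesian_product case_prod_beta)
  qed
  have card1: "card {r \<in> hyperbola q u. int q dvd fst r - a \<and> int q dvd snd r - y} = (if int q dvd a * y - u then 1 else 0)" for a y
  proof -
    have "{r \<in> hyperbola q u. int q dvd fst r - a \<and> int q dvd snd r - y} =
       (if int q dvd a * y - u then {(a mod int q, y mod int q)} else {})"
    proof -
      have c: "[(a mod int q) * (y mod int q) = a * y] (mod int q)" by (intro cong_mult) (auto simp: Cong.cong_def)
      define z where "z = (a mod int q, y mod int q)"
      have mem: "(a mod int q, y mod int q) \<in> hyperbola q u" if "int q dvd a * y - u"
      proof -
        have "[a * y = u] (mod int q)" using that by (simp add: cong_iff_dvd_diff)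
        with c have "[(a mod int q) * (y mod int q) = u] (mod int q)" by (rule cong_trans)
        then have "int q dvd (a mod int q) * (y mod int q) - u" by (simp only: cong_iff_dvd_diff)
        moreover have "a mod int q \<in> ?Z" "y mod int q \<in> ?Z" using assms by auto
        ultimately show ?thesis unfolding hyperbola_def by blast
      qed
      have uniq: "r = (a mod int q, y mod int q) \<and> int q dvd a * y - u"
        if r: "r \<in> hyperbola q u" "int q dvd fst r - a" "int q dvd snd r - y" for r
      proof -
        have rz: "fst r \<in> ?Z" "snd r \<in> ?Z" "int q dvd fst r * snd r - u" using r(1) by (auto simp: hyperbola_def)
        have ca: "[fst r = a] (mod int q)" "[snd r = y] (mod int q)" using r by (simp_all add: cong_iff_dvd_diff)
        then have "fst r = a mod int q" "snd r = y mod int q" using rz by (auto simp: Cong.cong_def)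
        moreover have "[a * y = fst r * snd r] (mod int q)" using cong_mult[OF ca] by (rule cong_sym)
        then have "[a * y = u] (mod int q)" using rz(3) cong_trans cong_iff_dvd_diff by blast
        then have "int q dvd a * y - u" by (simp only: cong_iff_dvd_diff)
        ultimately show ?thesis by (simp only: prod_eq_iff fst_conv snd_conv simp_thms)
      qed
      have "int q dvd a mod int q - a" "int q dvd y mod int q - y"
        unfolding cong_iff_dvd_diff[symmetric] by (simp_all add: Cong.cong_def)
      then have dz: "int q dvd fst z - a \<and> int q dvd snd z - y" by (simp only: z_def fst_conv snd_conv)
      show ?thesis
        using mem uniq dz unfolding z_def[symmetric] by (auto simp only: split: if_splits)
    qed
    then show ?thesis by simp
  qed
  have "(\<Sum>m\<in>?Z. \<Sum>n\<in>?Z. \<Sum>p\<in>?P. ?f m n p) = (\<Sum>p\<in>?P. \<Sum>m\<in>?Z. \<Sum>n\<in>?Z. ?f m n p)"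
  proof -
    have "(\<Sum>m\<in>?Z. \<Sum>n\<in>?Z. \<Sum>p\<in>?P. ?f m n p) = (\<Sum>m\<in>?Z. \<Sum>p\<in>?P. \<Sum>n\<in>?Z. ?f m n p)"
      by (intro sum.cong refl, rule sum.swap)
    also have "\<dots> = (\<Sum>p\<in>?P. \<Sum>m\<in>?Z. \<Sum>n\<in>?Z. ?f m n p)" by (rule sum.swap)
    finally show ?thesis .
  qed
  also have "\<dots> = (\<Sum>p\<in>?P. if int q dvd fst (snd p) - fst (fst p) \<and> int q dvd snd (snd p) - snd (fst p) then of_nat (q ^ 2) else 0)"
  proof (intro sum.cong refl)
    fix p assume "p \<in> ?P"
    have "(\<Sum>m\<in>?Z. \<Sum>n\<in>?Z. ?f m n p) = (\<Sum>m\<in>?Z. ephase q (m * (fst (snd p) - fst (fst p)))) * (\<Sum>n\<in>?Z. ephase q (n * (snd (snd p) - snd (fst p))))"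
      by (simp only: sum_product)
    then show "(\<Sum>m\<in>?Z. \<Sum>n\<in>?Z. ?f m n p) = (if int q dvd fst (snd p) - fst (fst p) \<and> int q dvd snd (snd p) - snd (fst p) then of_nat (q ^ 2) else 0)"
      unfolding sum_ephase_complete[OF assms] by (simp add: power2_eq_square)
  qed
  also have "\<dots> = (\<Sum>p\<in>?A \<times> ?Y. \<Sum>r\<in>hyperbola q u. if int q dvd fst r - fst p \<and> int q dvd snd r - snd p then of_nat (q ^ 2) else 0)"
    by (simp add: sum.cartesian_product case_prod_beta)
  also have "\<dots> = (\<Sum>p\<in>?A \<times> ?Y. of_nat (q ^ 2 * card {r \<in> hyperbola q u. int q dvd fst r - fst p \<and> int q dvd snd r - snd p}))"
    by (intro sum.cong refl) (simp add: sum.inter_filter[symmetric])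
  also have "\<dots> = of_nat (q ^ 2 * (\<Sum>p\<in>?A \<times> ?Y. if int q dvd fst p * snd p - u then 1 else 0))"
    unfolding card1 by (simp add: sum_distrib_left)
  also have "(\<Sum>p\<in>?A \<times> ?Y. if int q dvd fst p * snd p - u then 1 else 0) = card {p \<in> ?A \<times> ?Y. int q dvd fst p * snd p - u}"
    by (simp only: sum.inter_filter[symmetric] finite_cartesian_product finite_atLeastLessThan_int card_eq_sum)
  also have "{p \<in> ?A \<times> ?Y. int q dvd fst p * snd p - u} = {(a, y) \<in> ?A \<times> ?Y. int q dvd a * y - u}" by auto
  finally show ?thesis unfolding 1 by (rule sym)
qed

text \<open>The frequency (0, 0) is the main term, where the Kloosterman sum equals
  \<open>totient q\<close>. For m \<noteq> 0 the Kloosterman bound costs gcd m q; for m = 0 that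
  would be q, so the symmetry of the sum moves the cost to gcd n q with n \<noteq> 0. Both costs are
  absorbed by \<open>sum_dual_le\<close>.\<close>

theorem hyperbola_count:
  assumes "q > 0" "coprime u (int q)" "n1 \<le> q" "n2 \<le> q"
  shows "\<bar>real (card {(a, y) \<in> {a0..<a0 + int n1} \<times> {y0..<y0 + int n2}. int q dvd a * y - u})
      - real (totient q) * real n1 * real n2 / real q ^ 2\<bar>
    \<le> 6 * real q powr (3/4) * real (tau q) ^ 3 * (1 + ln (real q)) ^ 2"
proof -
  let ?Z = "{0..<int q}" and ?Z1 = "{1..<int q}"
  define A where "A m = (\<Sum>a\<in>{a0..<a0 + int n1}. ephase q (- (m * a)))" for m
  define Y where "Y n = (\<Sum>y\<in>{y0..<y0 + int n2}. ephase q (- (n * y)))" for n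
  define N where "N = real (card {(a, y) \<in> {a0..<a0 + int n1} \<times> {y0..<y0 + int n2}. int q dvd a * y - u})"
  define S where "S m n = kloosterman q u m n" for m n
  define B where "B = 2 * real q powr (3/4) * real (tau q)"
  define L where "L = 1 + ln (real q)"
  define D where "D = real (tau q) * L"
  have q1: "real q \<ge> 1" using assms by simp
  have t1: "real (tau q) \<ge> 1" using tau_pos[OF assms(1)] by simp
  have L1: "L \<ge> 1" using q1 by (simp add: L_def)
  have D1: "D \<ge> 1" using t1 L1 mult_mono[of 1 "real (tau q)" 1 L] by (simp add: D_def)
  have B0: "B \<ge> 0" by (simp add: B_def)
  have Zs: "?Z = insert 0 ?Z1" using assms by auto
  have A0: "A 0 = of_nat n1" and Y0: "Y 0 = of_nat n2" by (simp_all add: A_def Y_def)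
  have S0: "S 0 0 = of_nat (totient q)" using card_hyperbola[OF assms(1,2)] by (simp add: S_def kloosterman_def)
  have four: "of_real (real q ^ 2 * N) = (\<Sum>m\<in>?Z. \<Sum>n\<in>?Z. A m * Y n * S m n)"
    using hyperbola_count_fourier[OF assms(1), of a0 n1 y0 n2 u] by (simp add: N_def A_def Y_def S_def)
  have split: "(\<Sum>m\<in>?Z. \<Sum>n\<in>?Z. A m * Y n * S m n) = A 0 * Y 0 * S 0 0 + (\<Sum>n\<in>?Z1. A 0 * Y n * S 0 n)
      + (\<Sum>m\<in>?Z1. \<Sum>n\<in>?Z. A m * Y n * S m n)"
    unfolding Zs by simp
  have gcd1: "1 \<le> real_of_int (gcd n (int q))" for n
  proof -
    have "0 < gcd n (int q)" using assms by simp
    then have "1 \<le> gcd n (int q)" by linarith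
    then show ?thesis by simp
  qed
  have sA: "(\<Sum>m\<in>?Z1. cmod (A m) * of_int (gcd m (int q))) \<le> real q * D"
    using sum_dual_le[OF assms(1)] by (simp add: A_def D_def L_def mult.assoc)
  have sY: "(\<Sum>n\<in>?Z1. cmod (Y n) * of_int (gcd n (int q))) \<le> real q * D"
    using sum_dual_le[OF assms(1)] by (simp add: Y_def D_def L_def mult.assoc)
  have sY1: "(\<Sum>n\<in>?Z. cmod (Y n)) \<le> 2 * (real q * D)"
  proof -
    have "(\<Sum>n\<in>?Z. cmod (Y n)) = real n2 + (\<Sum>n\<in>?Z1. cmod (Y n))" unfolding Zs by (simp add: Y0)
    also have "(\<Sum>n\<in>?Z1. cmod (Y n)) \<le> (\<Sum>n\<in>?Z1. cmod (Y n) * of_int (gcd n (int q)))"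
      using gcd1 by (intro sum_mono) (simp add: mult_left_le mult_le_cancel_left1)
    also note sY
    also have "real n2 \<le> real q * D" using assms(4) D1 q1 mult_mono[of "real n2" "real q" 1 D] by simp
    finally show ?thesis by (simp add: mult_ac)
  qed
  have "cmod (\<Sum>n\<in>?Z1. A 0 * Y n * S 0 n) \<le> (\<Sum>n\<in>?Z1. real q * (cmod (Y n) * (of_int (gcd n (int q)) * B)))"
  proof (intro sum_norm_le)
    fix n
    have "cmod (S 0 n) \<le> of_int (gcd n (int q)) * B"
      using kloosterman_bound[OF assms(1,2), of n 0] by (simp add: S_def B_def kloosterman_swap mult_ac)
    then show "cmod (A 0 * Y n * S 0 n) \<le> real q * (cmod (Y n) * (of_int (gcd n (int q)) * B))"
      using assms(3) unfolding A0 norm_mult mult.assoc by (intro mult_mono) auto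
  qed
  also have "\<dots> = real q * B * (\<Sum>n\<in>?Z1. cmod (Y n) * of_int (gcd n (int q)))"
    by (simp add: sum_distrib_left mult_ac)
  also have "\<dots> \<le> real q * B * (real q * D)" using sY B0 by (intro mult_left_mono) auto
  finally have e1: "cmod (\<Sum>n\<in>?Z1. A 0 * Y n * S 0 n) \<le> real q * B * (real q * D)" .
  have "cmod (\<Sum>m\<in>?Z1. \<Sum>n\<in>?Z. A m * Y n * S m n) \<le> (\<Sum>m\<in>?Z1. \<Sum>n\<in>?Z. (cmod (A m) * of_int (gcd m (int q))) * (cmod (Y n) * B))"
  proof (intro sum_norm_le)
    fix m n
    have "cmod (S m n) \<le> of_int (gcd m (int q)) * B"
      using kloosterman_bound[OF assms(1,2), of m n] by (simp add: S_def B_def mult_ac)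
    then have "cmod (A m) * cmod (Y n) * cmod (S m n) \<le> cmod (A m) * cmod (Y n) * (of_int (gcd m (int q)) * B)"
      by (intro mult_left_mono) auto
    then show "cmod (A m * Y n * S m n) \<le> (cmod (A m) * of_int (gcd m (int q))) * (cmod (Y n) * B)"
      by (simp add: norm_mult mult_ac)
  qed
  also have "\<dots> = (\<Sum>m\<in>?Z1. cmod (A m) * of_int (gcd m (int q))) * ((\<Sum>n\<in>?Z. cmod (Y n)) * B)"
    unfolding sum_distrib_right[of "\<lambda>n. cmod (Y n)" ?Z B] by (simp only: sum_product)
  also have "\<dots> \<le> (real q * D) * (2 * (real q * D) * B)"
    using sA sY1 B0 D1 by (intro mult_mono mult_right_mono) (auto intro!: sum_nonneg mult_nonneg_nonneg)
  finally have e2: "cmod (\<Sum>m\<in>?Z1. \<Sum>n\<in>?Z. A m * Y n * S m n) \<le> (real q * D) * (2 * (real q * D) * B)" .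
  have "complex_of_real (real q ^ 2 * N - real (totient q) * real n1 * real n2)
     = (\<Sum>n\<in>?Z1. A 0 * Y n * S 0 n) + (\<Sum>m\<in>?Z1. \<Sum>n\<in>?Z. A m * Y n * S m n)"
    using four unfolding split A0 Y0 S0 by (simp add: mult_ac)
  then have "\<bar>real q ^ 2 * N - real (totient q) * real n1 * real n2\<bar>
      = cmod ((\<Sum>n\<in>?Z1. A 0 * Y n * S 0 n) + (\<Sum>m\<in>?Z1. \<Sum>n\<in>?Z. A m * Y n * S m n))"
    by (metis norm_of_real)
  also have "\<dots> \<le> real q * B * (real q * D) + (real q * D) * (2 * (real q * D) * B)"
    using e1 e2 norm_triangle_ineq by (meson add_mono order_trans)
  also have "\<dots> = real q ^ 2 * (B * D + 2 * B * D ^ 2)" by (simp add: algebra_simps power2_eq_square)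
  also have "\<dots> \<le> real q ^ 2 * (B * D ^ 2 + 2 * B * D ^ 2)"
    using D1 B0 self_le_power[of D 2] by (intro mult_left_mono add_right_mono) auto
  finally have "\<bar>real q ^ 2 * N - real (totient q) * real n1 * real n2\<bar> \<le> real q ^ 2 * (3 * B * D ^ 2)" by simp
  moreover have "real q ^ 2 * N - real (totient q) * real n1 * real n2 = real q ^ 2 * (N - real (totient q) * real n1 * real n2 / real q ^ 2)"
    using q1 by (simp add: field_simps)
  ultimately have "real q ^ 2 * \<bar>N - real (totient q) * real n1 * real n2 / real q ^ 2\<bar> \<le> real q ^ 2 * (3 * B * D ^ 2)"
    by (simp add: abs_mult)
  then have "\<bar>N - real (totient q) * real n1 * real n2 / real q ^ 2\<bar> \<le> 3 * B * D ^ 2"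
    using q1 by (subst (asm) mult_le_cancel_left_pos) auto
  also have "\<dots> = 6 * real q powr (3/4) * real (tau q) ^ 3 * (1 + ln (real q)) ^ 2"
    by (simp add: B_def D_def L_def power2_eq_square power3_eq_cube)
  finally show ?thesis unfolding N_def .
qed

section \<open>Weighted totient sums\<close>

lemma pi_squared_ge_6: "6 \<le> pi\<^sup>2"
proof -
  have "3\<^sup>2 \<le> pi\<^sup>2" using pi_gt3 by (intro power_mono) auto
  then show ?thesis by simp
qed

definition totient_ratio_sum :: "nat \<Rightarrow> real" where
  "totient_ratio_sum n = (\<Sum>q\<in>{1..n}. real (totient q) / real q)"

text \<open>Dividing the divisor sum of \<open>totient\<close> by n and summing over n \<le> N gives
  N. With n = k * q the same sum is grouped by the cofactor k.\<close>

lemma sum_totient_ratio_sum: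
  "(\<Sum>k\<in>{1..N}. totient_ratio_sum (N div k) / real k) = real N"
proof -
  have "(\<Sum>k\<in>{1..N}. totient_ratio_sum (N div k) / real k)
      = (\<Sum>k\<in>{1..N}. \<Sum>q\<in>{1..N div k}. real (totient q) / real (k * q))"
    by (simp add: totient_ratio_sum_def sum_divide_distrib mult.commute)
  also have "\<dots> = (\<Sum>(k,q)\<in>(SIGMA k:{1..N}. {1..N div k}). real (totient q) / real (k * q))"
    by (rule sum.Sigma) auto
  also have "\<dots> = (\<Sum>(n,q)\<in>(SIGMA n:{1..N}. {q. q dvd n}). real (totient q) / real n)"
  proof (rule sum.reindex_bij_witness[of _ "\<lambda>(n,q). (n div q, q)" "\<lambda>(k,q). (k * q, q)"])
    fix p assume p: "p \<in> (SIGMA n:{1..N}. {q. q dvd n})"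
    obtain n q where nq: "p = (n, q)" by fastforce
    from p nq have *: "1 \<le> n" "n \<le> N" "q dvd n" by auto
    then have q0: "q \<ge> 1" by (auto intro: Suc_leI Nat.gr0I)
    obtain k where k: "n = q * k" using *(3) by blast
    have k1: "k \<ge> 1" using * k by (auto intro: Suc_leI Nat.gr0I)
    have "q \<le> N div k" using k1 *(2) k by (simp add: less_eq_div_iff_mult_less_eq)
    moreover have "k \<le> N" using *(2) k q0 by (metis dual_order.trans mult_le_mono1 nat_mult_1)
    ultimately show "(\<lambda>(n,q). (n div q, q)) p \<in> (SIGMA k:{1..N}. {1..N div k})"
      using q0 k1 k nq by auto
    show "(\<lambda>(k,q). (k * q, q)) ((\<lambda>(n,q). (n div q, q)) p) = p"
      using * nq by simp
  next
    fix p assume p: "p \<in> (SIGMA k:{1..N}. {1..N div k})"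
    obtain k q where kq: "p = (k, q)" by fastforce
    from p kq have *: "1 \<le> k" "k \<le> N" "1 \<le> q" "q \<le> N div k" by auto
    then have "q * k \<le> N" by (simp add: less_eq_div_iff_mult_less_eq)
    then show "(\<lambda>(k,q). (k * q, q)) p \<in> (SIGMA n:{1..N}. {q. q dvd n})"
      using * kq by (auto simp: mult.commute)
    show "(\<lambda>(n,q). (n div q, q)) ((\<lambda>(k,q). (k * q, q)) p) = p"
      using * kq by simp
    show "(case (\<lambda>(k,q). (k * q, q)) p of (n, q) \<Rightarrow> real (totient q) / real n) = (case p of (k, q) \<Rightarrow> real (totient q) / real (k * q))"
      using kq by simp
  qed
  also have "\<dots> = (\<Sum>n\<in>{1..N}. \<Sum>q | q dvd n. real (totient q) / real n)"
    by (rule sum.Sigma[symmetric]) auto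
  also have "\<dots> = (\<Sum>n\<in>{1..N}. real (\<Sum>q | q dvd n. totient q) / real n)"
    by (simp add: sum_divide_distrib)
  also have "\<dots> = (\<Sum>n\<in>{1..N}. 1)"
    by (intro sum.cong refl) (simp add: totient_divisor_sum)
  finally show ?thesis by simp
qed

lemma real_div_nat_bounds:
  fixes n k :: nat
  shows "real (n div k) \<le> real n / real k" "real n / real k - 1 \<le> real (n div k)"
proof -
  have "real_of_int \<lfloor>real n / real k\<rfloor> = real (n div k)" by (simp add: floor_divide_of_nat_eq)
  then show "real (n div k) \<le> real n / real k" "real n / real k - 1 \<le> real (n div k)"
    using floor_correct[of "real n / real k"] by linarith+
qed

text \<open>The induction for \<open>totient_ratio_sum\<close> needs a constant below 1. Comparison
  with an integral from 1 on would give 8/7, so the term k = 2 is kept exact and only the rest is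
  telescoped.\<close>

lemma powr_tail_bound:
  "(\<Sum>k\<in>{2..N}. real k powr (-(15/8))) \<le> 19/20"
proof -
  have tele: "real (Suc k) powr (-(15/8)) \<le> 8/7 * (real k powr (-(7/8)) - real (Suc k) powr (-(7/8)))"
    if "k \<ge> 1" for k
  proof -
    have "\<exists>z>real k. z < real (Suc k) \<and> real (Suc k) powr (-(7/8)) - real k powr (-(7/8))
        = (real (Suc k) - real k) * (-(7/8) * z powr (-(7/8) - 1))"
      using that by (intro MVT2) (auto intro!: derivative_eq_intros)
    then obtain z where z: "z > real k" "z < real (Suc k)"
      "real (Suc k) powr (-(7/8)) - real k powr (-(7/8)) = -(7/8) * z powr (-(15/8))" by auto
    have "real (Suc k) powr (-(15/8)) \<le> z powr (-(15/8))"
      using z that by (intro powr_mono2') auto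
    then show ?thesis using z(3) by (simp add: field_simps)
  qed
  have tail: "(\<Sum>k\<in>{3..N}. real k powr (-(15/8))) \<le> 8/7 * (2 powr (-(7/8)) - real N powr (-(7/8)))" if "N \<ge> 2" for N
    using that
  proof (induction N rule: dec_induct)
    case base
    then show ?case by simp
  next
    case (step n)
    then have "(\<Sum>k\<in>{3..Suc n}. real k powr (-(15/8))) = (\<Sum>k\<in>{3..n}. real k powr (-(15/8))) + real (Suc n) powr (-(15/8))"
      by simp
    then show ?case using step tele[of n] by simp
  qed
  \<comment> \<open>Here 460/133 is 23/7 divided by 19/20, and the inequality is checked as
    (460/133) ^ 8 \<le> 2 ^ 15.\<close>
  have num: "2 powr (-(15/8)) * (23/7) \<le> (19/20 :: real)"
  proof -
    have "((460/133::real) ^ 8) powr (1/8) \<le> (2 ^ 15) powr (1/8)"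
      by (intro powr_mono2) (simp_all add: power_divide divide_le_eq)
    moreover have "((460/133::real) ^ 8) powr (1/8) = 460/133"
      by (simp add: powr_powr flip: powr_numeral)
    moreover have "((2::real) ^ 15) powr (1/8) = 2 powr (15/8)"
    proof -
      have "(2::real) ^ 15 = 2 powr 15" by (subst powr_numeral) auto
      then show ?thesis by (simp only: powr_powr) simp
    qed
    ultimately have "(460/133::real) \<le> 2 powr (15/8)" by simp
    then show ?thesis by (simp add: powr_minus field_simps)
  qed
  show ?thesis
  proof (cases "N \<ge> 2")
    case True
    have "(\<Sum>k\<in>{2..N}. real k powr (-(15/8))) = 2 powr (-(15/8)) + (\<Sum>k\<in>{3..N}. real k powr (-(15/8)))"
      using True by (subst sum.atLeast_Suc_atMost) (auto simp: numeral_3_eq_3)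
    also have "\<dots> \<le> 2 powr (-(15/8)) + 8/7 * 2 powr (-(7/8))"
    proof -
      have "8/7 * (2 powr (-(7/8)) - real N powr (-(7/8))) \<le> 8/7 * 2 powr (-(7/8))" by simp
      with tail[OF True] show ?thesis by (meson add_left_mono order_trans)
    qed
    also have "(2::real) powr (-(7/8)) = 2 * 2 powr (-(15/8))"
      using powr_add[of "2::real" 1 "-(15/8)"] by simp
    also have "2 powr (-(15/8)) + 8/7 * (2 * 2 powr (-(15/8))) = 2 powr (-(15/8)) * (23/7 :: real)" by simp
    also note num
    finally show ?thesis .
  qed simp
qed

lemma sum_inverse_squares_bounds:
  assumes "N \<ge> 1"
  shows "(\<Sum>k\<in>{1..N}. 1 / real k ^ 2) \<le> pi\<^sup>2 / 6" "pi\<^sup>2 / 6 - 1 / real N \<le> (\<Sum>k\<in>{1..N}. 1 / real k ^ 2)"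
proof -
  have sums: "(\<lambda>n. 1 / real (n + 1) ^ 2) sums (pi\<^sup>2 / 6)"
    using inverse_squares_sums by simp
  have eq: "(\<Sum>k\<in>{1..n}. 1 / real k ^ 2) = (\<Sum>k<n. 1 / real (k + 1) ^ 2)" for n
    by (rule sum.reindex_bij_witness[of _ "\<lambda>k. k + 1" "\<lambda>k. k - 1"]) auto
  show "(\<Sum>k\<in>{1..N}. 1 / real k ^ 2) \<le> pi\<^sup>2 / 6"
    unfolding eq using sums by (metis (no_types, lifting) sum_le_suminf sums_iff finite_lessThan zero_le_divide_1_iff zero_le_power2)
  have "(\<Sum>k\<in>{1..M}. 1 / real k ^ 2) \<le> (\<Sum>k\<in>{1..N}. 1 / real k ^ 2) + 1 / real N - 1 / real M" if "M \<ge> N" for M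
    using that
  proof (induction M rule: dec_induct)
    case (step n)
    have n: "n \<ge> 1" using assms step by simp
    have "1 / real (Suc n) ^ 2 \<le> 1 / (real n * real (Suc n))"
      using n by (intro divide_left_mono) (auto simp: power2_eq_square)
    also have "\<dots> = 1 / real n - 1 / real (Suc n)" using n by (simp add: field_simps)
    finally show ?case using step by simp
  qed simp
  then have "(\<Sum>k<M. 1 / real (k + 1) ^ 2) \<le> (\<Sum>k\<in>{1..N}. 1 / real k ^ 2) + 1 / real N" if "M \<ge> N" for M
    using that eq[of M] by (smt (verit) zero_le_divide_1_iff of_nat_0_le_iff)
  then have "pi\<^sup>2 / 6 \<le> (\<Sum>k\<in>{1..N}. 1 / real k ^ 2) + 1 / real N"
    using sums unfolding sums_def by (intro LIMSEQ_le_const2) auto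
  then show "pi\<^sup>2 / 6 - 1 / real N \<le> (\<Sum>k\<in>{1..N}. 1 / real k ^ 2)" by simp
qed

text \<open>
  The error \<open>E(n) = totient_ratio_sum n - 6 n / pi\<^sup>2\<close> satisfies
  \<open>\<Sum>k\<le>N. E(N div k) / k = O(ln N)\<close>. Since the sum of \<open>k powr -(15/8)\<close> over \<open>k \<ge> 2\<close> is below 1,
  strong induction propagates a bound \<open>n powr (7/8)\<close> without Moebius inversion.
\<close>

lemma totient_ratio_sum_asymp:
  "\<bar>totient_ratio_sum n - 6 / pi\<^sup>2 * real n\<bar> \<le> 80 * real n powr (7/8)"
proof (induction n rule: less_induct)
  case (less N)
  show ?case
  proof (cases "N = 0")
    case True
    then show ?thesis by (simp add: totient_ratio_sum_def)
  next
    case False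
    then have N1: "N \<ge> 1" by simp
    define \<kappa> where "\<kappa> = 6 / pi\<^sup>2"
    define E where "E n = totient_ratio_sum n - \<kappa> * real n" for n
    have \<kappa>: "0 \<le> \<kappa>" "\<kappa> \<le> 1" using pi_squared_ge_6 by (auto simp: \<kappa>_def divide_le_eq)
    have harm: "(\<Sum>k\<in>{1..N}. 1 / real k) \<le> 1 + ln (real N)"
      using N1 decseqD[OF decseq_harm_diff_ln, of 0 "N - 1"] by (simp add: harm_expand) (simp add: harm_def inverse_eq_divide)
    define T where "T = (\<Sum>k\<in>{1..N}. real (N div k) / real k)"
    have T1: "T \<le> real N * (\<Sum>k\<in>{1..N}. 1 / real k ^ 2)"
      unfolding T_def sum_distrib_left
    proof (rule sum_mono)
      fix k assume "k \<in> {1..N}"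
      then have "real (N div k) \<le> real N / real k" by (intro real_div_nat_bounds)
      then have "real (N div k) / real k \<le> real N / real k / real k" by (intro divide_right_mono) auto
      then show "real (N div k) / real k \<le> real N * (1 / real k ^ 2)" by (simp add: power2_eq_square)
    qed
    have T2: "real N * (\<Sum>k\<in>{1..N}. 1 / real k ^ 2) - (\<Sum>k\<in>{1..N}. 1 / real k) \<le> T"
      unfolding T_def sum_distrib_left sum_subtractf[symmetric]
    proof (rule sum_mono)
      fix k assume "k \<in> {1..N}"
      have "real N / real k - 1 \<le> real (N div k)" by (rule real_div_nat_bounds)
      then have "(real N / real k - 1) / real k \<le> real (N div k) / real k" by (intro divide_right_mono) auto
      then show "real N * (1 / real k ^ 2) - 1 / real k \<le> real (N div k) / real k" by (simp add: power2_eq_square diff_divide_distrib)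
    qed
    have "(\<Sum>k\<in>{1..N}. E (N div k) / real k) = real N - \<kappa> * T"
      unfolding E_def T_def by (simp add: diff_divide_distrib sum_subtractf sum_totient_ratio_sum[unfolded One_nat_def] sum_distrib_left)
    \<comment> \<open>Splitting off k = 1 isolates the error at N itself; the other terms involve N
      div k < N.\<close>
    moreover have "{1..N} = insert 1 {2..N}" using N1 by auto
    ultimately have E1: "E N = real N - \<kappa> * T - (\<Sum>k\<in>{2..N}. E (N div k) / real k)" by simp
    have "\<bar>real N - \<kappa> * T\<bar> \<le> 2 + ln (real N)"
    proof -
      have "\<kappa> * T \<le> \<kappa> * (real N * (pi\<^sup>2 / 6))"
        using T1 sum_inverse_squares_bounds(1)[OF N1] \<kappa> by (smt (verit) mult_left_mono of_nat_0_le_iff)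
      then have "\<kappa> * T \<le> real N" by (simp add: \<kappa>_def)
      moreover have "real N * (pi\<^sup>2 / 6 - 1 / real N) - (1 + ln (real N)) \<le> T"
        using T2 harm sum_inverse_squares_bounds(2)[OF N1] by (smt (verit) mult_left_mono of_nat_0_le_iff)
      then have "real N * (pi\<^sup>2 / 6) - (2 + ln (real N)) \<le> T" using N1 by (simp add: right_diff_distrib)
      then have "\<kappa> * (real N * (pi\<^sup>2 / 6) - (2 + ln (real N))) \<le> \<kappa> * T" using \<kappa> by (intro mult_left_mono)
      then have "real N - \<kappa> * (2 + ln (real N)) \<le> \<kappa> * T" by (simp add: \<kappa>_def right_diff_distrib)
      moreover have "\<kappa> * (2 + ln (real N)) \<le> 1 * (2 + ln (real N))" using \<kappa> N1 by (intro mult_right_mono) auto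
      ultimately have "real N - \<kappa> * T \<le> 2 + ln (real N)" by simp
      moreover have "0 \<le> ln (real N)" using N1 by simp
      ultimately show ?thesis using \<open>\<kappa> * T \<le> real N\<close> by simp
    qed
    also have "2 + ln (real N) \<le> 4 * real N powr (7/8)"
    proof -
      have "ln (real N) = 8/7 * ln (real N powr (7/8))" using N1 by (simp add: ln_powr)
      also have "\<dots> \<le> 8/7 * real N powr (7/8)" using N1 ln_le_minus_one[of "real N powr (7/8)"] by simp
      finally have "ln (real N) \<le> 8/7 * real N powr (7/8)" .
      moreover have "real N powr (7/8) \<ge> 1" using N1 by (intro ge_one_powr_ge_zero) auto
      ultimately show ?thesis by simp
    qed
    finally have m: "\<bar>real N - \<kappa> * T\<bar> \<le> 4 * real N powr (7/8)" .
    have "\<bar>\<Sum>k\<in>{2..N}. E (N div k) / real k\<bar> \<le> (\<Sum>k\<in>{2..N}. 80 * real N powr (7/8) * real k powr (-(15/8)))"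
    proof (rule order_trans[OF sum_abs], rule sum_mono)
      fix k assume k: "k \<in> {2..N}"
      have "N div k < N" using k N1 by (intro div_less_dividend) auto
      then have "\<bar>E (N div k)\<bar> \<le> 80 * real (N div k) powr (7/8)"
        using less.IH unfolding E_def \<kappa>_def by blast
      also have "\<dots> \<le> 80 * (real N / real k) powr (7/8)"
        by (intro mult_left_mono powr_mono2 real_div_nat_bounds) auto
      also have "\<dots> = 80 * real N powr (7/8) * (real k * real k powr (-(15/8)))"
      proof -
        have "real k * real k powr (-(15/8)) = real k powr (-(7/8))"
          using powr_add[of "real k" 1 "-(15/8)"] k by simp
        then show ?thesis by (simp add: powr_divide powr_minus_divide)
      qed
      finally show "\<bar>E (N div k) / real k\<bar> \<le> 80 * real N powr (7/8) * real k powr (-(15/8))"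
        using k by (simp add: divide_le_eq mult_ac)
    qed
    also have "\<dots> = 80 * real N powr (7/8) * (\<Sum>k\<in>{2..N}. real k powr (-(15/8)))"
      by (simp add: sum_distrib_left)
    also have "\<dots> \<le> 80 * real N powr (7/8) * (19/20)"
      using powr_tail_bound by (intro mult_left_mono) auto
    \<comment> \<open>The constant 80 closes the induction: 80 * 19/20 + 4 = 80.\<close>
    finally have "\<bar>E N\<bar> \<le> 80 * real N powr (7/8)" using m E1 by linarith
    then show ?thesis by (simp add: E_def \<kappa>_def)
  qed
qed

text \<open>Abel summation: the decrements of u are nonnegative and telescope, so a bound M on the
  partial sums of e passes to the weighted sum with the factor u 1.\<close>

lemma abs_sum_by_parts_le:
  fixes e u :: "nat \<Rightarrow> real"
  assumes "\<And>n. n \<le> N \<Longrightarrow> \<bar>\<Sum>q\<in>{1..n}. e q\<bar> \<le> M"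
    and "\<And>q. 1 \<le> q \<Longrightarrow> u (Suc q) \<le> u q" and "\<And>q. 1 \<le> q \<Longrightarrow> u q \<ge> 0"
  shows "\<bar>\<Sum>q\<in>{1..N}. e q * u q\<bar> \<le> M * u 1"
proof -
  have M: "M \<ge> 0" using assms(1)[of 0] by simp
  have "(\<Sum>q\<in>{1..n}. e q * u q) = (\<Sum>q\<in>{1..n}. (\<Sum>k\<in>{1..q}. e k) * (u q - u (Suc q))) + (\<Sum>k\<in>{1..n}. e k) * u (Suc n)" for n
    by (induction n) (simp_all add: algebra_simps)
  then have "\<bar>\<Sum>q\<in>{1..N}. e q * u q\<bar> \<le> \<bar>\<Sum>q\<in>{1..N}. (\<Sum>k\<in>{1..q}. e k) * (u q - u (Suc q))\<bar> + \<bar>(\<Sum>k\<in>{1..N}. e k) * u (Suc N)\<bar>"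
    by (metis abs_triangle_ineq)
  also have "\<bar>\<Sum>q\<in>{1..N}. (\<Sum>k\<in>{1..q}. e k) * (u q - u (Suc q))\<bar> \<le> (\<Sum>q\<in>{1..N}. M * (u q - u (Suc q)))"
    by (rule order_trans[OF sum_abs], rule sum_mono) (use assms M in \<open>auto simp: abs_mult intro!: mult_mono\<close>)
  also have "\<bar>(\<Sum>k\<in>{1..N}. e k) * u (Suc N)\<bar> \<le> M * u (Suc N)"
    using assms(1)[of N] assms(3)[of "Suc N"] by (simp add: abs_mult mult_right_mono)
  also have "(\<Sum>q\<in>{1..N}. M * (u q - u (Suc q))) + M * u (Suc N) = M * u 1"
  proof -
    have "(\<Sum>q\<in>{1..n}. M * (u q - u (Suc q))) + M * u (Suc n) = M * u 1" for n
      by (induction n) (simp_all add: algebra_simps)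
    then show ?thesis .
  qed
  finally show ?thesis by simp
qed

text \<open>The sum is compared with the integral of the decreasing function min 1 (z / x) over
  {0..N}, where z = c * N.\<close>

lemma sum_min_bound:
  fixes c :: real
  assumes "0 \<le> c" "c \<le> 1" "N \<ge> 1"
  shows "\<bar>(\<Sum>q\<in>{1..N}. min 1 (c * real N / real q)) - real N * (c - c * ln c)\<bar> \<le> 1"
proof (cases "c = 0")
  case True
  then show ?thesis by simp
next
  case False
  define z where "z = c * real N"
  \<comment> \<open>The value u 0 = 1 is that of the integrand at 0, where z / 0 would be 0 in HOL.
    V below is the antiderivative of the integrand.\<close>
  define u where "u q = (if q = 0 then 1 else min 1 (z / real q))" for q :: nat
  define V where "V x = (if x \<le> z then x else z + z * ln (x / z))" for x
  have z0: "z > 0" using assms False by (simp add: z_def)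
  have ln1: "1 - z / x \<le> ln (x / z)" "ln (x / z) \<le> x / z - 1" if "x > 0" for x
  proof -
    show "ln (x / z) \<le> x / z - 1" using ln_le_minus_one[of "x / z"] that z0 by simp
    have "ln (z / x) \<le> z / x - 1" using ln_le_minus_one[of "z / x"] that z0 by simp
    then show "1 - z / x \<le> ln (x / z)" using that z0 by (simp add: ln_div)
  qed
  have step: "u (Suc q) \<le> V (real (Suc q)) - V (real q) \<and> V (real (Suc q)) - V (real q) \<le> u q" for q
  proof -
    consider "real (Suc q) \<le> z" | "real q \<le> z" "z < real (Suc q)" | "z < real q" by linarith
    then show ?thesis
    proof cases
      case 1
      then show ?thesis using z0 by (auto simp: u_def V_def)
    next
      \<comment> \<open>This unit step contains the kink z, where V passes from linear to
        logarithmic. The lower bound comes from the product (1 - (x - z)) * (1 - z / x) \<ge>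
        0.\<close>
      case 2
      define x where "x = real (Suc q)"
      have x: "real q = x - 1" "z < x" "x - 1 \<le> z" "x \<ge> 1" using 2 by (auto simp: x_def)
      have "z * ln (x / z) \<le> z * (x / z - 1)" using ln1(2)[of x] x z0 by (intro mult_left_mono) auto
      also have "\<dots> = x - z" using z0 by (simp add: field_simps)
      finally have up: "V x - V (real q) \<le> 1" using x by (simp add: V_def)
      have uq: "u q = 1" using x z0 by (auto simp: u_def min_def divide_less_eq)
      have "z * (1 - z / x) \<le> z * ln (x / z)" using ln1(1)[of x] x z0 by (intro mult_left_mono) auto
      moreover have "0 \<le> (1 - (x - z)) * (1 - z / x)" using x by (intro mult_nonneg_nonneg) auto
      moreover have "z + z * (1 - z / x) - (x - 1) - z / x = (1 - (x - z)) * (1 - z / x)" using x by (simp add: field_simps)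
      ultimately have "z / x \<le> z + z * ln (x / z) - (x - 1)" by linarith
      then have "z / x \<le> V x - V (real q)" using x by (simp add: V_def)
      moreover have "u (Suc q) \<le> z / x" by (simp add: u_def x_def)
      ultimately show ?thesis using up uq by (simp add: x_def)
    next
      case 3
      have q0: "real q > 0" using 3 z0 by linarith
      have d: "V (real (Suc q)) - V (real q) = z * (ln (real (Suc q)) - ln (real q))"
        using 3 z0 q0 by (simp add: V_def ln_div algebra_simps)
      have l1: "ln (real (Suc q)) - ln (real q) \<le> 1 / real q"
        using ln_le_minus_one[of "real (Suc q) / real q"] q0 by (simp add: ln_div field_simps)
      have l2: "1 / real (Suc q) \<le> ln (real (Suc q)) - ln (real q)"
        using ln_le_minus_one[of "real q / real (Suc q)"] q0 by (simp add: ln_div field_simps)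
      have "z * (1 / real (Suc q)) \<le> V (real (Suc q)) - V (real q)" "V (real (Suc q)) - V (real q) \<le> z * (1 / real q)"
        unfolding d by (intro mult_left_mono l1 l2 less_imp_le[OF z0])+
      then show ?thesis using 3 z0 q0 by (simp add: u_def min_def divide_less_eq)
    qed
  qed
  have "(\<Sum>q\<in>{1..n}. u q) \<le> V (real n) \<and> V (real n) \<le> (\<Sum>q<n. u q)" for n
  proof (induction n)
    case 0
    then show ?case using z0 by (simp add: V_def)
  next
    case (Suc n)
    then show ?case using step[of n] by simp
  qed
  from this[of N] have 1: "(\<Sum>q\<in>{1..N}. u q) \<le> V (real N)" "V (real N) \<le> (\<Sum>q<N. u q)" by auto
  have "(\<Sum>q<N. u q) \<le> 1 + (\<Sum>q\<in>{1..N}. u q)"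
  proof -
    have "(\<Sum>q<N. u q) \<le> (\<Sum>q\<in>{0..N}. u q)" using z0 by (intro sum_mono2) (auto simp: u_def)
    also have "\<dots> = 1 + (\<Sum>q\<in>{1..N}. u q)" by (simp add: sum.atLeast_Suc_atMost u_def)
    finally show ?thesis .
  qed
  moreover have "V (real N) = real N * (c - c * ln c)"
  proof -
    have "z \<le> real N" using assms by (simp add: z_def mult_left_le_one_le)
    then have "V (real N) = z + z * ln (real N / z)" using z0 by (auto simp: V_def)
    also have "real N / z = 1 / c" using assms by (simp add: z_def)
    finally show ?thesis using assms False by (simp add: ln_div z_def algebra_simps)
  qed
  moreover have "(\<Sum>q\<in>{1..N}. u q) = (\<Sum>q\<in>{1..N}. min 1 (c * real N / real q))"
    by (intro sum.cong refl) (auto simp: u_def z_def)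
  ultimately show ?thesis using 1 by (simp add: abs_le_iff)
qed

text \<open>Replace totient q / q by its mean 6 / pi^2. The weight decreases in q, so Abel summation
  transfers the error of \<open>totient_ratio_sum\<close>, and \<open>sum_min_bound\<close>
  evaluates what remains.\<close>

lemma totient_weighted_sum_asymp:
  fixes c :: real
  assumes "0 \<le> c" "c \<le> 1" "N \<ge> 1"
  shows "\<bar>(\<Sum>q\<in>{1..N}. real (totient q) / real q * min 1 (c * real N / real q))
      - 6 / pi\<^sup>2 * (real N * (c - c * ln c))\<bar> \<le> 81 * real N powr (7/8)"
proof -
  define u where "u q = min 1 (c * real N / real q)" for q :: nat
  define \<kappa> where "\<kappa> = 6 / pi\<^sup>2"
  have "\<bar>\<Sum>q\<in>{1..N}. (real (totient q) / real q - \<kappa>) * u q\<bar> \<le> (80 * real N powr (7/8)) * u 1"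
  proof (rule abs_sum_by_parts_le)
    fix n assume "n \<le> N"
    have "\<bar>\<Sum>q\<in>{1..n}. real (totient q) / real q - \<kappa>\<bar> = \<bar>totient_ratio_sum n - 6 / pi\<^sup>2 * real n\<bar>"
      by (simp add: sum_subtractf totient_ratio_sum_def \<kappa>_def mult.commute)
    also have "\<dots> \<le> 80 * real n powr (7/8)" by (rule totient_ratio_sum_asymp)
    also have "\<dots> \<le> 80 * real N powr (7/8)" using \<open>n \<le> N\<close> by (intro mult_left_mono powr_mono2) auto
    finally show "\<bar>\<Sum>q\<in>{1..n}. real (totient q) / real q - \<kappa>\<bar> \<le> 80 * real N powr (7/8)" .
  next
    fix q :: nat assume "1 \<le> q"
    then have "c * real N / real (Suc q) \<le> c * real N / real q" using assms by (intro divide_left_mono) auto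
    then show "u (Suc q) \<le> u q" by (simp add: u_def)
    show "u q \<ge> 0" using assms by (simp add: u_def)
  qed
  also have "\<dots> \<le> 80 * real N powr (7/8)" by (simp add: u_def mult_left_le)
  finally have 1: "\<bar>\<Sum>q\<in>{1..N}. (real (totient q) / real q - \<kappa>) * u q\<bar> \<le> 80 * real N powr (7/8)" .
  have \<kappa>: "0 \<le> \<kappa>" "\<kappa> \<le> 1" using pi_squared_ge_6 by (auto simp: \<kappa>_def divide_le_eq)
  have "\<bar>\<kappa> * (\<Sum>q\<in>{1..N}. u q) - \<kappa> * (real N * (c - c * ln c))\<bar> = \<kappa> * \<bar>(\<Sum>q\<in>{1..N}. u q) - real N * (c - c * ln c)\<bar>"
    using \<kappa> by (simp add: right_diff_distrib[symmetric] abs_mult)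
  also have "\<dots> \<le> 1 * 1" using \<kappa> sum_min_bound[OF assms] unfolding u_def by (intro mult_mono) auto
  also have "1 * 1 \<le> real N powr (7/8)" using assms by (simp add: ge_one_powr_ge_zero)
  finally have 2: "\<bar>\<kappa> * (\<Sum>q\<in>{1..N}. u q) - \<kappa> * (real N * (c - c * ln c))\<bar> \<le> real N powr (7/8)" .
  have "(\<Sum>q\<in>{1..N}. real (totient q) / real q * u q) = (\<Sum>q\<in>{1..N}. (real (totient q) / real q - \<kappa>) * u q) + \<kappa> * (\<Sum>q\<in>{1..N}. u q)"
    by (simp add: left_diff_distrib sum_subtractf sum_distrib_left)
  moreover define P where "P = \<kappa> * (\<Sum>q\<in>{1..N}. u q)"
  moreover define R where "R = \<kappa> * (real N * (c - c * ln c))"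
  ultimately have "\<bar>(\<Sum>q\<in>{1..N}. real (totient q) / real q * u q) - R\<bar> \<le> 81 * real N powr (7/8)"
    using 1 2 by simp
  then show ?thesis unfolding u_def \<kappa>_def R_def .
qed

section \<open>Farey cells\<close>

definition near_set :: "nat \<Rightarrow> real \<Rightarrow> real set" where
  "near_set N \<eta> = {x. \<exists>q\<in>{1..N}. \<exists>a::int. \<bar>real q * x - of_int a\<bar> \<le> \<eta>}"

text \<open>
  For \<open>s = 1\<close> (\<open>s = - 1\<close>) this is the denominator of the right (left) neighbour of \<open>a / q\<close>
  among the fractions with denominator at most \<open>N\<close>.
\<close>
definition farey_next :: "nat \<Rightarrow> nat \<Rightarrow> int \<Rightarrow> int \<Rightarrow> int" where
  "farey_next N q a s = (THE y. int N - int q < y \<and> y \<le> int N \<and> int q dvd a * y + s)"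

text \<open>The bound 1 / (q + q') on the deviation s * (q * x - a) ends the cell at the mediant
  with the neighbour a' / q', where both fractions deviate equally. The cells are closed, so
  different cells may share rational endpoints.\<close>

definition farey_cell :: "nat \<Rightarrow> real \<Rightarrow> nat \<Rightarrow> int \<Rightarrow> int \<Rightarrow> real set" where
  "farey_cell N \<eta> q a s = {x. 0 \<le> of_int s * (real q * x - of_int a) \<and>
     of_int s * (real q * x - of_int a) \<le> min \<eta> (1 / (real q + of_int (farey_next N q a s)))}"

lemma farey_cell_borel [measurable]: "farey_cell N \<eta> q a s \<in> sets borel"
  unfolding farey_cell_def by measurable

lemma farey_next_unique:
  assumes "coprime a (int q)" "int N - int q < y" "y \<le> int N" "int q dvd a * y + s"
    "int N - int q < y'" "y' \<le> int N" "int q dvd a * y' + s"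
  shows "y = y'"
proof -
  have "int q dvd (a * y + s) - (a * y' + s)" using assms(4,7) by (rule dvd_diff)
  then have "int q dvd a * (y - y')" by (simp add: algebra_simps)
  then have "int q dvd y - y'" using assms(1) by (metis coprime_commute coprime_dvd_mult_right_iff)
  then show ?thesis using assms(2,3,5,6) dvd_imp_le_int[of "y - y'" "int q"] by (smt (verit))
qed

lemma farey_next:
  assumes "1 \<le> q" "coprime a (int q)"
  shows "int N - int q < farey_next N q a s" "farey_next N q a s \<le> int N" "int q dvd a * farey_next N q a s + s"
proof -
  obtain b where b: "[a * b = 1] (mod int q)" using assms(2) cong_solve_coprime_int by blast
  \<comment> \<open>The required residue is - s * b; subtracting (N + s * b) mod q from N reaches it
    inside the window {N - q<..N}.\<close>
  define r where "r = (int N + s * b) mod int q"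
  define y where "y = int N - r"
  have "0 \<le> r" "r < int q" using assms by (auto simp: r_def)
  then have y1: "int N - int q < y" "y \<le> int N" by (auto simp: y_def)
  have "[r = int N + s * b] (mod int q)" by (simp add: r_def Cong.cong_def)
  then have "[y = int N - (int N + s * b)] (mod int q)" unfolding y_def by (intro cong_diff cong_refl)
  then have "[a * y + s = a * (int N - (int N + s * b)) + s] (mod int q)" by (intro cong_add cong_mult cong_refl)
  also have "a * (int N - (int N + s * b)) + s = s - (a * b) * s" by (simp add: algebra_simps)
  also have "[s - (a * b) * s = s - 1 * s] (mod int q)" by (intro cong_diff cong_mult cong_refl b)
  finally have y2: "int q dvd a * y + s" by (simp add: cong_0_iff)
  have "\<exists>!y. int N - int q < y \<and> y \<le> int N \<and> int q dvd a * y + s"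
    using y1 y2 farey_next_unique[OF assms(2)] by blast
  from theI'[OF this] show "int N - int q < farey_next N q a s" "farey_next N q a s \<le> int N" "int q dvd a * farey_next N q a s + s"
    unfolding farey_next_def by blast+
qed

lemma farey_next_eqI:
  assumes "1 \<le> q" "coprime a (int q)" "int N - int q < y" "y \<le> int N" "int q dvd a * y + s"
  shows "farey_next N q a s = y"
  using farey_next_unique[OF assms(2)] farey_next[OF assms(1,2)] assms(3-5) by blast

text \<open>From k < q + y the coefficients i and j are not both positive, and k \<ge> 1 excludes
  that both are nonpositive. With opposite signs the two terms of i * \<delta> - j * \<beta> cannot
  cancel.\<close>

lemma mult_comb_ge:
  fixes i j k q y :: int and \<delta> \<beta> :: real
  assumes "k = i * q + j * y" "1 \<le> k" "k < q + y" "q > 0" "y > 0" "0 \<le> \<delta>" "\<delta> \<le> \<beta>"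
  shows "\<delta> \<le> \<bar>of_int i * \<delta> - of_int j * \<beta>\<bar>"
proof -
  have big: "n * \<delta>' \<ge> \<delta>'" if "n \<ge> 1" "\<delta>' \<ge> 0" for n \<delta>' :: real
    using that mult_right_mono[of 1 n \<delta>'] by simp
  consider "i \<ge> 1" "j \<le> 0" | "i \<ge> 1" "j \<ge> 1" | "i \<le> 0" "j \<ge> 1" | "i \<le> 0" "j \<le> 0" by linarith
  then show ?thesis
  proof cases
    case 1
    have "of_int i * \<delta> \<ge> \<delta>" using 1 assms by (intro big) auto
    moreover have "of_int j * \<beta> \<le> 0" using 1 assms by (intro mult_nonpos_nonneg) auto
    ultimately show ?thesis by linarith
  next
    case 2
    have "i * q \<ge> 1 * q" "j * y \<ge> 1 * y" using 2 assms by (intro mult_right_mono; simp)+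
    then show ?thesis using assms by linarith
  next
    case 3
    have "of_int j * \<beta> \<ge> \<beta>" using 3 assms by (intro big) auto
    moreover have "of_int i * \<delta> \<le> 0" using 3 assms by (intro mult_nonpos_nonneg) auto
    ultimately show ?thesis using assms by linarith
  next
    case 4
    have "i * q \<le> 0" "j * y \<le> 0" using 4 assms by (auto intro: mult_nonpos_nonneg)
    then show ?thesis using assms by linarith
  qed
qed

text \<open>The unimodular relation q * a' - a * y = s in terms of the deviations \<delta> = s * (q
  * x - a) and \<beta> = s * (a' - y * x): it says q * \<beta> + y * \<delta> = 1. For positive q
  and y, the mediant bound \<delta> \<le> 1 / (q + y) is therefore the same as \<delta> \<le>
  \<beta>.\<close>

lemma farey_neighbour_identity:
  fixes x :: real and q a y s a' :: int
  assumes "a * y + s = q * a'" "s * s = 1"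
  shows "of_int q * (of_int s * (of_int a' - of_int y * x)) = 1 - of_int y * (of_int s * (of_int q * x - of_int a))"
proof -
  have "real_of_int (a * y + s) = of_int (q * a')" "real_of_int (s * s) = 1" using assms by simp_all
  then have e: "of_int q * real_of_int a' = of_int a * of_int y + of_int s" "real_of_int s * of_int s = 1" by simp_all
  have "of_int q * (of_int s * (of_int a' - of_int y * x)) = real_of_int s * (of_int q * of_int a') - of_int q * of_int s * of_int y * x"
    by (simp add: algebra_simps)
  also have "\<dots> = real_of_int s * of_int s + real_of_int s * of_int a * of_int y - of_int q * of_int s * of_int y * x"
    unfolding e(1) by (simp add: algebra_simps)
  finally show ?thesis unfolding e(2) by (simp add: algebra_simps)
qed

text \<open>The vectors (q, a) and (y, a') form a lattice basis, so (k, b) is an integer combination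
  of them and its deviation is i * \<delta> - j * \<beta> up to sign. Since y > N - q, every k \<le>
  N is below q + y and \<open>mult_comb_ge\<close> applies.\<close>

lemma farey_cell_minimal:
  assumes "x \<in> farey_cell N \<eta> q a s" "1 \<le> q" "q \<le> N" "coprime a (int q)" "s * s = 1" "1 \<le> k" "k \<le> N"
  shows "\<bar>real q * x - of_int a\<bar> \<le> \<bar>real k * x - of_int b\<bar>"
proof -
  define y where "y = farey_next N q a s"
  have y: "int N - int q < y" "y \<le> int N" "int q dvd a * y + s"
    using farey_next[OF assms(2,4)] by (simp_all add: y_def)
  have y0: "y > 0" using y assms by linarith
  obtain a' where a': "a * y + s = int q * a'" using y(3) by (rule dvdE)
  define \<delta> where "\<delta> = of_int s * (real q * x - of_int a)"
  define \<beta> where "\<beta> = of_int s * (of_int a' - of_int y * x)"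
  have "s = 1 \<or> s = -1" using assms(5) by (metis zmult_eq_1_iff mult.commute)
  then have abs_s: "\<bar>of_int s * z\<bar> = \<bar>z\<bar>" for z :: real by (auto simp: abs_mult)
  have \<delta>: "0 \<le> \<delta>" "\<delta> \<le> 1 / (real q + of_int y)" using assms(1) by (auto simp: farey_cell_def \<delta>_def y_def)
  have id: "real q * \<beta> = 1 - of_int y * \<delta>"
    using farey_neighbour_identity[OF a' assms(5), of x] by (simp add: \<beta>_def \<delta>_def)
  have "\<delta> * (real q + of_int y) \<le> 1" using \<delta>(2) y0 assms(2) by (subst (asm) le_divide_eq) (auto split: if_splits)
  then have "real q * \<delta> \<le> real q * \<beta>" unfolding id by (simp add: algebra_simps)
  then have \<delta>\<beta>: "\<delta> \<le> \<beta>" using assms(2) by simp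
  \<comment> \<open>The coefficients of (k, b) in the basis, by Cramer's rule with determinant
    s.\<close>
  define i where "i = s * (int k * a' - b * y)"
  define j where "j = s * (int q * b - a * int k)"
  have qa': "int q * a' - a * y = s" using a' by simp
  have "i * int q + j * y = s * (int k * (int q * a' - a * y))" by (simp add: i_def j_def algebra_simps)
  also have "\<dots> = int k" unfolding qa' by (simp only: mult.left_commute[of s] assms(5) mult_1_right)
  finally have k: "int k = i * int q + j * y" ..
  have "\<delta> \<le> \<bar>of_int i * \<delta> - of_int j * \<beta>\<bar>"
    using k y y0 assms \<delta>(1) \<delta>\<beta> by (intro mult_comb_ge[of "int k" i "int q" j y]) auto
  also have "of_int i * \<delta> - of_int j * \<beta> = (of_int (i * int q + j * y)) * (of_int s * x) - of_int s * of_int (i * a + j * a')"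
    by (simp add: \<delta>_def \<beta>_def algebra_simps)
  also have "i * a + j * a' = s * (b * (int q * a' - a * y))" by (simp add: i_def j_def algebra_simps)
  also have "\<dots> = b" unfolding qa' by (simp only: mult.left_commute[of s] assms(5) mult_1_right)
  also have "i * int q + j * y = int k" using k ..
  also have "of_int (int k) * (of_int s * x) - of_int s * of_int b = of_int s * (real k * x - of_int b)"
    by (simp add: algebra_simps)
  finally have "\<delta> \<le> \<bar>real k * x - of_int b\<bar>" by (simp only: abs_s)
  moreover have "\<bar>real q * x - of_int a\<bar> = \<delta>" using \<delta>(1) abs_s unfolding \<delta>_def by (metis abs_of_nonneg)
  ultimately show ?thesis by simp
qed

text \<open>Converse of \<open>farey_cell_minimal\<close> inside the near set: minimality against
  the neighbour (y, a') gives \<delta> \<le> \<bar>\<beta>\<bar>, which is the mediant bound once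
  \<beta> is known to be positive.\<close>

lemma farey_cell_of_minimal:
  assumes q: "1 \<le> q" "q \<le> N" and cop: "coprime a (int q)" and s: "s * s = 1"
    and min: "\<And>k b. 1 \<le> k \<Longrightarrow> k \<le> N \<Longrightarrow> \<bar>real q * x - of_int a\<bar> \<le> \<bar>real k * x - of_int b\<bar>"
    and sign: "0 \<le> of_int s * (real q * x - of_int a)" and near: "x \<in> near_set N \<eta>"
  shows "x \<in> farey_cell N \<eta> q a s"
proof -
  define y where "y = farey_next N q a s"
  have y: "int N - int q < y" "y \<le> int N" "int q dvd a * y + s"
    using farey_next[OF q(1) cop] by (simp_all add: y_def)
  have y0: "y > 0" using y q by linarith
  obtain a' where a': "a * y + s = int q * a'" using y(3) by (rule dvdE)
  define \<delta> where "\<delta> = of_int s * (real q * x - of_int a)"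
  define \<beta> where "\<beta> = of_int s * (of_int a' - of_int y * x)"
  have "s = 1 \<or> s = -1" using s by (metis zmult_eq_1_iff mult.commute)
  then have abs_s: "\<bar>of_int s * z\<bar> = \<bar>z\<bar>" for z :: real by (auto simp: abs_mult)
  have \<delta>: "\<bar>real q * x - of_int a\<bar> = \<delta>" "\<delta> \<ge> 0" using sign abs_s unfolding \<delta>_def by (metis abs_of_nonneg, simp)
  have id: "real q * \<beta> = 1 - of_int y * \<delta>"
    using farey_neighbour_identity[OF a' s, of x] by (simp add: \<beta>_def \<delta>_def)
  have N0: "0 < N" using q by simp
  \<comment> \<open>Dirichlet's theorem puts the minimal deviation below 1 / N, so y * \<delta> < 1
    and \<beta> is positive.\<close>
  obtain h k where hk: "0 < k" "k \<le> int N" "\<bar>of_int k * x - of_int h\<bar> < 1 / real N"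
    using Dirichlet_approx[OF N0, of x] by blast
  have "\<delta> \<le> \<bar>real (nat k) * x - of_int h\<bar>" using min[of "nat k" h] hk \<delta> by auto
  then have "\<delta> < 1 / real N" using hk by simp
  then have "real N * \<delta> < 1" using q by (simp add: field_simps)
  moreover have "of_int y * \<delta> \<le> real N * \<delta>" using y(2) \<delta>(2) by (intro mult_right_mono) linarith+
  ultimately have "real q * \<beta> > 0" using id by linarith
  then have \<beta>0: "\<beta> > 0" using q by (simp add: zero_less_mult_iff)
  have "\<delta> \<le> \<bar>real (nat y) * x - of_int a'\<bar>" using min[of "nat y" a'] y y0 \<delta> by auto
  also have "\<dots> = \<bar>of_int s * (of_int a' - of_int y * x)\<bar>" using y0 by (simp add: abs_s abs_minus_commute)
  also have "\<dots> = \<beta>" using \<beta>0 by (simp add: \<beta>_def)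
  finally have "real q * \<delta> \<le> real q * \<beta>" by (intro mult_left_mono) auto
  then have "\<delta> * (real q + of_int y) \<le> 1" unfolding id by (simp add: algebra_simps)
  then have "\<delta> \<le> 1 / (real q + of_int y)" using y0 q by (subst le_divide_eq) (auto simp: add_pos_pos)
  moreover obtain k b where "1 \<le> k" "k \<le> N" "\<bar>real k * x - of_int b\<bar> \<le> \<eta>" using near by (auto simp: near_set_def)
  then have "\<delta> \<le> \<eta>" using min[of k b] \<delta> by linarith
  ultimately show ?thesis using sign unfolding farey_cell_def \<delta>_def y_def by simp
qed

section \<open>Measuring a near set through its cells\<close>

lemma Rats_if_linear:
  fixes x :: real
  assumes "of_int m * x = of_int n" "m \<noteq> 0"
  shows "x \<in> \<rat>"
proof -
  have "x = of_int n / of_int m" using assms by (simp add: field_simps)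
  then show ?thesis by simp
qed

text \<open>Minimise over k with b the nearest integer. A common factor d > 1 of q and a would make
  (q / d, a / d) strictly better, because the deviation of an irrational x is nonzero.\<close>

lemma minimiser_exists:
  assumes "N \<ge> 1" "x \<notin> \<rat>"
  obtains q a where "1 \<le> q" "q \<le> N" "coprime a (int q)"
    "\<And>k b. 1 \<le> k \<Longrightarrow> k \<le> N \<Longrightarrow> \<bar>real q * x - of_int a\<bar> \<le> \<bar>real k * x - of_int b\<bar>"
proof -
  define f where "f k = \<bar>real k * x - of_int (round (real k * x))\<bar>" for k :: nat
  obtain q where q: "q \<in> {1..N}" "\<And>k. k \<in> {1..N} \<Longrightarrow> f q \<le> f k"
    using ex_min_if_finite[of "f ` {1..N}"] assms(1)
    by (metis (no_types, lifting) arg_min_if_finite(1) arg_min_least atLeastAtMost_iff empty_iff finite_atLeastAtMost order_refl)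
  define a where "a = round (real q * x)"
  have min: "\<bar>real q * x - of_int a\<bar> \<le> \<bar>real k * x - of_int b\<bar>" if "1 \<le> k" "k \<le> N" for k b
  proof -
    have "\<bar>real q * x - of_int a\<bar> \<le> f k" using q(2)[of k] that by (simp add: f_def a_def)
    also have "\<dots> \<le> \<bar>real k * x - of_int b\<bar>" unfolding f_def by (rule round_diff_minimal)
    finally show ?thesis .
  qed
  have pos: "\<bar>real q * x - of_int a\<bar> > 0"
    using Rats_if_linear[of "int q" x a] assms(2) q(1) by auto
  have "coprime a (int q)"
  proof -
    define d where "d = gcd a (int q)"
    have d0: "d > 0" using q(1) by (auto simp: d_def)
    obtain a1 q1 where aq: "a = a1 * d" "int q = q1 * d"
      unfolding d_def by (metis dvd_def gcd_dvd1 gcd_dvd2 mult.commute)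
    have q1: "q1 > 0" using aq(2) d0 q(1) by (metis atLeastAtMost_iff of_nat_0_less_iff less_le_trans zero_less_one zero_less_mult_pos2)
    have "q1 * 1 \<le> q1 * d" using d0 q1 by (intro mult_left_mono) auto
    then have qN: "nat q1 \<le> N" using aq(2) q(1) by auto
    have "\<bar>real q * x - of_int a\<bar> \<le> \<bar>real (nat q1) * x - of_int a1\<bar>"
      using q1 qN by (intro min) auto
    moreover have "real q * x - of_int a = of_int d * (real (nat q1) * x - of_int a1)"
    proof -
      have "real q = of_int (q1 * d)" unfolding aq(2)[symmetric] by simp
      then show ?thesis using q1 by (simp add: aq(1) algebra_simps)
    qed
    then have "\<bar>real q * x - of_int a\<bar> = of_int d * \<bar>real (nat q1) * x - of_int a1\<bar>"
      using d0 by (simp add: abs_mult)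
    ultimately have "of_int d * \<bar>real (nat q1) * x - of_int a1\<bar> \<le> 1 * \<bar>real (nat q1) * x - of_int a1\<bar>"
      and "\<bar>real (nat q1) * x - of_int a1\<bar> > 0" using pos by linarith+
    then have "real_of_int d \<le> 1" by (simp only: mult_le_cancel_right_pos)
    then have "d = 1" using d0 by simp
    then show ?thesis by (simp add: d_def coprime_iff_gcd_eq_1)
  qed
  then show thesis using that[of q a] q(1) min by auto
qed

lemma farey_cell_eq_interval:
  assumes "1 \<le> q" "s = 1 \<or> s = -1" "0 \<le> \<eta>" "coprime a (int q)" "q \<le> N"
  shows "\<exists>l. farey_cell N \<eta> q a s = {l..l + min \<eta> (1 / (real q + of_int (farey_next N q a s))) / real q}"
    "0 \<le> min \<eta> (1 / (real q + of_int (farey_next N q a s)))"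
proof -
  define m where "m = min \<eta> (1 / (real q + of_int (farey_next N q a s)))"
  have "farey_next N q a s > 0" using farey_next(1)[OF assms(1,4), of N s] assms(5) by linarith
  then have "m \<ge> 0" using assms by (simp add: m_def)
  then show "0 \<le> min \<eta> (1 / (real q + of_int (farey_next N q a s)))" by (simp add: m_def)
  have q0: "real q > 0" using assms by simp
  show "\<exists>l. farey_cell N \<eta> q a s = {l..l + min \<eta> (1 / (real q + of_int (farey_next N q a s))) / real q}"
    unfolding m_def[symmetric]
  proof (cases "s = 1")
    case True
    have "farey_cell N \<eta> q a s = {x. 0 \<le> real q * x - of_int a \<and> real q * x - of_int a \<le> m}"
      using True by (auto simp: farey_cell_def m_def)
    also have "\<dots> = {of_int a / real q..of_int a / real q + m / real q}"
      using q0 by (auto simp: field_simps)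
    finally show "\<exists>l. farey_cell N \<eta> q a s = {l..l + m / real q}" by blast
  next
    case False
    then have "s = -1" using assms by simp
    then have "farey_cell N \<eta> q a s = {x. 0 \<le> - (real q * x - of_int a) \<and> - (real q * x - of_int a) \<le> m}"
      by (auto simp: farey_cell_def m_def)
    also have "\<dots> = {(of_int a - m) / real q..(of_int a - m) / real q + m / real q}"
      using q0 by (auto simp: field_simps)
    finally show "\<exists>l. farey_cell N \<eta> q a s = {l..l + m / real q}" by blast
  qed
qed

lemma near_set_borel [measurable]: "near_set N \<eta> \<in> sets borel"
proof -
  have "near_set N \<eta> = (\<Union>q\<in>{1..N}. \<Union>a::int. {x. \<bar>real q * x - of_int a\<bar> \<le> \<eta>})"
    by (auto simp: near_set_def)
  also have "\<dots> \<in> sets borel" by measurable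
  finally show ?thesis .
qed

text \<open>A cell is assigned to the interval by the position of its fraction a / q, so it may
  stick out of {\<alpha>..<\<beta>} by up to 1 / N; this is the source of the terms 2 / N
  below.\<close>

definition farey_index :: "nat \<Rightarrow> real \<Rightarrow> real \<Rightarrow> (nat \<times> int \<times> int) set" where
  "farey_index N \<alpha> \<beta> = (SIGMA q:{1..N}. {a. \<alpha> * real q \<le> of_int a \<and> of_int a < \<beta> * real q \<and> coprime a (int q)} \<times> {1, -1})"

definition cell_length :: "nat \<Rightarrow> real \<Rightarrow> nat \<times> int \<times> int \<Rightarrow> real" where
  "cell_length N \<eta> = (\<lambda>(q, a, s). min \<eta> (1 / (real q + of_int (farey_next N q a s))) / real q)"

lemma finite_numerators: "finite {a. \<alpha> * real q \<le> of_int a \<and> of_int a < \<beta> * real q \<and> coprime a (int q)}"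
  by (rule finite_subset[of _ "{\<lceil>\<alpha> * real q\<rceil>..\<lceil>\<beta> * real q\<rceil>}"]) (auto simp: ceiling_le_iff le_ceiling_iff)

lemma finite_farey_index [simp]: "finite (farey_index N \<alpha> \<beta>)"
  unfolding farey_index_def by (intro finite_SigmaI finite_cartesian_product finite_numerators) auto

lemma farey_indexD:
  assumes "(q, a, s) \<in> farey_index N \<alpha> \<beta>"
  shows "1 \<le> q" "q \<le> N" "coprime a (int q)" "s = 1 \<or> s = -1" "s * s = 1" "\<alpha> \<le> of_int a / real q" "of_int a / real q < \<beta>"
  using assms by (auto simp: farey_index_def field_simps)

lemma measure_farey_cell:
  assumes "(q, a, s) \<in> farey_index N \<alpha> \<beta>" "0 \<le> \<eta>"
  shows "farey_cell N \<eta> q a s \<in> fmeasurable lborel" "measure lborel (farey_cell N \<eta> q a s) = cell_length N \<eta> (q, a, s)"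
proof -
  note d = farey_indexD[OF assms(1)]
  obtain l where l: "farey_cell N \<eta> q a s = {l..l + cell_length N \<eta> (q, a, s)}"
    using farey_cell_eq_interval(1)[OF d(1,4) assms(2) d(3,2)] by (auto simp: cell_length_def)
  have "0 \<le> cell_length N \<eta> (q, a, s)"
    using farey_cell_eq_interval(2)[OF d(1,4) assms(2) d(3,2)] by (simp add: cell_length_def)
  then show "farey_cell N \<eta> q a s \<in> fmeasurable lborel" "measure lborel (farey_cell N \<eta> q a s) = cell_length N \<eta> (q, a, s)"
    unfolding l by (auto intro: fmeasurableI)
qed

text \<open>The window for the neighbour forces q + q' > N, and dividing the deviation by q \<ge> 1
  only helps.\<close>

lemma farey_cell_dist:
  assumes "(q, a, s) \<in> farey_index N \<alpha> \<beta>" "x \<in> farey_cell N \<eta> q a s"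
  shows "\<bar>x - of_int a / real q\<bar> \<le> 1 / real N"
proof -
  note d = farey_indexD[OF assms(1)]
  define y where "y = farey_next N q a s"
  have y: "int N < int q + y" using farey_next(1)[OF d(1,3), of N s] by (simp add: y_def)
  then have y': "real N \<le> real q + of_int y" by linarith
  have N0: "real N > 0" "real q > 0" using d by auto
  have "\<bar>real q * x - of_int a\<bar> \<le> 1 / (real q + of_int y)" using assms(2) d(4) by (auto simp: farey_cell_def y_def)
  also have "\<dots> \<le> 1 / real N" using y' N0 by (intro divide_left_mono) auto
  finally have "\<bar>real q * x - of_int a\<bar> \<le> 1 / real N" .
  moreover have "x - of_int a / real q = (real q * x - of_int a) / real q" using N0 by (simp add: field_simps)
  ultimately have "\<bar>x - of_int a / real q\<bar> = \<bar>real q * x - of_int a\<bar> / real q"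
    using N0 by (simp add: abs_divide)
  also have "\<dots> \<le> 1 / real N / real q"
    by (rule divide_right_mono) (use \<open>\<bar>real q * x - of_int a\<bar> \<le> 1 / real N\<close> in auto)
  also have "\<dots> \<le> 1 / real N / 1" using d(1) N0 by (intro divide_left_mono) auto
  also have "\<dots> = 1 / real N" by simp
  finally show ?thesis .
qed

lemma countable_rats_null: "(\<rat> :: real set) \<in> null_sets lborel"
  by (intro countable_imp_null_set_lborel countable_rat)

lemma fmeasurable_bounded_Int:
  fixes A S :: "real set"
  assumes "bounded A" "A \<in> sets borel" "S \<in> sets borel"
  shows "A \<inter> S \<in> fmeasurable lborel"
proof -
  have "bounded (A \<inter> S)" using assms(1) by (simp add: bounded_Int)
  from emeasure_bounded_finite[OF this] show ?thesis using assms by (intro fmeasurableI) auto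
qed

text \<open>An irrational point of the near set lies in the cell of its best denominator. If that
  cell is not indexed, its fraction is outside {\<alpha>..<\<beta>}, and the point is within 1 / N
  of an endpoint.\<close>

lemma near_set_measure_le:
  assumes "N \<ge> 1" "0 \<le> \<eta>" "\<alpha> \<le> \<beta>"
  shows "measure lborel ({\<alpha>..<\<beta>} \<inter> near_set N \<eta>) \<le> (\<Sum>i\<in>farey_index N \<alpha> \<beta>. cell_length N \<eta> i) + 2 / real N"
proof -
  define U where "U = (\<Union>(q, a, s)\<in>farey_index N \<alpha> \<beta>. farey_cell N \<eta> q a s)"
  define B where "B = {\<alpha>..\<alpha> + 1 / real N} \<union> {\<beta> - 1 / real N..\<beta>}"
  have U: "U \<in> sets lborel" unfolding U_def
    by (intro sets.finite_UN) auto
  have "measure lborel U \<le> (\<Sum>i\<in>farey_index N \<alpha> \<beta>. measure lborel (case i of (q, a, s) \<Rightarrow> farey_cell N \<eta> q a s))"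
    unfolding U_def by (intro measure_UNION_le) auto
  also have "\<dots> = (\<Sum>i\<in>farey_index N \<alpha> \<beta>. cell_length N \<eta> i)"
    using measure_farey_cell(2)[OF _ assms(2)] by (intro sum.cong refl) auto
  finally have mU: "measure lborel U \<le> (\<Sum>i\<in>farey_index N \<alpha> \<beta>. cell_length N \<eta> i)" .
  have B: "B \<in> sets lborel" by (simp add: B_def)
  have "measure lborel B \<le> measure lborel {\<alpha>..\<alpha> + 1 / real N} + measure lborel {\<beta> - 1 / real N..\<beta>}"
    unfolding B_def by (intro measure_Un_le) auto
  also have "\<dots> = 2 / real N" by simp
  finally have mB: "measure lborel B \<le> 2 / real N" .
  have bnd: "bounded (U \<union> B)"
  proof -
    have "bounded U" unfolding U_def
    proof (intro bounded_UN ballI)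
      fix i assume "i \<in> farey_index N \<alpha> \<beta>"
      moreover obtain q a s where i: "i = (q, a, s)" by (cases i)
      ultimately have "farey_cell N \<eta> q a s \<subseteq> cball (of_int a / real q) (1 / real N)"
        using farey_cell_dist by (force simp: dist_real_def abs_minus_commute)
      then show "bounded (case i of (q, a, s) \<Rightarrow> farey_cell N \<eta> q a s)" using i bounded_cball bounded_subset by auto
    qed simp
    then show ?thesis by (simp add: B_def)
  qed
  have sub: "{\<alpha>..<\<beta>} \<inter> near_set N \<eta> - \<rat> \<subseteq> U \<union> B"
  proof
    fix x assume x: "x \<in> {\<alpha>..<\<beta>} \<inter> near_set N \<eta> - \<rat>"
    then obtain q a where qa: "1 \<le> q" "q \<le> N" "coprime a (int q)"
      "\<And>k b. 1 \<le> k \<Longrightarrow> k \<le> N \<Longrightarrow> \<bar>real q * x - of_int a\<bar> \<le> \<bar>real k * x - of_int b\<bar>"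
      using minimiser_exists[OF assms(1), of x] by blast
    define s :: int where "s = (if real q * x - of_int a \<ge> 0 then 1 else -1)"
    have "x \<in> farey_cell N \<eta> q a s"
      using qa x by (intro farey_cell_of_minimal) (auto simp: s_def)
    \<comment> \<open>An auxiliary interval starting at a / q, so that
      \<open>farey_cell_dist\<close> applies before the position of a / q relative to
      {\<alpha>..<\<beta>} is known.\<close>
    moreover have "(q, a, s) \<in> farey_index N (of_int a / real q) (of_int a / real q + 1)"
      using qa by (auto simp: farey_index_def s_def field_simps)
    ultimately have dist: "\<bar>x - of_int a / real q\<bar> \<le> 1 / real N" using farey_cell_dist by blast
    show "x \<in> U \<union> B"
    proof (cases "\<alpha> \<le> of_int a / real q \<and> of_int a / real q < \<beta>")
      case True
      then have "(q, a, s) \<in> farey_index N \<alpha> \<beta>"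
        using qa by (auto simp: farey_index_def s_def field_simps)
      then show ?thesis using \<open>x \<in> farey_cell N \<eta> q a s\<close> unfolding U_def by blast
    next
      case False
      then show ?thesis using dist x by (auto simp: B_def)
    qed
  qed
  have "measure lborel ({\<alpha>..<\<beta>} \<inter> near_set N \<eta>) = measure lborel ({\<alpha>..<\<beta>} \<inter> near_set N \<eta> - \<rat>)"
    by (rule measure_Diff_null_set[symmetric]) (auto intro: countable_rats_null)
  also have "\<dots> \<le> measure lborel (U \<union> B)"
  proof (rule measure_mono_fmeasurable[OF sub])
    show "{\<alpha>..<\<beta>} \<inter> near_set N \<eta> - \<rat> \<in> sets lborel" using countable_rats_null by (intro sets.Diff) auto
    show "U \<union> B \<in> fmeasurable lborel"
      using emeasure_bounded_finite[OF bnd] U B by (intro fmeasurableI) auto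
  qed
  also have "\<dots> \<le> measure lborel U + measure lborel B" using U B by (rule measure_Un_le)
  finally show ?thesis using mU mB by simp
qed

text \<open>Cells are disjoint away from the rationals. At a common point both fractions have the
  same deviation up to sign, which makes the point rational unless the fractions coincide; and two
  opposite sides of one fraction meet only at the fraction.\<close>

lemma near_set_measure_ge:
  assumes "N \<ge> 1" "0 \<le> \<eta>" "\<alpha> \<le> \<beta>"
  shows "(\<Sum>i\<in>farey_index N \<alpha> \<beta>. cell_length N \<eta> i) \<le> measure lborel ({\<alpha>..<\<beta>} \<inter> near_set N \<eta>) + 2 / real N"
proof -
  define W where "W i = (case i of (q, a, s) \<Rightarrow> farey_cell N \<eta> q a s) - \<rat>" for i
  define B where "B = {\<alpha> - 1 / real N..\<alpha>} \<union> {\<beta>..\<beta> + 1 / real N}"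
  let ?I = "farey_index N \<alpha> \<beta>"
  have W: "W i \<in> fmeasurable lborel" "measure lborel (W i) = cell_length N \<eta> i" if i: "i \<in> ?I" for i
  proof -
    obtain q a s where qas: "i = (q, a, s)" by (cases i)
    note m = measure_farey_cell[OF i[unfolded qas] assms(2)]
    show "W i \<in> fmeasurable lborel"
      by (rule fmeasurableI2[OF m(1)]) (auto simp: W_def qas intro: sets.Diff null_setsD2[OF countable_rats_null, simplified])
    show "measure lborel (W i) = cell_length N \<eta> i"
      unfolding W_def qas using m countable_rats_null by (simp add: measure_Diff_null_set)
  qed
  have disj: "pairwise (\<lambda>i j. disjnt (W i) (W j)) ?I"
  proof (rule pairwiseI)
    fix i j assume ij: "i \<in> ?I" "j \<in> ?I" "i \<noteq> j"
    obtain q a s where i: "i = (q, a, s)" by (cases i)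
    obtain k b r where j: "j = (k, b, r)" by (cases j)
    note di = farey_indexD[OF ij(1)[unfolded i]] and dj = farey_indexD[OF ij(2)[unfolded j]]
    show "disjnt (W i) (W j)"
    proof (rule ccontr)
      assume "\<not> disjnt (W i) (W j)"
      then obtain x where x: "x \<in> farey_cell N \<eta> q a s" "x \<in> farey_cell N \<eta> k b r" "x \<notin> \<rat>"
        by (auto simp: disjnt_def W_def i j)
      have "\<bar>real q * x - of_int a\<bar> = \<bar>real k * x - of_int b\<bar>"
        using farey_cell_minimal[OF x(1) di(1-3,5) dj(1,2)] farey_cell_minimal[OF x(2) dj(1-3,5) di(1,2)]
        by (intro antisym) auto
      then consider "real q * x - of_int a = real k * x - of_int b" | "real q * x - of_int a = - (real k * x - of_int b)" by linarith
      then have qk: "q = k \<and> a = b"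
      proof cases
        case 1
        then have e: "of_int (int q - int k) * x = of_int (a - b)" by (simp add: algebra_simps)
        then have "int q - int k = 0" using Rats_if_linear x(3) by blast
        then show ?thesis using e by simp
      next
        case 2
        then have e: "of_int (int q + int k) * x = of_int (a + b)" by (simp add: algebra_simps)
        then have "int q + int k = 0" using Rats_if_linear x(3) by blast
        then show ?thesis using di(1) by simp
      qed
      have "s \<noteq> r" using ij(3) qk i j by simp
      then have "of_int s = - real_of_int r" using di(4) dj(4) by auto
      then have "real q * x - of_int a = 0" using x(1,2) qk di(4) by (auto simp: farey_cell_def)
      then have "of_int (int q) * x = of_int a" by simp
      then show False using Rats_if_linear[of "int q" x a] x(3) di(1) by simp
    qed
  qed
  have "(\<Sum>i\<in>?I. cell_length N \<eta> i) = (\<Sum>i\<in>?I. measure lborel (W i))" using W by simp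
  also have "\<dots> = measure lborel (\<Union>i\<in>?I. W i)"
    using W disj by (intro measure_UNION'[symmetric]) auto
  also have "\<dots> \<le> measure lborel (({\<alpha>..<\<beta>} \<inter> near_set N \<eta>) \<union> B)"
  proof (rule measure_mono_fmeasurable)
    show "(\<Union>i\<in>?I. W i) \<subseteq> ({\<alpha>..<\<beta>} \<inter> near_set N \<eta>) \<union> B"
    proof
      fix x assume "x \<in> (\<Union>i\<in>?I. W i)"
      then obtain q a s where i: "(q, a, s) \<in> ?I" "x \<in> farey_cell N \<eta> q a s" by (auto simp: W_def)
      note d = farey_indexD[OF i(1)]
      have "\<bar>x - of_int a / real q\<bar> \<le> 1 / real N" using farey_cell_dist[OF i] .
      moreover have "\<bar>real q * x - of_int a\<bar> \<le> \<eta>" using i(2) d(4) by (auto simp: farey_cell_def)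
      then have "x \<in> near_set N \<eta>" using d(1,2) by (auto simp: near_set_def)
      ultimately show "x \<in> ({\<alpha>..<\<beta>} \<inter> near_set N \<eta>) \<union> B"
        using d(6,7) unfolding B_def by (cases "\<alpha> \<le> x \<and> x < \<beta>") (simp, simp, linarith)
    qed
    show "(\<Union>i\<in>?I. W i) \<in> sets lborel" using fmeasurableD[OF W(1)] by (intro sets.finite_UN) auto
    show "({\<alpha>..<\<beta>} \<inter> near_set N \<eta>) \<union> B \<in> fmeasurable lborel"
      unfolding B_def by (intro fmeasurable.Un fmeasurable_bounded_Int) (auto intro!: fmeasurableI)
  qed
  also have "\<dots> \<le> measure lborel ({\<alpha>..<\<beta>} \<inter> near_set N \<eta>) + measure lborel B"
    by (intro measure_Un_le) (auto simp: B_def)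
  also have "measure lborel B \<le> measure lborel {\<alpha> - 1 / real N..\<alpha>} + measure lborel {\<beta>..\<beta> + 1 / real N}"
    unfolding B_def by (intro measure_Un_le) auto
  finally show ?thesis by simp
qed

section \<open>The measure of well approximable points\<close>

text \<open>With q + q' in {N<..N + q}, the condition \<sigma> * (q + q') < N leaves about min q (w
  * N) values of q', where w = 1 / \<sigma> - 1 for \<sigma> < 1. Clipping \<sigma> at 1/2 keeps w
  \<le> 1 without changing this minimum, as q \<le> N, and also covers \<sigma> = 0.\<close>

definition overlap :: "real \<Rightarrow> real" where
  "overlap \<sigma> = max 0 (1 / max \<sigma> (1/2) - 1)"

lemma overlap_bounds: "0 \<le> overlap \<sigma>" "overlap \<sigma> \<le> 1"
proof -
  have "1 / max \<sigma> (1/2) \<le> 1 / (1/2::real)" by (intro divide_left_mono) auto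
  then show "0 \<le> overlap \<sigma>" "overlap \<sigma> \<le> 1" by (auto simp: overlap_def)
qed

text \<open>For w = (1 - \<sigma>) / \<sigma> the logarithm in \<open>psi\<close> is - ln w. In this
  form the density is directly comparable with \<open>totient_weighted_sum_asymp\<close>.\<close>

lemma limit_density_eq:
  "limit_density \<sigma> = 2 * (6 / pi\<^sup>2 * (overlap \<sigma> - overlap \<sigma> * ln (overlap \<sigma>)))"
proof -
  consider "\<sigma> \<le> 1/2" | "1/2 < \<sigma>" "\<sigma> < 1" | "\<sigma> \<ge> 1" by linarith
  then show ?thesis
  proof cases
    case 1
    then have "overlap \<sigma> = 1" by (simp add: overlap_def max_def)
    then show ?thesis using 1 by (simp add: limit_density_def real_zeta_2)
  next
    case 2
    then have "overlap \<sigma> = (1 - \<sigma>) / \<sigma>" by (simp add: overlap_def max_def field_simps)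
    moreover have "ln (\<sigma> / (1 - \<sigma>)) = - ln ((1 - \<sigma>) / \<sigma>)" using 2 by (simp add: ln_div)
    ultimately show ?thesis using 2 by (simp add: limit_density_def real_zeta_2 psi_def algebra_simps)
  next
    case 3
    then have "overlap \<sigma> = 0" by (simp add: overlap_def max_def)
    then show ?thesis using 3 by (simp add: limit_density_def)
  qed
qed

text \<open>Passing through \<open>overlap\<close> treats both break points 1/2 and 1 at once; what
  remains is the continuity of w - w * ln w at w = 0.\<close>

lemma continuous_limit_density: "continuous_on UNIV limit_density"
proof -
  define G where "G w = w - w * ln w" for w :: real
  have G0: "continuous_on {0..} G"
    unfolding continuous_on_eq_continuous_within
  proof
    fix w :: real assume "w \<in> {0..}"
    show "continuous (at w within {0..}) G"
    proof (cases "w = 0")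
      case True
      have "((\<lambda>w::real. w - w * ln w) \<longlongrightarrow> 0) (at_right 0)" by real_asymp
      then show ?thesis using True by (simp add: continuous_within G_def[abs_def] at_within_Ici_at_right)
    next
      case False
      then have "isCont G w" unfolding G_def using \<open>w \<in> {0..}\<close> by (intro continuous_intros) auto
      then show ?thesis by (rule continuous_at_imp_continuous_at_within)
    qed
  qed
  have "continuous_on UNIV overlap" unfolding overlap_def by (intro continuous_intros) (auto simp: max_def)
  moreover have "overlap ` UNIV \<subseteq> {0..}" using overlap_bounds(1) by auto
  ultimately have "continuous_on UNIV (\<lambda>\<sigma>. G (overlap \<sigma>))" using G0 continuous_on_compose2 by blast
  then have "continuous_on UNIV (\<lambda>\<sigma>. 2 * (6 / pi\<^sup>2 * G (overlap \<sigma>)))" by (intro continuous_intros)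
  then show ?thesis unfolding limit_density_eq[abs_def] G_def .
qed

lemma limit_density_integrable [simp]: "limit_density integrable_on {a..b}"
  using continuous_limit_density by (intro integrable_continuous_interval) (rule continuous_on_subset, auto)

lemma overlap_ln_nonpos: "overlap \<sigma> * ln (overlap \<sigma>) \<le> 0"
  using overlap_bounds[of \<sigma>] by (intro mult_nonneg_nonpos) (auto simp: ln_le_zero_iff le_less)

lemma limit_density_nonneg: "0 \<le> limit_density \<sigma>"
  unfolding limit_density_eq using overlap_bounds[of \<sigma>] overlap_ln_nonpos[of \<sigma>] by simp

text \<open>Since ln (1 / w) \<le> 1 / w - 1, the expression w - w * ln w is at most 1. The bound
  becomes the Lipschitz constant of \<open>cumul\<close>.\<close>

lemma limit_density_le: "limit_density \<sigma> \<le> 2"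
proof -
  let ?w = "overlap \<sigma>"
  have "?w - ?w * ln ?w \<le> 1"
  proof (cases "?w = 0")
    case False
    then have w: "?w > 0" using overlap_bounds[of \<sigma>] by simp
    have "ln (1 / ?w) \<le> 1 / ?w - 1" using w by (intro ln_le_minus_one) auto
    then have "?w * ln (1 / ?w) \<le> ?w * (1 / ?w - 1)" using w by (intro mult_left_mono) auto
    then show ?thesis using w by (simp add: ln_div algebra_simps)
  qed simp
  moreover have "6 / pi\<^sup>2 \<le> (1::real)" using pi_squared_ge_6 by (simp add: divide_le_eq)
  moreover have "0 \<le> ?w - ?w * ln ?w" using overlap_ln_nonpos[of \<sigma>] overlap_bounds[of \<sigma>] by simp
  ultimately have "6 / pi\<^sup>2 * (?w - ?w * ln ?w) \<le> 1 * 1" by (intro mult_mono) auto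
  then show ?thesis unfolding limit_density_eq by (rule order_trans[OF mult_left_mono]) auto
qed

section \<open>Counting the cells at one level \<sigma>\<close>

lemma numerator_range:
  fixes \<alpha> \<beta> :: real and q :: nat
  assumes "0 \<le> \<alpha>" "\<alpha> \<le> \<beta>" "\<beta> \<le> 1"
  obtains a0 n1 where "{a::int. \<alpha> * real q \<le> of_int a \<and> of_int a < \<beta> * real q} = {a0..<a0 + int n1}"
    "n1 \<le> q" "\<bar>real n1 - (\<beta> - \<alpha>) * real q\<bar> \<le> 1"
proof -
  define a0 where "a0 = \<lceil>\<alpha> * real q\<rceil>"
  define b0 where "b0 = \<lceil>\<beta> * real q\<rceil>"
  have ab: "a0 \<le> b0" unfolding a0_def b0_def using assms by (intro ceiling_mono mult_right_mono) auto
  have "\<beta> * real q \<le> real q" using assms by (simp add: mult_left_le_one_le)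
  then have bq: "b0 \<le> int q" by (simp add: b0_def ceiling_le_iff)
  have a00: "0 \<le> a0" unfolding a0_def using assms by (simp add: le_ceiling_iff) (meson less_le_trans mult_nonneg_nonneg of_nat_0_le_iff neg_less_0_iff_less zero_less_one order.strict_trans2)
  show thesis
  proof (rule that[of a0 "nat (b0 - a0)"])
    show "{a::int. \<alpha> * real q \<le> of_int a \<and> of_int a < \<beta> * real q} = {a0..<a0 + int (nat (b0 - a0))}"
      using ab by (auto simp: a0_def b0_def ceiling_le_iff less_ceiling_iff)
    show "nat (b0 - a0) \<le> q" using a00 bq by simp
    have "real (nat (b0 - a0)) = of_int b0 - of_int a0" using ab by simp
    then show "\<bar>real (nat (b0 - a0)) - (\<beta> - \<alpha>) * real q\<bar> \<le> 1"
      using ceiling_correct[of "\<alpha> * real q"] ceiling_correct[of "\<beta> * real q"]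
      unfolding a0_def b0_def left_diff_distrib by linarith
  qed
qed

text \<open>The level condition cuts the window of possible neighbours down to an initial segment,
  so that \<open>hyperbola_count\<close> applies to it.\<close>

lemma denominator_range:
  fixes \<sigma> :: real and q N :: nat
  assumes "1 \<le> q" "q \<le> N" "0 \<le> \<sigma>"
  obtains y0 n2 where "{y::int. int N - int q < y \<and> y \<le> int N \<and> \<sigma> * (real q + of_int y) < real N} = {y0..<y0 + int n2}"
    "n2 \<le> q" "\<bar>real n2 - min (real q) (overlap \<sigma> * real N)\<bar> \<le> 1"
proof (cases "\<sigma> = 0")
  \<comment> \<open>Here N / \<sigma> would be 0 in HOL, whereas every y in the window is
    admissible.\<close>
  case True
  show thesis
  proof (rule that[of "int N - int q + 1" q])
    show "{y::int. int N - int q < y \<and> y \<le> int N \<and> \<sigma> * (real q + of_int y) < real N} = {int N - int q + 1..<int N - int q + 1 + int q}"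
      using True assms by auto
    show "\<bar>real q - min (real q) (overlap \<sigma> * real N)\<bar> \<le> 1" using True assms by (simp add: overlap_def max_def)
  qed simp
next
  case False
  then have \<sigma>: "\<sigma> > 0" using assms by simp
  define c where "c = \<lceil>real N / \<sigma>\<rceil>"
  \<comment> \<open>The admissible sums q + y are the integers strictly between N and c; there are c
    - N - 1 of them, capped by the window length q.\<close>
  define n2 where "n2 = nat (min (int q) (c - int N - 1))"
  have c: "real N / \<sigma> \<le> of_int c" "of_int c < real N / \<sigma> + 1" unfolding c_def by linarith+
  show thesis
  proof (rule that[of "int N - int q + 1" n2])
    have iff: "\<sigma> * (real q + of_int y) < real N \<longleftrightarrow> int q + y < c" for y :: int
    proof -
      have "\<sigma> * (real q + of_int y) < real N \<longleftrightarrow> of_int (int q + y) < real N / \<sigma>"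
        using \<sigma> by (simp add: less_divide_eq mult.commute)
      then show ?thesis by (simp only: c_def less_ceiling_iff)
    qed
    show "{y::int. int N - int q < y \<and> y \<le> int N \<and> \<sigma> * (real q + of_int y) < real N} = {int N - int q + 1..<int N - int q + 1 + int n2}"
      unfolding iff n2_def by auto
    show "n2 \<le> q" by (simp add: n2_def)
    consider "\<sigma> \<le> 1/2" | "1/2 < \<sigma>" "\<sigma> < 1" | "\<sigma> \<ge> 1" by linarith
    then show "\<bar>real n2 - min (real q) (overlap \<sigma> * real N)\<bar> \<le> 1"
    proof cases
      case 1
      have "real N / (1/2) \<le> real N / \<sigma>" using 1 \<sigma> by (intro divide_left_mono) auto
      then have "real_of_int (2 * int N) \<le> of_int c" using c(1) by simp
      then have "2 * int N \<le> c" by (simp only: of_int_le_iff)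
      then have "real n2 \<ge> real q - 1" "real n2 \<le> real q" using assms by (auto simp: n2_def)
      moreover have "overlap \<sigma> = 1" using 1 by (simp add: overlap_def max_def)
      ultimately show ?thesis using assms by simp
    next
      case 2
      have ov: "overlap \<sigma> = 1 / \<sigma> - 1" using 2 by (simp add: overlap_def max_def)
      have w: "overlap \<sigma> * real N = real N / \<sigma> - real N" unfolding ov by (simp add: left_diff_distrib)
      have "real N / 1 < real N / \<sigma>" using 2 assms by (intro divide_strict_left_mono) auto
      then have "int N < c" using c(1) by linarith
      then have "real n2 = min (real q) (of_int c - real N - 1)"
        by (auto simp: n2_def min_def)
      then show ?thesis using c unfolding w by linarith
    next
      case 3
      have "real N / \<sigma> \<le> real N / 1" using 3 by (intro divide_left_mono) auto
      then have "c \<le> int N" by (simp add: c_def ceiling_le_iff)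
      then have "n2 = 0" by (simp add: n2_def)
      moreover have "overlap \<sigma> = 0" using 3 by (simp add: overlap_def max_def)
      ultimately show ?thesis by simp
    qed
  qed
qed

definition cell_count :: "nat \<Rightarrow> real \<Rightarrow> real \<Rightarrow> real \<Rightarrow> nat \<Rightarrow> int \<Rightarrow> nat" where
  "cell_count N \<alpha> \<beta> \<sigma> q s = card {a::int. \<alpha> * real q \<le> of_int a \<and> of_int a < \<beta> * real q \<and> coprime a (int q)
      \<and> \<sigma> * (real q + of_int (farey_next N q a s)) < real N}"

text \<open>Pairing a with \<open>farey_next N q a s\<close> identifies the counted numerators with
  the points of a * y = - s in a box; coprimality of a and q is automatic because - s is a unit.
  Rounding the two side lengths costs at most 2.\<close>

lemma cell_count_asymp:
  assumes "0 \<le> \<alpha>" "\<alpha> \<le> \<beta>" "\<beta> \<le> 1" "1 \<le> q" "q \<le> N" "0 \<le> \<sigma>" "s = 1 \<or> s = -1"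
  shows "\<bar>real (cell_count N \<alpha> \<beta> \<sigma> q s) - (\<beta> - \<alpha>) * real (totient q) / real q * min (real q) (overlap \<sigma> * real N)\<bar>
    \<le> 2 + 6 * real q powr (3/4) * real (tau q) ^ 3 * (1 + ln (real q)) ^ 2"
proof -
  define A where "A = {a::int. \<alpha> * real q \<le> of_int a \<and> of_int a < \<beta> * real q}"
  define Y where "Y = {y::int. int N - int q < y \<and> y \<le> int N \<and> \<sigma> * (real q + of_int y) < real N}"
  define M where "M = min (real q) (overlap \<sigma> * real N)"
  obtain a0 n1 where A: "A = {a0..<a0 + int n1}" "n1 \<le> q" "\<bar>real n1 - (\<beta> - \<alpha>) * real q\<bar> \<le> 1"
    using numerator_range[OF assms(1-3), of q, folded A_def] by blast
  obtain y0 n2 where Y: "Y = {y0..<y0 + int n2}" "n2 \<le> q" "\<bar>real n2 - M\<bar> \<le> 1"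
    using denominator_range[OF assms(4-6), folded Y_def M_def] by blast
  have cop: "coprime a (int q)" if "int q dvd a * y + s" for a y
  proof -
    have "gcd a (int q) dvd (a * y + s) - a * y" using that by (intro dvd_diff) (auto intro: dvd_trans[OF gcd_dvd2])
    then have "gcd a (int q) dvd s" by simp
    then have "gcd a (int q) dvd 1" using assms(7) by auto
    then show ?thesis by (simp add: coprime_iff_gcd_eq_1)
  qed
  have "bij_betw (\<lambda>a. (a, farey_next N q a s))
      {a. \<alpha> * real q \<le> of_int a \<and> of_int a < \<beta> * real q \<and> coprime a (int q) \<and> \<sigma> * (real q + of_int (farey_next N q a s)) < real N}
      {(a, y) \<in> A \<times> Y. int q dvd a * y - (- s)}"
    unfolding bij_betw_def
  proof
    show "(\<lambda>a. (a, farey_next N q a s)) ` {a. \<alpha> * real q \<le> of_int a \<and> of_int a < \<beta> * real q \<and> coprime a (int q) \<and> \<sigma> * (real q + of_int (farey_next N q a s)) < real N}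
       = {(a, y) \<in> A \<times> Y. int q dvd a * y - (- s)}" (is "?f ` ?S = ?T")
    proof (intro subset_antisym subsetI)
      fix p assume "p \<in> ?f ` ?S"
      then obtain a where a: "a \<in> ?S" "p = (a, farey_next N q a s)" by blast
      then show "p \<in> ?T" using farey_next[OF assms(4), of a N s] by (auto simp: A_def Y_def)
    next
      fix p assume "p \<in> ?T"
      then obtain a y where p: "p = (a, y)" "a \<in> A" "y \<in> Y" "int q dvd a * y + s" by auto
      have "coprime a (int q)" using cop p(4) .
      moreover from this have "farey_next N q a s = y"
        using p by (intro farey_next_eqI) (auto simp: Y_def assms)
      ultimately show "p \<in> ?f ` ?S" using p by (intro image_eqI[of _ _ a]) (auto simp: A_def Y_def)
    qed
  qed (auto intro: inj_onI)
  then have cc: "cell_count N \<alpha> \<beta> \<sigma> q s = card {(a, y) \<in> A \<times> Y. int q dvd a * y - (- s)}"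
    unfolding cell_count_def by (rule bij_betw_same_card)
  have q0: "real q > 0" "q > 0" using assms by auto
  have "coprime (- s) (int q)" using assms(7) by auto
  then have main: "\<bar>real (cell_count N \<alpha> \<beta> \<sigma> q s) - real (totient q) * real n1 * real n2 / real q ^ 2\<bar>
      \<le> 6 * real q powr (3/4) * real (tau q) ^ 3 * (1 + ln (real q)) ^ 2"
    unfolding cc A(1) Y(1) using A(2) Y(2) q0 by (intro hyperbola_count) auto
  have M: "0 \<le> M" "M \<le> real q" using overlap_bounds[of \<sigma>] by (auto simp: M_def)
  have "\<bar>real n1 * real n2 - ((\<beta> - \<alpha>) * real q) * M\<bar> \<le> 2 * real q"
  proof -
    have "real n1 * real n2 - ((\<beta> - \<alpha>) * real q) * M = (real n1 - (\<beta> - \<alpha>) * real q) * real n2 + (\<beta> - \<alpha>) * real q * (real n2 - M)"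
      by (simp add: algebra_simps)
    moreover have "\<bar>(real n1 - (\<beta> - \<alpha>) * real q) * real n2\<bar> \<le> 1 * real q"
      unfolding abs_mult using A(3) Y(2) by (intro mult_mono) auto
    moreover have "\<bar>(\<beta> - \<alpha>) * real q * (real n2 - M)\<bar> \<le> (1 * real q) * 1"
      unfolding abs_mult using Y(3) assms by (intro mult_mono) auto
    ultimately show ?thesis by linarith
  qed
  then have "real (totient q) / real q ^ 2 * \<bar>real n1 * real n2 - ((\<beta> - \<alpha>) * real q) * M\<bar> \<le> real q / real q ^ 2 * (2 * real q)"
    by (intro mult_mono divide_right_mono) (auto simp: totient_le)
  also have "\<dots> = 2" using q0 by (simp add: power2_eq_square)
  finally have "\<bar>real (totient q) / real q ^ 2 * (real n1 * real n2 - ((\<beta> - \<alpha>) * real q) * M)\<bar> \<le> 2"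
    by (simp add: abs_mult)
  also have "real (totient q) / real q ^ 2 * (real n1 * real n2 - ((\<beta> - \<alpha>) * real q) * M)
      = real (totient q) * real n1 * real n2 / real q ^ 2 - (\<beta> - \<alpha>) * real (totient q) / real q * M"
    using q0 by (simp add: field_simps power2_eq_square)
  finally show ?thesis using main unfolding M_def by linarith
qed

lemma kloosterman_error_bound:
  assumes "\<delta> > 0"
  obtains C where "C \<ge> 0" "\<And>q. q \<ge> 1 \<Longrightarrow> 2 + 6 * real q powr (3/4) * real (tau q) ^ 3 * (1 + ln (real q)) ^ 2 \<le> C * real q powr (3/4 + \<delta>)"
proof -
  \<comment> \<open>Three factors \<open>tau\<close> and two logarithms share \<delta> as 3 *
    \<delta>/6 + 2 * \<delta>/4.\<close>
  obtain C1 where C1: "C1 \<ge> 1" "\<And>n. n > 0 \<Longrightarrow> real (tau n) \<le> C1 * real n powr (\<delta>/6)"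
    using tau_bound[of "\<delta>/6"] assms by auto
  define C2 where "C2 = 1 + 4 / \<delta>"
  have C2: "C2 \<ge> 0" using assms by (simp add: C2_def)
  show thesis
  proof (rule that[of "2 + 6 * C1 ^ 3 * C2 ^ 2"])
    show "0 \<le> 2 + 6 * C1 ^ 3 * C2 ^ 2" using C1 C2 by simp
    fix q :: nat assume q: "q \<ge> 1"
    have one: "1 \<le> real q powr e" if "e \<ge> 0" for e using q that by (intro ge_one_powr_ge_zero) auto
    have "ln (real q) = (4/\<delta>) * ln (real q powr (\<delta>/4))" using q assms by (simp add: ln_powr)
    also have "\<dots> \<le> (4/\<delta>) * (real q powr (\<delta>/4))"
      using assms q ln_le_minus_one[of "real q powr (\<delta>/4)"] by (intro mult_left_mono) auto
    finally have "1 + ln (real q) \<le> C2 * real q powr (\<delta>/4)"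
      using one[of "\<delta>/4"] assms by (simp add: C2_def ring_distribs)
    then have l: "(1 + ln (real q)) ^ 2 \<le> (C2 * real q powr (\<delta>/4)) ^ 2" using q by (intro power_mono) auto
    have t: "real (tau q) ^ 3 \<le> (C1 * real q powr (\<delta>/6)) ^ 3" using C1(2)[of q] q by (intro power_mono) auto
    have "6 * real q powr (3/4) * real (tau q) ^ 3 * (1 + ln (real q)) ^ 2
        \<le> 6 * real q powr (3/4) * (C1 * real q powr (\<delta>/6)) ^ 3 * (C2 * real q powr (\<delta>/4)) ^ 2"
      using l t C1 by (intro mult_mono) auto
    also have "\<dots> = 6 * C1 ^ 3 * C2 ^ 2 * (real q powr (3/4) * (real q powr (\<delta>/6)) ^ 3 * (real q powr (\<delta>/4)) ^ 2)"
      by (simp add: power_mult_distrib mult_ac)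
    also have "real q powr (3/4) * (real q powr (\<delta>/6)) ^ 3 * (real q powr (\<delta>/4)) ^ 2 = real q powr (3/4 + \<delta>)"
      using q by (simp add: powr_power powr_add[symmetric] add.commute)
    finally have "6 * real q powr (3/4) * real (tau q) ^ 3 * (1 + ln (real q)) ^ 2 \<le> 6 * C1 ^ 3 * C2 ^ 2 * real q powr (3/4 + \<delta>)" .
    moreover have "2 \<le> 2 * real q powr (3/4 + \<delta>)" using one[of "3/4 + \<delta>"] assms by simp
    ultimately show "2 + 6 * real q powr (3/4) * real (tau q) ^ 3 * (1 + ln (real q)) ^ 2 \<le> (2 + 6 * C1 ^ 3 * C2 ^ 2) * real q powr (3/4 + \<delta>)"
      by (simp add: ring_distribs)
  qed
qed

lemma sum_powr_quarter_le: "(\<Sum>q\<in>{1..N}. real q powr (-(1/4))) \<le> 4/3 * real N powr (3/4)"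
proof (induction N)
  case (Suc n)
  have "real (Suc n) powr (-(1/4)) \<le> 4/3 * (real (Suc n) powr (3/4) - real n powr (3/4))"
  proof (cases "n = 0")
    case False
    have "\<exists>z>real n. z < real (Suc n) \<and> real (Suc n) powr (3/4) - real n powr (3/4)
        = (real (Suc n) - real n) * (3/4 * z powr (3/4 - 1))"
      using False by (intro MVT2) (auto intro!: derivative_eq_intros)
    then obtain z where z: "z > real n" "z < real (Suc n)"
      "real (Suc n) powr (3/4) - real n powr (3/4) = 3/4 * z powr (-(1/4))" by auto
    have "real (Suc n) powr (-(1/4)) \<le> z powr (-(1/4))"
      using z by (intro powr_mono2') auto
    then show ?thesis using z(3) by simp
  qed simp
  then show ?case using Suc by simp
qed simp

text \<open>The first error term comes from Kloosterman sums and ignores the interval; the second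
  comes from the totient averages and carries the factor \<beta> - \<alpha>. They are kept apart
  because they behave differently when intervals are added up.\<close>

lemma cell_count_weighted_asymp:
  assumes "\<delta> > 0"
  obtains C where "C \<ge> 0" "\<And>N \<alpha> \<beta> \<sigma> s. \<lbrakk>N \<ge> 1; 0 \<le> \<alpha>; \<alpha> \<le> \<beta>; \<beta> \<le> 1; 0 \<le> \<sigma>; s = 1 \<or> s = -1\<rbrakk> \<Longrightarrow>
    \<bar>(\<Sum>q\<in>{1..N}. real (cell_count N \<alpha> \<beta> \<sigma> q s) / real q) / real N - (\<beta> - \<alpha>) * (limit_density \<sigma> / 2)\<bar>
      \<le> C * (real N powr (\<delta> - 1/4) + (\<beta> - \<alpha>) * real N powr (-(1/8)))"
proof -
  obtain C1 where C1: "C1 \<ge> 0"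
    "\<And>q. q \<ge> 1 \<Longrightarrow> 2 + 6 * real q powr (3/4) * real (tau q) ^ 3 * (1 + ln (real q)) ^ 2 \<le> C1 * real q powr (3/4 + \<delta>)"
    using kloosterman_error_bound[OF assms] by blast
  show thesis
  proof (rule that[of "4/3 * C1 + 81"])
    show "0 \<le> 4/3 * C1 + 81" using C1 by simp
    fix N :: nat and \<alpha> \<beta> \<sigma> :: real and s :: int
    assume N: "N \<ge> (1::nat)" and ab: "0 \<le> \<alpha>" "\<alpha> \<le> \<beta>" "\<beta> \<le> (1::real)" and \<sigma>: "0 \<le> \<sigma>" and s: "s = 1 \<or> s = -1"
    let ?w = "overlap \<sigma>"
    define P where "P = (\<Sum>q\<in>{1..N}. real (cell_count N \<alpha> \<beta> \<sigma> q s) / real q)"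
    define Q where "Q = (\<Sum>q\<in>{1..N}. real (totient q) / real q * min 1 (?w * real N / real q))"
    define R where "R = real N * (limit_density \<sigma> / 2)"
    have "\<bar>P - (\<beta> - \<alpha>) * Q\<bar> \<le> (\<Sum>q\<in>{1..N}. C1 * real N powr \<delta> * real q powr (-(1/4)))"
      unfolding P_def Q_def sum_distrib_left sum_subtractf[symmetric]
    proof (rule order_trans[OF sum_abs], rule sum_mono)
      fix q assume q: "q \<in> {1..N}"
      then have q0: "real q > 0" by simp
      have mn: "min 1 (?w * real N / real q) = min (real q) (?w * real N) / real q"
        using q0 by (simp add: min_def divide_le_eq le_divide_eq)
      have "real (cell_count N \<alpha> \<beta> \<sigma> q s) / real q - (\<beta> - \<alpha>) * (real (totient q) / real q * min 1 (?w * real N / real q))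
          = (real (cell_count N \<alpha> \<beta> \<sigma> q s) - (\<beta> - \<alpha>) * real (totient q) / real q * min (real q) (?w * real N)) / real q"
        unfolding mn by (simp add: diff_divide_distrib)
      then have "\<bar>real (cell_count N \<alpha> \<beta> \<sigma> q s) / real q - (\<beta> - \<alpha>) * (real (totient q) / real q * min 1 (?w * real N / real q))\<bar>
          = \<bar>real (cell_count N \<alpha> \<beta> \<sigma> q s) - (\<beta> - \<alpha>) * real (totient q) / real q * min (real q) (?w * real N)\<bar> / real q"
        using q0 by (simp add: abs_divide)
      also have "\<dots> \<le> C1 * real q powr (3/4 + \<delta>) / real q"
        using cell_count_asymp[of \<alpha> \<beta> q N \<sigma> s] C1(2)[of q] q ab \<sigma> s by (intro divide_right_mono) auto
      also have "\<dots> = C1 * (real q powr \<delta> * real q powr (-(1/4)))"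
      proof -
        have "real q powr (3/4 + \<delta>) / real q = real q powr (3/4 + \<delta> - 1)"
          by (simp only: powr_diff powr_one of_nat_0_le_iff)
        also have "3/4 + \<delta> - 1 = \<delta> + (-(1/4))" by simp
        also have "real q powr (\<delta> + (-(1/4))) = real q powr \<delta> * real q powr (-(1/4))" by (rule powr_add)
        finally show ?thesis by (simp only: times_divide_eq_right[symmetric])
      qed
      also have "\<dots> \<le> C1 * (real N powr \<delta> * real q powr (-(1/4)))"
        using q assms C1 by (intro mult_left_mono mult_right_mono powr_mono2) auto
      finally show "\<bar>real (cell_count N \<alpha> \<beta> \<sigma> q s) / real q - (\<beta> - \<alpha>) * (real (totient q) / real q * min 1 (?w * real N / real q))\<bar>
          \<le> C1 * real N powr \<delta> * real q powr (-(1/4))" by (simp add: mult.assoc)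
    qed
    also have "\<dots> = C1 * real N powr \<delta> * (\<Sum>q\<in>{1..N}. real q powr (-(1/4)))" by (simp add: sum_distrib_left)
    also have "\<dots> \<le> C1 * real N powr \<delta> * (4/3 * real N powr (3/4))"
      using sum_powr_quarter_le C1 by (intro mult_left_mono) auto
    finally have 1: "\<bar>P - (\<beta> - \<alpha>) * Q\<bar> \<le> C1 * real N powr \<delta> * (4/3 * real N powr (3/4))" .
    have R: "R = 6 / pi\<^sup>2 * (real N * (?w - ?w * ln ?w))"
    proof -
      have "limit_density \<sigma> / 2 = 6 / pi\<^sup>2 * (?w - ?w * ln ?w)"
        unfolding limit_density_eq by (rule nonzero_mult_div_cancel_left) simp
      then show ?thesis by (simp only: R_def mult.left_commute)
    qed
    have "\<bar>Q - R\<bar> \<le> 81 * real N powr (7/8)"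
      unfolding Q_def R by (rule totient_weighted_sum_asymp[OF overlap_bounds N])
    then have "(\<beta> - \<alpha>) * \<bar>Q - R\<bar> \<le> (\<beta> - \<alpha>) * (81 * real N powr (7/8))" using ab by (intro mult_left_mono) auto
    then have 2: "\<bar>(\<beta> - \<alpha>) * Q - (\<beta> - \<alpha>) * R\<bar> \<le> (\<beta> - \<alpha>) * (81 * real N powr (7/8))"
      using ab by (simp add: right_diff_distrib[symmetric] abs_mult)
    have N0: "real N > 0" using N by simp
    have "P / real N - (\<beta> - \<alpha>) * (limit_density \<sigma> / 2) = (P - (\<beta> - \<alpha>) * R) / real N"
      using N0 by (simp add: R_def diff_divide_distrib)
    then have "\<bar>P / real N - (\<beta> - \<alpha>) * (limit_density \<sigma> / 2)\<bar> = \<bar>P - (\<beta> - \<alpha>) * R\<bar> / real N"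
      using N0 by (simp add: abs_divide)
    also have "\<dots> \<le> (C1 * real N powr \<delta> * (4/3 * real N powr (3/4)) + (\<beta> - \<alpha>) * (81 * real N powr (7/8))) / real N"
    proof (rule divide_right_mono)
      show "\<bar>P - (\<beta> - \<alpha>) * R\<bar> \<le> C1 * real N powr \<delta> * (4/3 * real N powr (3/4)) + (\<beta> - \<alpha>) * (81 * real N powr (7/8))"
        using 1 2 by linarith
    qed simp
    also have "\<dots> = 4/3 * C1 * real N powr (\<delta> - 1/4) + 81 * ((\<beta> - \<alpha>) * real N powr (-(1/8)))"
    proof -
      have "real N powr \<delta> * real N powr (3/4) / real N = real N powr (\<delta> + 3/4 - 1)"
        by (simp only: powr_add powr_diff powr_one of_nat_0_le_iff)
      also have "\<delta> + 3/4 - 1 = \<delta> - 1/4" by simp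
      finally have f1: "real N powr \<delta> * real N powr (3/4) / real N = real N powr (\<delta> - 1/4)" .
      have "real N powr (7/8) / real N = real N powr (7/8 - 1)"
        by (simp only: powr_diff powr_one of_nat_0_le_iff)
      also have "7/8 - 1 = -(1/8::real)" by simp
      finally have f2: "real N powr (7/8) / real N = real N powr (-(1/8))" .
      show ?thesis unfolding f1[symmetric] f2[symmetric] using N0 by (simp add: field_simps)
    qed
    also have "\<dots> \<le> (4/3 * C1 + 81) * real N powr (\<delta> - 1/4) + (4/3 * C1 + 81) * ((\<beta> - \<alpha>) * real N powr (-(1/8)))"
      using C1 ab by (intro add_mono mult_right_mono) auto
    finally show "\<bar>(\<Sum>q\<in>{1..N}. real (cell_count N \<alpha> \<beta> \<sigma> q s) / real q) / real N - (\<beta> - \<alpha>) * (limit_density \<sigma> / 2)\<bar>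
      \<le> (4/3 * C1 + 81) * (real N powr (\<delta> - 1/4) + (\<beta> - \<alpha>) * real N powr (-(1/8)))"
      unfolding P_def by (simp add: ring_distribs)
  qed
qed

text \<open>Each cell length is a minimum, hence the integral over \<open>{0..t}\<close> of an indicator.\<close>

lemma has_integral_min:
  fixes z t M :: real
  assumes "z > 0" "t \<ge> 0" "M \<ge> 0"
  shows "((\<lambda>\<sigma>. if \<sigma> * z < M then 1 else 0) has_integral min t (M / z)) {0..t}"
proof -
  have "((\<lambda>\<sigma>. 1::real) has_integral min t (M / z)) {0..min t (M / z)}"
    using has_integral_const_real[of "1::real" 0 "min t (M / z)"] assms by simp
  then have "((\<lambda>\<sigma>. if \<sigma> \<in> {0..min t (M / z)} then 1 else 0::real) has_integral min t (M / z)) {0..t}"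
    using assms by (subst has_integral_restrict) auto
  then show ?thesis
  \<comment> \<open>The strict and the closed condition differ only at \<sigma> = M / z.\<close>
  proof (rule has_integral_spike[of "{M / z}", rotated 2])
    fix \<sigma> assume "\<sigma> \<in> {0..t} - {M / z}"
    then show "(if \<sigma> * z < M then 1 else 0) = (if \<sigma> \<in> {0..min t (M / z)} then 1 else 0::real)"
      using assms by (auto simp: less_divide_eq le_divide_eq)
  qed auto
qed

text \<open>With \<eta> = t / N a cell has length min t (N / (q + q')) / (N * q), so
  \<open>has_integral_min\<close> brings in the level condition \<sigma> * (q + q') < N. Exchanging
  finite sum and integral leaves one counting problem for each q, s and \<sigma>.\<close>

lemma has_integral_cell_length:
  assumes "N \<ge> 1" "t \<ge> 0"
  shows "((\<lambda>\<sigma>. \<Sum>s\<in>{1,-1}. (\<Sum>q\<in>{1..N}. real (cell_count N \<alpha> \<beta> \<sigma> q s) / real q) / real N)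
    has_integral (\<Sum>i\<in>farey_index N \<alpha> \<beta>. cell_length N (t / real N) i)) {0..t}"
proof -
  let ?I = "farey_index N \<alpha> \<beta>"
  define g where "g i \<sigma> = (case i of (q, a, s) \<Rightarrow> (if \<sigma> * (real q + of_int (farey_next N q a s)) < real N then 1 else 0) * (1 / (real N * real q)))"
    for i :: "nat \<times> int \<times> int" and \<sigma>
  have N0: "real N > 0" using assms by simp
  have "((\<lambda>\<sigma>. \<Sum>i\<in>?I. g i \<sigma>) has_integral (\<Sum>i\<in>?I. cell_length N (t / real N) i)) {0..t}"
  proof (rule has_integral_sum)
    fix i assume i: "i \<in> ?I"
    obtain q a s where qas: "i = (q, a, s)" by (cases i)
    note d = farey_indexD[OF i[unfolded qas]]
    define z where "z = real q + of_int (farey_next N q a s)"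
    have "int N < int q + farey_next N q a s" using farey_next(1)[OF d(1,3), of N s] by linarith
    then have z: "z > 0" unfolding z_def using N0 by linarith
    have "((\<lambda>\<sigma>. (if \<sigma> * z < real N then 1 else 0) * (1 / (real N * real q))) has_integral (min t (real N / z) * (1 / (real N * real q)))) {0..t}"
      using z assms by (intro has_integral_mult_left has_integral_min) auto
    moreover have "min t (real N / z) * (1 / (real N * real q)) = cell_length N (t / real N) i"
    proof -
      have "min (t / real N) (1 / z) = min t (real N / z) / real N"
        using N0 z by (simp add: min_def field_simps)
      then show ?thesis by (simp add: cell_length_def qas z_def[symmetric])
    qed
    ultimately show "(g i has_integral cell_length N (t / real N) i) {0..t}"
      by (simp add: g_def[abs_def] qas z_def)
  qed simp
  moreover have "(\<Sum>i\<in>?I. g i \<sigma>) = (\<Sum>s\<in>{1,-1}. (\<Sum>q\<in>{1..N}. real (cell_count N \<alpha> \<beta> \<sigma> q s) / real q) / real N)" for \<sigma>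
  proof -
    let ?A = "\<lambda>q. {a::int. \<alpha> * real q \<le> of_int a \<and> of_int a < \<beta> * real q \<and> coprime a (int q)}"
    have finA: "finite (?A q)" for q by (rule finite_numerators)
    have "(\<Sum>i\<in>?I. g i \<sigma>) = (\<Sum>q\<in>{1..N}. \<Sum>p\<in>?A q \<times> {1,-1}. g (q, p) \<sigma>)"
      unfolding farey_index_def using finA by (subst sum.Sigma) (auto simp: case_prod_beta)
    also have "\<dots> = (\<Sum>q\<in>{1..N}. \<Sum>s\<in>{1,-1}. \<Sum>a\<in>?A q. g (q, a, s) \<sigma>)"
      by (intro sum.cong refl, subst sum.swap, simp only: sum.cartesian_product, rule sum.cong[OF refl]) auto
    also have "\<dots> = (\<Sum>q\<in>{1..N}. \<Sum>s\<in>{1,-1}. real (cell_count N \<alpha> \<beta> \<sigma> q s) / real q / real N)"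
    proof (intro sum.cong refl)
      fix q s
      have "(\<Sum>a\<in>?A q. g (q, a, s) \<sigma>) = (\<Sum>a\<in>?A q. if \<sigma> * (real q + of_int (farey_next N q a s)) < real N then 1 else 0) * (1 / (real N * real q))"
        by (simp only: g_def prod.case sum_distrib_right)
      also have "(\<Sum>a\<in>?A q. if \<sigma> * (real q + of_int (farey_next N q a s)) < real N then 1 else 0::real)
          = (\<Sum>a\<in>{a\<in>?A q. \<sigma> * (real q + of_int (farey_next N q a s)) < real N}. 1)"
        by (rule sum.inter_filter[symmetric]) (rule finA)
      also have "\<dots> = real (cell_count N \<alpha> \<beta> \<sigma> q s)"
        by (simp add: cell_count_def conj_assoc)
      finally show "(\<Sum>a\<in>?A q. g (q, a, s) \<sigma>) = real (cell_count N \<alpha> \<beta> \<sigma> q s) / real q / real N" by (simp add: mult.commute)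
    qed
    also have "\<dots> = (\<Sum>s\<in>{1,-1}. \<Sum>q\<in>{1..N}. real (cell_count N \<alpha> \<beta> \<sigma> q s) / real q / real N)" by (rule sum.swap)
    finally show ?thesis by (simp only: sum_divide_distrib)
  qed
  ultimately show ?thesis by simp
qed

text \<open>The count is uniform in the level \<sigma>, so integrating over {0..t} only multiplies
  its error by t; the term 2 / N accounts for cells at the ends of the interval.\<close>

theorem near_set_measure_asymp:
  assumes "\<delta> > 0"
  obtains C where "C \<ge> 0" "\<And>N \<alpha> \<beta> t. \<lbrakk>N \<ge> 1; 0 \<le> \<alpha>; \<alpha> \<le> \<beta>; \<beta> \<le> 1; 0 \<le> t\<rbrakk> \<Longrightarrow>
    \<bar>measure lborel ({\<alpha>..<\<beta>} \<inter> near_set N (t / real N)) - (\<beta> - \<alpha>) * integral {0..t} limit_density\<bar>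
      \<le> C * t * (real N powr (\<delta> - 1/4) + (\<beta> - \<alpha>) * real N powr (-(1/8))) + 2 / real N"
proof -
  obtain C where C: "C \<ge> 0" "\<And>N \<alpha> \<beta> \<sigma> s. \<lbrakk>N \<ge> 1; 0 \<le> \<alpha>; \<alpha> \<le> \<beta>; \<beta> \<le> 1; 0 \<le> \<sigma>; s = 1 \<or> s = -1\<rbrakk> \<Longrightarrow>
    \<bar>(\<Sum>q\<in>{1..N}. real (cell_count N \<alpha> \<beta> \<sigma> q s) / real q) / real N - (\<beta> - \<alpha>) * (limit_density \<sigma> / 2)\<bar>
      \<le> C * (real N powr (\<delta> - 1/4) + (\<beta> - \<alpha>) * real N powr (-(1/8)))"
    using cell_count_weighted_asymp[OF assms] by blast
  show thesis
  proof (rule that[of "2 * C"])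
    show "0 \<le> 2 * C" using C by simp
    fix N :: nat and \<alpha> \<beta> t :: real
    assume N: "N \<ge> (1::nat)" and ab: "0 \<le> \<alpha>" "\<alpha> \<le> \<beta>" "\<beta> \<le> (1::real)" and t: "0 \<le> (t::real)"
    define S where "S \<sigma> s = (\<Sum>q\<in>{1..N}. real (cell_count N \<alpha> \<beta> \<sigma> q s) / real q) / real N" for \<sigma> s
    define L where "L = (\<Sum>i\<in>farey_index N \<alpha> \<beta>. cell_length N (t / real N) i)"
    define E where "E = real N powr (\<delta> - 1/4) + (\<beta> - \<alpha>) * real N powr (-(1/8))"
    have "((\<lambda>\<sigma>. (\<Sum>s\<in>{1,-1}. S \<sigma> s) - (\<beta> - \<alpha>) * limit_density \<sigma>) has_integral (L - (\<beta> - \<alpha>) * integral {0..t} limit_density)) {0..t}"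
      unfolding S_def L_def
      by (intro has_integral_diff has_integral_cell_length[OF N t] has_integral_mult_right integrable_integral) simp
    moreover have "norm ((\<Sum>s\<in>{1,-1}. S \<sigma> s) - (\<beta> - \<alpha>) * limit_density \<sigma>) \<le> 2 * C * E" if "\<sigma> \<in> {0..t}" for \<sigma>
    proof -
      have "\<bar>S \<sigma> 1 - (\<beta> - \<alpha>) * (limit_density \<sigma> / 2)\<bar> \<le> C * E" "\<bar>S \<sigma> (-1) - (\<beta> - \<alpha>) * (limit_density \<sigma> / 2)\<bar> \<le> C * E"
        unfolding S_def E_def using C(2)[OF N ab] that by auto
      moreover have "(\<beta> - \<alpha>) * limit_density \<sigma> = 2 * ((\<beta> - \<alpha>) * (limit_density \<sigma> / 2))" by simp
      moreover have "(\<Sum>s\<in>{1,-1}. S \<sigma> s) = S \<sigma> 1 + S \<sigma> (-1)" by simp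
      ultimately show ?thesis unfolding real_norm_def by linarith
    qed
    moreover have "0 \<le> 2 * C * E" using C ab by (simp add: E_def)
    ultimately have "norm (L - (\<beta> - \<alpha>) * integral {0..t} limit_density) \<le> 2 * C * E * measure lborel {0..t}"
      by (intro has_integral_bound_real) auto
    then have 1: "\<bar>L - (\<beta> - \<alpha>) * integral {0..t} limit_density\<bar> \<le> 2 * C * t * E" using t by (simp add: mult_ac)
    have "\<bar>measure lborel ({\<alpha>..<\<beta>} \<inter> near_set N (t / real N)) - L\<bar> \<le> 2 / real N"
      using near_set_measure_le[OF N _ ab(2), of "t / real N"] near_set_measure_ge[OF N _ ab(2), of "t / real N"] t
      unfolding L_def by (simp add: abs_le_iff)
    with 1 show "\<bar>measure lborel ({\<alpha>..<\<beta>} \<inter> near_set N (t / real N)) - (\<beta> - \<alpha>) * integral {0..t} limit_density\<bar>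
      \<le> 2 * C * t * (real N powr (\<delta> - 1/4) + (\<beta> - \<alpha>) * real N powr (-(1/8))) + 2 / real N"
      unfolding E_def by linarith
  qed
qed

section \<open>Exit times\<close>

text \<open>Evaluate at the foot of the perpendicular from the lattice point (q, a) to the ray:
  \<tau> is its time and \<bar>w\<bar> the distance. The abscissa of the foot is q - w * s, hence at
  most q + \<epsilon>.\<close>

lemma exit_time_arctan_le:
  fixes x T \<epsilon> :: real and q :: nat and a :: int
  assumes "0 < \<epsilon>" "\<epsilon> < 1/2" "0 \<le> x" "1 \<le> q"
    and near: "\<bar>real q * x - of_int a\<bar> \<le> \<epsilon> * sqrt (1 + x\<^sup>2)" and le: "(real q + \<epsilon>) * sqrt (1 + x\<^sup>2) \<le> T"
  shows "exit_time \<epsilon> (arctan x) \<le> T"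
proof -
  define r where "r = sqrt (1 + x\<^sup>2)"
  define c where "c = cos (arctan x)"
  define s where "s = sin (arctan x)"
  define w where "w = real q * s - of_int a * c"
  define \<tau> where "\<tau> = real q * c + of_int a * s"
  have r: "r \<ge> 1" by (simp add: r_def)
  have c: "c = 1 / r" by (simp add: c_def r_def cos_arctan)
  have s: "s = x / r" by (simp add: s_def r_def sin_arctan)
  have cs: "c\<^sup>2 + s\<^sup>2 = 1" by (simp add: c_def s_def)
  have s01: "0 \<le> s" "s \<le> 1"
  proof -
    show "0 \<le> s" using assms(3) r by (simp add: s)
    show "s \<le> 1" by (simp add: s_def)
  qed
  have w: "w = (real q * x - of_int a) / r" by (simp add: w_def s c diff_divide_distrib)
  have "\<bar>real q * x - of_int a\<bar> \<le> \<epsilon> * r" using near by (simp add: r_def)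
  then have wle: "\<bar>w\<bar> \<le> \<epsilon>" using r by (simp add: w abs_divide divide_le_eq)
  have ws: "\<bar>w * s\<bar> \<le> \<epsilon> * 1" unfolding abs_mult using wle s01 assms(1) by (intro mult_mono) auto
  have \<tau>c: "\<tau> * c = real q - w * s"
  proof -
    have "\<tau> * c = real q * (c\<^sup>2 + s\<^sup>2) - w * s" by (simp add: \<tau>_def w_def algebra_simps power2_eq_square)
    then show ?thesis using cs by simp
  qed
  have \<tau>s: "\<tau> * s - of_int a = c * w"
  proof -
    have "\<tau> * s - of_int a * (c\<^sup>2 + s\<^sup>2) = c * w" by (simp add: \<tau>_def w_def algebra_simps power2_eq_square)
    then show ?thesis using cs by simp
  qed
  have \<tau>r: "\<tau> = (real q - w * s) * r" using \<tau>c r c by (simp add: field_simps)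
  have "\<tau> > 0" unfolding \<tau>r using ws assms(2,4) r by (intro mult_pos_pos) (simp_all add: abs_le_iff)
  moreover have "\<tau> \<le> T"
  proof -
    have "(real q - w * s) * r \<le> (real q + \<epsilon>) * r" using ws r by (intro mult_right_mono) (simp_all add: abs_le_iff)
    then show ?thesis using le unfolding \<tau>r r_def by simp
  qed
  moreover have "infdist (\<tau> * cos (arctan x), \<tau> * sin (arctan x)) (\<int> \<times> \<int> - {(0, 0)}) \<le> \<epsilon>"
  proof -
    have "dist (\<tau> * c, \<tau> * s) (real q, of_int a) = sqrt ((\<tau> * c - real q)\<^sup>2 + (\<tau> * s - of_int a)\<^sup>2)"
      by (simp add: dist_prod_def dist_real_def)
    also have "(\<tau> * c - real q)\<^sup>2 + (\<tau> * s - of_int a)\<^sup>2 = w\<^sup>2 * (c\<^sup>2 + s\<^sup>2)"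
      unfolding \<tau>c \<tau>s by (simp add: algebra_simps power2_eq_square)
    also have "sqrt (w\<^sup>2 * (c\<^sup>2 + s\<^sup>2)) = \<bar>w\<bar>" using cs by simp
    finally have "dist (\<tau> * c, \<tau> * s) (real q, of_int a) \<le> \<epsilon>" using wle by simp
    moreover have "(real q, real_of_int a) \<in> \<int> \<times> \<int> - {(0, 0)}" using assms(4) by auto
    ultimately show ?thesis unfolding c_def s_def by (rule infdist_le2[rotated])
  qed
  ultimately show ?thesis
    unfolding exit_time_def by (intro cInf_lower2[of \<tau>] bdd_belowI[of _ 0]) auto
qed

text \<open>The proof does not establish that the infimum over times or the distance to the lattice
  is attained. Hence a time below T + \<epsilon> and a lattice point closer than e = \<epsilon> * (1
  + \<epsilon>) are taken; the slack in the distance is of relative size \<epsilon>.\<close>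

lemma lattice_point_of_exit_time:
  fixes x T \<epsilon> :: real
  assumes "0 < \<epsilon>" "\<epsilon> < 1/8" "0 \<le> x" "x \<le> 1" and le: "exit_time \<epsilon> (arctan x) \<le> T"
  obtains q :: nat and a :: int where "1 \<le> q" "real q \<le> T / sqrt (1 + x\<^sup>2) + 1"
    "\<bar>real q * x - of_int a\<bar> \<le> \<epsilon> * (1 + \<epsilon>) * sqrt (1 + x\<^sup>2)"
proof -
  define r where "r = sqrt (1 + x\<^sup>2)"
  define c where "c = cos (arctan x)"
  define s where "s = sin (arctan x)"
  define e where "e = \<epsilon> * (1 + \<epsilon>)"
  have r: "r \<ge> 1" by (simp add: r_def)
  have c: "c = 1 / r" by (simp add: c_def r_def cos_arctan)
  have s: "s = x / r" by (simp add: s_def r_def sin_arctan)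
  have cs: "c\<^sup>2 + s\<^sup>2 = 1" by (simp add: c_def s_def)
  have c01: "0 < c" "c \<le> 1" using r c by auto
  have sc: "0 \<le> s" "s \<le> c" unfolding s c using assms(3,4) r by (auto intro: divide_right_mono)
  have "\<epsilon> * (1 + \<epsilon>) \<le> \<epsilon> * (1 + 1)" using assms(1,2) by (intro mult_left_mono) auto
  then have e: "e < 1/4" "\<epsilon> < e" using assms(1,2) mult_pos_pos[of \<epsilon> \<epsilon>] unfolding e_def distrib_left by linarith+
  let ?L = "\<int> \<times> \<int> - {(0, 0)} :: (real \<times> real) set"
  let ?S = "{\<tau>. \<tau> > 0 \<and> infdist (\<tau> * c, \<tau> * s) ?L \<le> \<epsilon>}"
  have "?S \<noteq> {}" using exit_set_nonempty[OF assms(1), of "arctan x"] by (simp add: c_def s_def)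
  moreover have "Inf ?S < T + \<epsilon>" using le assms(1) by (simp add: exit_time_def c_def s_def)
  ultimately have "\<exists>\<tau>\<in>?S. \<tau> < T + \<epsilon>" by (rule cInf_lessD)
  then obtain \<tau> where \<tau>: "\<tau> > 0" "infdist (\<tau> * c, \<tau> * s) ?L \<le> \<epsilon>" "\<tau> < T + \<epsilon>"
    by blast
  have "\<exists>v\<in>?L. dist (\<tau> * c, \<tau> * s) v < e"
  proof (rule ccontr)
    assume "\<not> (\<exists>v\<in>?L. dist (\<tau> * c, \<tau> * s) v < e)"
    then have far: "\<And>v. v \<in> ?L \<Longrightarrow> e \<le> dist (\<tau> * c, \<tau> * s) v" by (meson not_less)
    have "(1, 0) \<in> ?L" by auto
    then have ne: "?L \<noteq> {}" by blast
    have "e \<le> infdist (\<tau> * c, \<tau> * s) ?L"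
      unfolding infdist_notempty[OF ne] by (rule cINF_greatest[OF ne far])
    then show False using \<tau>(2) e by simp
  qed
  then obtain v0 where v0: "v0 \<in> ?L" "dist (\<tau> * c, \<tau> * s) v0 < e" by blast
  from v0(1) have Z: "fst v0 \<in> \<int>" "snd v0 \<in> \<int>" "v0 \<noteq> (0, 0)" by auto
  obtain i :: int where i: "fst v0 = of_int i" using Z(1) by (rule Ints_cases)
  obtain a :: int where a: "snd v0 = of_int a" using Z(2) by (rule Ints_cases)
  have v0eq: "v0 = (of_int i, of_int a)" by (simp add: prod_eq_iff i a)
  have v: "(real_of_int i, real_of_int a) \<noteq> (0, 0)" "dist (\<tau> * c, \<tau> * s) (of_int i, of_int a) < e"
    using v0(2) Z(3) unfolding v0eq by auto
  define X where "X = \<tau> * c - of_int i"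
  define Y where "Y = \<tau> * s - of_int a"
  have d: "sqrt (X\<^sup>2 + Y\<^sup>2) < e" using v(2) by (simp add: dist_prod_def dist_real_def X_def Y_def)
  have X: "\<bar>X\<bar> < e" using d real_sqrt_ge_abs1[of X Y] by linarith
  have Y: "\<bar>Y\<bar> < e" using d real_sqrt_ge_abs2[of Y X] by linarith
  \<comment> \<open>The offset (X, Y) is rotated into components across and along the ray; the first
    is the signed distance of (i, a) from the line.\<close>
  have "(s * X - c * Y)\<^sup>2 + (c * X + s * Y)\<^sup>2 = (c\<^sup>2 + s\<^sup>2) * (X\<^sup>2 + Y\<^sup>2)" by (simp add: power2_eq_square algebra_simps)
  then have "(s * X - c * Y)\<^sup>2 + (c * X + s * Y)\<^sup>2 = X\<^sup>2 + Y\<^sup>2" using cs by simp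
  moreover have "0 \<le> (c * X + s * Y)\<^sup>2" by simp
  ultimately have "\<bar>s * X - c * Y\<bar>\<^sup>2 \<le> X\<^sup>2 + Y\<^sup>2" unfolding power2_abs by linarith
  then have "\<bar>s * X - c * Y\<bar> \<le> sqrt (X\<^sup>2 + Y\<^sup>2)" by (rule real_le_rsqrt)
  also have "s * X - c * Y = - (of_int i * s - of_int a * c)" by (simp add: X_def Y_def algebra_simps)
  finally have w: "\<bar>of_int i * s - of_int a * c\<bar> \<le> e" using d by simp
  have "of_int i > (-1 :: real)" using X e \<tau>(1) c01 mult_pos_pos[of \<tau> c] unfolding X_def by linarith
  then have i0: "i \<ge> 0" by linarith
  \<comment> \<open>If i = 0, the offset bound keeps \<tau> * c small, and slope at most 1 keeps
    \<tau> * s small too, so the only lattice point in reach is the excluded origin.\<close>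
  have "i \<noteq> 0"
  proof
    assume "i = 0"
    then have "\<tau> * c < e" using X by (simp add: X_def)
    moreover have "\<tau> * s \<le> \<tau> * c" "0 \<le> \<tau> * s" using sc \<tau>(1) by (auto intro: mult_left_mono)
    ultimately have "\<bar>real_of_int a\<bar> < 1" using Y e unfolding Y_def by linarith
    then have "a = 0" by linarith
    then show False using v(1) \<open>i = 0\<close> by simp
  qed
  then have i1: "1 \<le> nat i" "real (nat i) = of_int i" using i0 by auto
  have "\<tau> * c \<le> (T + \<epsilon>) * c" using \<tau>(3) c01 by (intro mult_right_mono) auto
  also have "\<dots> \<le> T * c + \<epsilon>" using c01 assms(1) by (simp add: distrib_right mult_left_le)
  finally have "of_int i \<le> T * c + 1" using X e unfolding X_def by linarith
  moreover have "\<bar>of_int i * x - of_int a\<bar> \<le> e * r"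
  proof -
    have "of_int i * s - of_int a * c = (of_int i * x - of_int a) / r" by (simp add: s c diff_divide_distrib)
    then show ?thesis using w r by (simp add: abs_divide divide_le_eq)
  qed
  ultimately show thesis using that[of "nat i" a] i1 by (simp add: c r_def e_def)
qed

text \<open>The limit H of the theorem is 1 - \<open>cumul\<close>.\<close>

definition cumul :: "real \<Rightarrow> real" where
  "cumul t = integral {0..t} limit_density"

lemma cumul_diff:
  assumes "0 \<le> s" "s \<le> t"
  shows "cumul t - cumul s = integral {s..t} limit_density"
  using Henstock_Kurzweil_Integration.integral_combine[OF assms, of limit_density] by (simp add: cumul_def)

lemma cumul_mono: "0 \<le> s \<Longrightarrow> s \<le> t \<Longrightarrow> cumul s \<le> cumul t"
  using cumul_diff[of s t] integral_nonneg[of limit_density "{s..t}"] by (simp add: limit_density_nonneg)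

lemma cumul_lipschitz:
  assumes "0 \<le> s" "s \<le> t"
  shows "cumul t \<le> cumul s + 2 * (t - s)"
proof -
  have "integral {s..t} limit_density \<le> integral {s..t} (\<lambda>_. 2)"
    by (rule integral_le) (auto simp: limit_density_le)
  then show ?thesis using cumul_diff[OF assms] assms by simp
qed

lemma cumul_nonneg: "0 \<le> t \<Longrightarrow> 0 \<le> cumul t"
  using cumul_mono[of 0 t] by (simp add: cumul_def)

section \<open>Slices of directions\<close>

lemma measure_Icc_eq_Ico:
  fixes a b :: real
  assumes [measurable]: "S \<in> sets borel"
  shows "measure lborel ({a..b} \<inter> S) = measure lborel ({a..<b} \<inter> S)"
proof -
  have "measure lborel ({a..b} \<inter> S - {b}) = measure lborel ({a..b} \<inter> S)"
    by (rule measure_Diff_null_set) (auto intro!: finite_imp_null_set_lborel)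
  moreover have "{a..b} \<inter> S - {b} = {a..<b} \<inter> S" by auto
  ultimately show ?thesis by simp
qed

lemma measure_Ico_split:
  fixes a b c :: real
  assumes "a \<le> b" "b \<le> c" and [measurable]: "S \<in> sets borel"
  shows "measure lborel ({a..<c} \<inter> S) = measure lborel ({a..<b} \<inter> S) + measure lborel ({b..<c} \<inter> S)"
proof -
  have "{a..<c} \<inter> S = ({a..<b} \<inter> S) \<union> ({b..<c} \<inter> S)" using assms by auto
  moreover have "measure lborel (({a..<b} \<inter> S) \<union> ({b..<c} \<inter> S)) = measure lborel ({a..<b} \<inter> S) + measure lborel ({b..<c} \<inter> S)"
    by (rule measure_Un_AE) (auto intro!: fmeasurable_bounded_Int always_eventually)
  ultimately show ?thesis by simp
qed

text \<open>Substituting \<omega> = arctan x brings in the density 1 / (1 + x^2), which decreases on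
  {\<alpha>..\<beta>} and so lies between its values at the endpoints.\<close>

lemma arctan_measure_bounds:
  fixes \<alpha> \<beta> :: real
  assumes ab: "0 \<le> \<alpha>" "\<alpha> \<le> \<beta>" and E[measurable]: "E \<in> sets borel"
  defines "B \<equiv> {x \<in> {\<alpha>..\<beta>}. arctan x \<in> E}"
  shows "measure lborel ({arctan \<alpha>..arctan \<beta>} \<inter> E) \<le> measure lborel B / (1 + \<alpha>\<^sup>2)"
    and "measure lborel B / (1 + \<beta>\<^sup>2) \<le> measure lborel ({arctan \<alpha>..arctan \<beta>} \<inter> E)"
proof -
  have pos: "0 < 1 + x\<^sup>2" for x :: real by (simp add: add_pos_nonneg)
  have [measurable]: "arctan \<in> borel_measurable borel"
    by (intro borel_measurable_continuous_onI continuous_intros)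
  have B[measurable]: "B \<in> sets borel" unfolding B_def by measurable
  have sub: "(\<integral>\<^sup>+x. indicator E x * indicator {arctan \<alpha>..arctan \<beta>} x \<partial>lborel) =
      (\<integral>\<^sup>+x. ennreal (indicator E (arctan x) * (1 / (1 + x\<^sup>2)) * indicator {\<alpha>..\<beta>} x) \<partial>lborel)"
  proof -
    have "(\<integral>\<^sup>+x. ennreal (indicator E x * indicator {arctan \<alpha>..arctan \<beta>} x) \<partial>lborel) =
      (\<integral>\<^sup>+x. ennreal (indicator E (arctan x) * (1 / (1 + x\<^sup>2)) * indicator {\<alpha>..\<beta>} x) \<partial>lborel)"
    proof (rule nn_integral_substitution)
      show "set_borel_measurable borel {arctan \<alpha>..arctan \<beta>} (indicator E :: real \<Rightarrow> real)"
        unfolding set_borel_measurable_def by measurable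
      show "(arctan has_real_derivative 1 / (1 + x\<^sup>2)) (at x)" for x
        using DERIV_arctan[of x] by (simp add: inverse_eq_divide)
      show "continuous_on {\<alpha>..\<beta>} (\<lambda>x. 1 / (1 + x\<^sup>2))"
        using pos by (intro continuous_intros) (metis less_numeral_extra(3))
      show "0 \<le> 1 / (1 + x\<^sup>2)" for x :: real using pos[of x] by simp
    qed (rule ab)
    then show ?thesis by (simp add: ennreal_mult' ennreal_indicator)
  qed
  have lhs: "(\<integral>\<^sup>+x. indicator E x * indicator {arctan \<alpha>..arctan \<beta>} x \<partial>lborel) = emeasure lborel ({arctan \<alpha>..arctan \<beta>} \<inter> E)"
  proof -
    have "(\<integral>\<^sup>+x. indicator E x * indicator {arctan \<alpha>..arctan \<beta>} x \<partial>lborel) = (\<integral>\<^sup>+x. indicator ({arctan \<alpha>..arctan \<beta>} \<inter> E) x \<partial>lborel)"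
      by (intro nn_integral_cong) (auto simp: indicator_def)
    then show ?thesis by simp
  qed
  have const: "(\<integral>\<^sup>+x. ennreal c * indicator B x \<partial>lborel) = ennreal (c * measure lborel B)" if "c \<ge> 0" for c
  proof -
    have "bounded B" unfolding B_def by (rule bounded_subset[of "{\<alpha>..\<beta>}"]) auto
    then have "emeasure lborel B < \<infinity>" by (rule emeasure_bounded_finite)
    then have "emeasure lborel B = ennreal (measure lborel B)" by (intro emeasure_eq_ennreal_measure) auto
    then show ?thesis using that by (simp add: nn_integral_cmult ennreal_mult)
  qed
  have fin: "emeasure lborel ({arctan \<alpha>..arctan \<beta>} \<inter> E) = ennreal (measure lborel ({arctan \<alpha>..arctan \<beta>} \<inter> E))"
  proof -
    have "{arctan \<alpha>..arctan \<beta>} \<inter> E \<in> fmeasurable lborel" by (intro fmeasurable_bounded_Int) auto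
    then show ?thesis by (rule emeasure_eq_measure2)
  qed
  have "ennreal (measure lborel ({arctan \<alpha>..arctan \<beta>} \<inter> E)) \<le> (\<integral>\<^sup>+x. ennreal (1 / (1 + \<alpha>\<^sup>2)) * indicator B x \<partial>lborel)"
    unfolding fin[symmetric] lhs[symmetric] sub
  proof (rule nn_integral_mono)
    fix x :: real
    have "1 / (1 + x\<^sup>2) \<le> 1 / (1 + \<alpha>\<^sup>2)" if "\<alpha> \<le> x"
      using that ab pos by (intro divide_left_mono mult_pos_pos) (auto intro: power_mono)
    then show "ennreal (indicator E (arctan x) * (1 / (1 + x\<^sup>2)) * indicator {\<alpha>..\<beta>} x) \<le> ennreal (1 / (1 + \<alpha>\<^sup>2)) * indicator B x"
      by (auto simp: indicator_def B_def intro!: ennreal_leI)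
  qed
  then show "measure lborel ({arctan \<alpha>..arctan \<beta>} \<inter> E) \<le> measure lborel B / (1 + \<alpha>\<^sup>2)"
    using const[of "1 / (1 + \<alpha>\<^sup>2)"] pos[of \<alpha>] by (simp add: ennreal_le_iff)
  have "(\<integral>\<^sup>+x. ennreal (1 / (1 + \<beta>\<^sup>2)) * indicator B x \<partial>lborel) \<le> ennreal (measure lborel ({arctan \<alpha>..arctan \<beta>} \<inter> E))"
    unfolding fin[symmetric] lhs[symmetric] sub
  proof (rule nn_integral_mono)
    fix x :: real
    have "1 / (1 + \<beta>\<^sup>2) \<le> 1 / (1 + x\<^sup>2)" if "0 \<le> x" "x \<le> \<beta>"
      using that ab pos by (intro divide_left_mono mult_pos_pos) (auto intro: power_mono)
    then show "ennreal (1 / (1 + \<beta>\<^sup>2)) * indicator B x \<le> ennreal (indicator E (arctan x) * (1 / (1 + x\<^sup>2)) * indicator {\<alpha>..\<beta>} x)"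
      using ab by (auto simp: indicator_def B_def intro!: ennreal_leI)
  qed
  then show "measure lborel B / (1 + \<beta>\<^sup>2) \<le> measure lborel ({arctan \<alpha>..arctan \<beta>} \<inter> E)"
    using const[of "1 / (1 + \<beta>\<^sup>2)"] pos[of \<beta>] by (simp add: ennreal_le_iff)
qed

text \<open>The factor 1 / cos \<omega> = sqrt (1 + x^2) is 1-Lipschitz in x and at least 1, which
  controls its relative change over a slice.\<close>

lemma sqrt_one_plus_bounds:
  fixes \<alpha> \<beta> :: real
  assumes "0 \<le> \<alpha>" "\<alpha> \<le> \<beta>"
  shows "sqrt (1 + \<alpha>\<^sup>2) \<le> sqrt (1 + \<beta>\<^sup>2)" "sqrt (1 + \<beta>\<^sup>2) \<le> sqrt (1 + \<alpha>\<^sup>2) * (1 + (\<beta> - \<alpha>))"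
proof -
  show "sqrt (1 + \<alpha>\<^sup>2) \<le> sqrt (1 + \<beta>\<^sup>2)" using assms by (auto intro: power_mono)
  have 1: "\<alpha> \<le> sqrt (1 + \<alpha>\<^sup>2)" by (rule real_le_rsqrt) simp
  have "1 + \<beta>\<^sup>2 = (1 + \<alpha>\<^sup>2) + 2 * \<alpha> * (\<beta> - \<alpha>) + (\<beta> - \<alpha>)\<^sup>2" by (simp add: power2_eq_square algebra_simps)
  also have "\<dots> \<le> (sqrt (1 + \<alpha>\<^sup>2))\<^sup>2 + 2 * sqrt (1 + \<alpha>\<^sup>2) * (\<beta> - \<alpha>) + (\<beta> - \<alpha>)\<^sup>2"
    using 1 assms by (intro add_mono mult_right_mono) auto
  also have "\<dots> = (sqrt (1 + \<alpha>\<^sup>2) + (\<beta> - \<alpha>))\<^sup>2" by (simp add: power2_sum)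
  finally have "sqrt (1 + \<beta>\<^sup>2) \<le> sqrt (1 + \<alpha>\<^sup>2) + (\<beta> - \<alpha>)"
    using assms by (intro real_le_lsqrt) auto
  also have "\<dots> \<le> sqrt (1 + \<alpha>\<^sup>2) + sqrt (1 + \<alpha>\<^sup>2) * (\<beta> - \<alpha>)"
    using assms by (intro add_left_mono) (simp add: mult_le_cancel_right1)
  finally show "sqrt (1 + \<beta>\<^sup>2) \<le> sqrt (1 + \<alpha>\<^sup>2) * (1 + (\<beta> - \<alpha>))" by (simp add: algebra_simps)
qed

definition exit_within :: "real \<Rightarrow> real \<Rightarrow> real set" where
  "exit_within \<epsilon> t = {\<omega>. exit_time \<epsilon> \<omega> \<le> t / \<epsilon>}"

lemma exit_within_borel:
  assumes "\<epsilon> > 0"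
  shows "exit_within \<epsilon> t \<in> sets borel"
  using exit_time_measurable[OF assms] unfolding exit_within_def by measurable

text \<open>Converts powers of N into powers of \<epsilon>. The hypothesis t / \<epsilon> \<le> 4 *
  N leaves room for cos \<omega> and for rounding N.\<close>

lemma error_term_bound:
  assumes "0 < \<delta>" "\<delta> < 1/4" "0 < \<epsilon>" "\<epsilon> \<le> 1" "0 < t" "t / \<epsilon> \<le> 4 * real N" "0 \<le> l" "0 \<le> s" "s \<le> M" "0 \<le> C"
  shows "C * s * (real N powr (\<delta> - 1/4) + l * real N powr (-(1/8))) + 2 / real N
    \<le> (C * M * ((t/4) powr (\<delta> - 1/4) + (t/4) powr (-(1/8))) + 8 / t) * (\<epsilon> powr (1/4 - \<delta>) + l * \<epsilon> powr (1/8))"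
proof -
  have N: "t / 4 / \<epsilon> \<le> real N" "t / 4 / \<epsilon> > 0" using assms by auto
  define A where "A = (t/4) powr (\<delta> - 1/4)"
  define B where "B = (t/4) powr (-(1/8))"
  define R where "R = \<epsilon> powr (1/4 - \<delta>) + l * \<epsilon> powr (1/8)"
  have AB: "A \<ge> 0" "B \<ge> 0" by (simp_all add: A_def B_def)
  have div: "(t / 4 / \<epsilon>) powr (- e) = (t/4) powr (- e) * \<epsilon> powr e" for e
  proof -
    have "(t / 4 / \<epsilon>) powr (- e) = (t/4) powr (- e) / \<epsilon> powr (- e)" by (rule powr_divide)
    also have "\<epsilon> powr (- e) = 1 / \<epsilon> powr e" by (rule powr_minus_divide)
    finally show ?thesis by (simp only: divide_divide_eq_right div_by_1)
  qed
  have "real N powr (\<delta> - 1/4) \<le> (t / 4 / \<epsilon>) powr (\<delta> - 1/4)" using N assms by (intro powr_mono2') auto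
  also have "\<dots> = A * \<epsilon> powr (1/4 - \<delta>)" using div[of "1/4 - \<delta>"] by (simp add: A_def)
  finally have 1: "real N powr (\<delta> - 1/4) \<le> A * \<epsilon> powr (1/4 - \<delta>)" .
  have "real N powr (-(1/8)) \<le> (t / 4 / \<epsilon>) powr (-(1/8))" using N by (intro powr_mono2') auto
  also have "\<dots> = B * \<epsilon> powr (1/8)" unfolding div B_def ..
  finally have 2: "real N powr (-(1/8)) \<le> B * \<epsilon> powr (1/8)" .
  have R0: "0 \<le> R" "\<epsilon> powr (1/4 - \<delta>) \<le> R" "l * \<epsilon> powr (1/8) \<le> R" using assms by (auto simp: R_def)
  have "real N powr (\<delta> - 1/4) + l * real N powr (-(1/8)) \<le> A * \<epsilon> powr (1/4 - \<delta>) + l * (B * \<epsilon> powr (1/8))"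
    using 1 2 assms by (intro add_mono mult_left_mono) auto
  also have "\<dots> \<le> A * R + B * R" using AB R0
    by (intro add_mono) (auto simp: mult.left_commute intro!: mult_left_mono)
  finally have S: "real N powr (\<delta> - 1/4) + l * real N powr (-(1/8)) \<le> (A + B) * R" by (simp add: ring_distribs)
  have "C * s * (real N powr (\<delta> - 1/4) + l * real N powr (-(1/8))) \<le> C * M * ((A + B) * R)"
    using S assms by (intro mult_mono) auto
  moreover have "2 / real N \<le> 8 / t * R"
  proof -
    have "2 / real N \<le> 2 / (t / 4 / \<epsilon>)" using N by (intro divide_left_mono mult_pos_pos) auto
    also have "\<dots> = 8 / t * \<epsilon> powr 1" using assms by simp
    also have "\<dots> \<le> 8 / t * \<epsilon> powr (1/4 - \<delta>)" using assms by (intro mult_left_mono powr_mono') auto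
    also have "\<dots> \<le> 8 / t * R" using R0 assms by (intro mult_left_mono) auto
    finally show ?thesis .
  qed
  ultimately have "C * s * (real N powr (\<delta> - 1/4) + l * real N powr (-(1/8))) + 2 / real N \<le> C * M * ((A + B) * R) + 8 / t * R"
    by (rule add_mono)
  also have "\<dots> = (C * M * (A + B) + 8 / t) * R" by (simp add: ring_distribs)
  finally show ?thesis unfolding A_def B_def R_def .
qed

lemma sqrt_one_plus_le:
  fixes x :: real
  assumes "0 \<le> x" "x \<le> 1"
  shows "sqrt (1 + x\<^sup>2) \<le> 3/2"
proof -
  have "1 + x\<^sup>2 \<le> (3/2)\<^sup>2" using assms power_mono[of x 1 2] by (simp add: power2_eq_square)
  then show ?thesis by (intro real_le_lsqrt) auto
qed

text \<open>For an outer approximation N is taken from the end \<alpha> and \<eta> from the end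
  \<beta>, where each is largest. Then N * \<eta> exceeds t through the ratio of the square roots,
  the factor 1 + \<epsilon> and the rounding, all of order (\<beta> - \<alpha>) +
  \<epsilon>.\<close>

lemma sandwich_upper_parameters:
  fixes t \<epsilon> \<alpha> \<beta> :: real
  assumes "0 < t" "0 < \<epsilon>" "\<epsilon> \<le> 1/16" "\<epsilon> \<le> t/16" "0 \<le> \<alpha>" "\<alpha> \<le> \<beta>" "\<beta> \<le> 1"
  obtains N where "N \<ge> 1" "(t / \<epsilon>) / sqrt (1 + \<alpha>\<^sup>2) + 1 \<le> real N" "t / \<epsilon> \<le> 4 * real N"
    "t \<le> real N * (\<epsilon> * (1 + \<epsilon>) * sqrt (1 + \<beta>\<^sup>2))"
    "real N * (\<epsilon> * (1 + \<epsilon>) * sqrt (1 + \<beta>\<^sup>2)) \<le> t + (2 * t + 6) * ((\<beta> - \<alpha>) + \<epsilon>)"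
proof -
  define T where "T = t / \<epsilon>"
  define ra where "ra = sqrt (1 + \<alpha>\<^sup>2)"
  define rb where "rb = sqrt (1 + \<beta>\<^sup>2)"
  define l where "l = \<beta> - \<alpha>"
  have l: "0 \<le> l" "l \<le> 1" using assms by (auto simp: l_def)
  have T0: "T > 0" "T * \<epsilon> = t" using assms by (auto simp: T_def)
  have ra1: "1 \<le> ra" by (simp add: ra_def)
  have rab: "ra \<le> rb" "rb \<le> ra * (1 + l)" using sqrt_one_plus_bounds[OF assms(5,6)] by (auto simp: ra_def rb_def l_def)
  have rb2: "rb \<le> 3/2" unfolding rb_def using assms by (intro sqrt_one_plus_le) auto
  have pos: "0 < ra" "0 < rb" using ra1 rab by auto
  \<comment> \<open>The added 1 matches the bound q \<le> T / sqrt (1 + x^2) + 1 of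
    \<open>lattice_point_of_exit_time\<close>.\<close>
  define N where "N = nat \<lceil>T / ra\<rceil> + 1"
  have "T / ra > 0" using T0 pos by simp
  then have "real (nat \<lceil>T / ra\<rceil>) = of_int \<lceil>T / ra\<rceil>" by simp
  then have N: "T / ra + 1 \<le> real N" "real N \<le> T / ra + 2" unfolding N_def by linarith+
  show thesis
  proof (rule that[of N])
    show "N \<ge> 1" by (simp add: N_def)
    show "(t / \<epsilon>) / sqrt (1 + \<alpha>\<^sup>2) + 1 \<le> real N" using N(1) by (simp add: T_def ra_def)
    have "T / (3/2) \<le> T / ra" using T0 pos rab rb2 by (intro divide_left_mono) auto
    then have "2/3 * T \<le> T / ra" by simp
    then show "t / \<epsilon> \<le> 4 * real N" using N(1) T0(1) unfolding T_def[symmetric] by linarith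
    define \<eta> where "\<eta> = \<epsilon> * (1 + \<epsilon>) * rb"
    have \<eta>0: "\<eta> \<ge> 0" using assms pos by (simp add: \<eta>_def)
    have quot: "T / ra * \<eta> = t * (rb / ra) * (1 + \<epsilon>)"
      unfolding \<eta>_def T0(2)[symmetric] by (simp add: mult_ac)
    have "t * 1 * 1 \<le> t * (rb / ra) * (1 + \<epsilon>)"
      using assms rab pos by (intro mult_mono) (auto simp: le_divide_eq)
    also have "\<dots> = T / ra * \<eta>" using quot ..
    also have "\<dots> \<le> real N * \<eta>" using N(1) \<eta>0 by (intro mult_right_mono) auto
    finally show "t \<le> real N * (\<epsilon> * (1 + \<epsilon>) * sqrt (1 + \<beta>\<^sup>2))" by (simp add: \<eta>_def rb_def)
    have "real N * \<eta> \<le> (T / ra + 2) * \<eta>" using N(2) \<eta>0 by (intro mult_right_mono) auto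
    also have "\<dots> = t * (rb / ra) * (1 + \<epsilon>) + 2 * \<eta>" unfolding distrib_right quot ..
    also have "\<dots> \<le> t * (1 + l) * (1 + \<epsilon>) + 2 * (\<epsilon> * (1 + \<epsilon>) * (3/2))"
      unfolding \<eta>_def using assms rab rb2 pos l
      by (intro add_mono mult_left_mono mult_right_mono) (auto simp: divide_le_eq mult.commute)
    also have "\<dots> = t + t * l + \<epsilon> * (t * (1 + l) + 3 + 3 * \<epsilon>)" by (simp add: algebra_simps)
    also have "\<dots> \<le> t + t * l + \<epsilon> * (2 * t + 6)"
    proof -
      have "t * l \<le> t * 1" using assms l by (intro mult_left_mono) auto
      then have "t * (1 + l) + 3 + 3 * \<epsilon> \<le> 2 * t + 6" using assms unfolding distrib_left by linarith
      then show ?thesis using assms by (intro add_left_mono mult_left_mono) auto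
    qed
    also have "t * l \<le> (2 * t + 6) * l" using assms l by (intro mult_right_mono) auto
    finally show "real N * (\<epsilon> * (1 + \<epsilon>) * sqrt (1 + \<beta>\<^sup>2)) \<le> t + (2 * t + 6) * ((\<beta> - \<alpha>) + \<epsilon>)"
      by (simp add: \<eta>_def rb_def l_def algebra_simps)
  qed
qed

text \<open>The inner approximation exchanges the roles of \<alpha> and \<beta>. Subtracting 1
  before rounding leaves space for the \<epsilon> in (N + \<epsilon>) * sqrt (1 + \<beta>^2), and t
  / \<epsilon> \<ge> 16 keeps N positive.\<close>

lemma sandwich_lower_parameters:
  fixes t \<epsilon> \<alpha> \<beta> :: real
  assumes "0 < t" "0 < \<epsilon>" "\<epsilon> \<le> 1/16" "\<epsilon> \<le> t/16" "0 \<le> \<alpha>" "\<alpha> \<le> \<beta>" "\<beta> \<le> 1"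
  obtains N where "N \<ge> 1" "(real N + \<epsilon>) * sqrt (1 + \<beta>\<^sup>2) \<le> t / \<epsilon>" "t / \<epsilon> \<le> 4 * real N"
    "real N * (\<epsilon> * sqrt (1 + \<alpha>\<^sup>2)) \<le> t"
    "t - (2 * t + 6) * ((\<beta> - \<alpha>) + \<epsilon>) \<le> real N * (\<epsilon> * sqrt (1 + \<alpha>\<^sup>2))"
proof -
  define T where "T = t / \<epsilon>"
  define ra where "ra = sqrt (1 + \<alpha>\<^sup>2)"
  define rb where "rb = sqrt (1 + \<beta>\<^sup>2)"
  define l where "l = \<beta> - \<alpha>"
  have l: "0 \<le> l" "l \<le> 1" using assms by (auto simp: l_def)
  have T0: "T > 0" "T * \<epsilon> = t" using assms by (auto simp: T_def)
  have T16: "16 \<le> T" using assms by (simp add: T_def le_divide_eq)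
  have ra1: "1 \<le> ra" by (simp add: ra_def)
  have rab: "ra \<le> rb" "rb \<le> ra * (1 + l)" using sqrt_one_plus_bounds[OF assms(5,6)] by (auto simp: ra_def rb_def l_def)
  have rb2: "rb \<le> 3/2" unfolding rb_def using assms by (intro sqrt_one_plus_le) auto
  have pos: "0 < ra" "0 < rb" using ra1 rab by auto
  define N where "N = nat \<lfloor>T / rb - 1\<rfloor>"
  have "T / (3/2) \<le> T / rb" using T0 pos rb2 by (intro divide_left_mono) auto
  then have Trb: "2/3 * T \<le> T / rb" by simp
  have "0 \<le> T / rb - 1" using Trb T16 by linarith
  then have "0 \<le> \<lfloor>T / rb - 1\<rfloor>" by (simp only: zero_le_floor)
  then have "real N = of_int \<lfloor>T / rb - 1\<rfloor>" unfolding N_def by (rule of_nat_nat)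
  then have N: "T / rb - 2 \<le> real N" "real N \<le> T / rb - 1" by linarith+
  show thesis
  proof (rule that[of N])
    have "real N \<ge> 1" using N(1) Trb T16 by linarith
    then show "N \<ge> 1" by simp
    have "(real N + \<epsilon>) * rb \<le> (T / rb) * rb" using N(2) assms pos by (intro mult_right_mono) auto
    then show "(real N + \<epsilon>) * sqrt (1 + \<beta>\<^sup>2) \<le> t / \<epsilon>" using pos by (simp add: rb_def T_def)
    show "t / \<epsilon> \<le> 4 * real N" using N(1) Trb T16 unfolding T_def[symmetric] by linarith
    define \<eta> where "\<eta> = \<epsilon> * ra"
    have \<eta>0: "\<eta> \<ge> 0" using assms pos by (simp add: \<eta>_def)
    have quot: "T / rb * \<eta> = t * (ra / rb)"
      unfolding \<eta>_def T0(2)[symmetric] by (simp add: mult_ac)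
    have "real N * \<eta> \<le> T / rb * \<eta>" using N(2) \<eta>0 by (intro mult_right_mono) auto
    also have "\<dots> \<le> t * 1" unfolding quot using assms rab pos by (intro mult_left_mono) auto
    finally show "real N * (\<epsilon> * sqrt (1 + \<alpha>\<^sup>2)) \<le> t" by (simp add: \<eta>_def ra_def)
    have "1 - l \<le> ra / rb"
    proof -
      have "(1 - l) * rb \<le> (1 - l) * (ra * (1 + l))" using rab l by (intro mult_left_mono) auto
      also have "\<dots> = ra * (1 - l\<^sup>2)" by (simp add: algebra_simps power2_eq_square)
      also have "\<dots> \<le> ra" using pos by (simp add: mult_left_le)
      finally show ?thesis using pos by (simp add: le_divide_eq)
    qed
    then have "t * (1 - l) \<le> t * (ra / rb)" using assms by (intro mult_left_mono) auto
    then have "t - t * l - 2 * \<eta> \<le> (T / rb - 2) * \<eta>" unfolding left_diff_distrib quot by (simp add: right_diff_distrib)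
    also have "\<dots> \<le> real N * \<eta>" using N(1) \<eta>0 by (intro mult_right_mono) auto
    finally have "t - t * l - 2 * \<eta> \<le> real N * \<eta>" .
    moreover have "2 * \<eta> \<le> (2 * t + 6) * \<epsilon>"
    proof -
      have "\<epsilon> * (2 * ra) \<le> \<epsilon> * (2 * t + 6)" using assms rab rb2 by (intro mult_left_mono) auto
      then show ?thesis by (simp add: \<eta>_def mult_ac)
    qed
    moreover have "t * l \<le> (2 * t + 6) * l" using assms l by (intro mult_right_mono) auto
    ultimately show "t - (2 * t + 6) * ((\<beta> - \<alpha>) + \<epsilon>) \<le> real N * (\<epsilon> * sqrt (1 + \<alpha>\<^sup>2))"
      unfolding \<eta>_def ra_def l_def[symmetric] distrib_left by linarith
  qed
qed

text \<open>As sqrt (1 + x^2) increases for x \<ge> 0, each occurrence can be frozen at the end of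
  the slice that errs on the required side.\<close>

lemma exit_within_sandwich:
  fixes \<epsilon> \<alpha> \<beta> x :: real
  assumes "0 < \<epsilon>" "\<epsilon> \<le> 1/16" "0 \<le> \<alpha>" "\<alpha> \<le> x" "x \<le> \<beta>" "\<beta> \<le> 1"
  shows "(real N + \<epsilon>) * sqrt (1 + \<beta>\<^sup>2) \<le> t / \<epsilon> \<Longrightarrow> x \<in> near_set N (\<epsilon> * sqrt (1 + \<alpha>\<^sup>2)) \<Longrightarrow> arctan x \<in> exit_within \<epsilon> t"
    and "(t / \<epsilon>) / sqrt (1 + \<alpha>\<^sup>2) + 1 \<le> real N \<Longrightarrow> 0 < t \<Longrightarrow> arctan x \<in> exit_within \<epsilon> t \<Longrightarrow> x \<in> near_set N (\<epsilon> * (1 + \<epsilon>) * sqrt (1 + \<beta>\<^sup>2))"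
proof -
  have r: "sqrt (1 + \<alpha>\<^sup>2) \<le> sqrt (1 + x\<^sup>2)" "sqrt (1 + x\<^sup>2) \<le> sqrt (1 + \<beta>\<^sup>2)"
    using sqrt_one_plus_bounds(1)[of \<alpha> x] sqrt_one_plus_bounds(1)[of x \<beta>] assms by auto
  {
    assume N: "(real N + \<epsilon>) * sqrt (1 + \<beta>\<^sup>2) \<le> t / \<epsilon>" and x: "x \<in> near_set N (\<epsilon> * sqrt (1 + \<alpha>\<^sup>2))"
    then obtain q a where q: "1 \<le> q" "q \<le> N" "\<bar>real q * x - of_int a\<bar> \<le> \<epsilon> * sqrt (1 + \<alpha>\<^sup>2)"
      by (auto simp: near_set_def)
    have "exit_time \<epsilon> (arctan x) \<le> t / \<epsilon>"
    proof (rule exit_time_arctan_le)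
      show "\<bar>real q * x - of_int a\<bar> \<le> \<epsilon> * sqrt (1 + x\<^sup>2)"
        using q(3) r(1) assms(1) by (smt (verit) mult_left_mono)
      have "(real q + \<epsilon>) * sqrt (1 + x\<^sup>2) \<le> (real N + \<epsilon>) * sqrt (1 + \<beta>\<^sup>2)"
        using q r assms by (intro mult_mono) auto
      then show "(real q + \<epsilon>) * sqrt (1 + x\<^sup>2) \<le> t / \<epsilon>" using N by linarith
    qed (use assms q in auto)
    then show "arctan x \<in> exit_within \<epsilon> t" by (simp add: exit_within_def)
  next
    assume N: "(t / \<epsilon>) / sqrt (1 + \<alpha>\<^sup>2) + 1 \<le> real N" and t: "0 < t" and x: "arctan x \<in> exit_within \<epsilon> t"
    then have le: "exit_time \<epsilon> (arctan x) \<le> t / \<epsilon>" by (simp add: exit_within_def)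
    obtain q a where q: "1 \<le> q" "real q \<le> (t / \<epsilon>) / sqrt (1 + x\<^sup>2) + 1"
      "\<bar>real q * x - of_int a\<bar> \<le> \<epsilon> * (1 + \<epsilon>) * sqrt (1 + x\<^sup>2)"
      by (rule lattice_point_of_exit_time[OF _ _ _ _ le]) (use assms in auto)
    have "(t / \<epsilon>) / sqrt (1 + x\<^sup>2) \<le> (t / \<epsilon>) / sqrt (1 + \<alpha>\<^sup>2)"
      using r t assms by (intro divide_left_mono mult_pos_pos) (auto simp: add_pos_nonneg)
    then have "q \<le> N" using q(2) N by linarith
    moreover have "\<epsilon> * (1 + \<epsilon>) * sqrt (1 + x\<^sup>2) \<le> \<epsilon> * (1 + \<epsilon>) * sqrt (1 + \<beta>\<^sup>2)"
      using r assms by (intro mult_left_mono) auto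
    then have "\<bar>real q * x - of_int a\<bar> \<le> \<epsilon> * (1 + \<epsilon>) * sqrt (1 + \<beta>\<^sup>2)" using q(3) by linarith
    ultimately show "x \<in> near_set N (\<epsilon> * (1 + \<epsilon>) * sqrt (1 + \<beta>\<^sup>2))"
      using q(1) unfolding near_set_def by auto
  }
qed

text \<open>In the coordinate x the slice lies between two near sets whose N * \<eta> is within
  \<Delta> = O(l + \<epsilon>) of t, where l = \<beta> - \<alpha>. The Lipschitz bound for
  \<open>cumul\<close> turns this into an error l * \<Delta>, and the variation of 1 / (1 + x^2)
  over the slice costs O(l^2) once more.\<close>

lemma slice_asymp:
  assumes \<delta>: "0 < \<delta>" "\<delta> < 1/4" and t: "0 < t"
  obtains C where "C \<ge> 0" "\<And>\<epsilon> \<alpha> \<beta>. \<lbrakk>0 < \<epsilon>; \<epsilon> \<le> 1/16; \<epsilon> \<le> t/16; 0 \<le> \<alpha>; \<alpha> \<le> \<beta>; \<beta> \<le> 1\<rbrakk> \<Longrightarrow>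
    \<bar>measure lborel ({arctan \<alpha>..<arctan \<beta>} \<inter> exit_within \<epsilon> t) - (arctan \<beta> - arctan \<alpha>) * cumul t\<bar>
      \<le> C * (\<epsilon> powr (1/4 - \<delta>) + (\<beta> - \<alpha>) * \<epsilon> powr (1/8) + (\<beta> - \<alpha>)\<^sup>2)"
proof -
  obtain C0 where C0: "C0 \<ge> 0" "\<And>N \<alpha> \<beta> t. \<lbrakk>N \<ge> 1; 0 \<le> \<alpha>; \<alpha> \<le> \<beta>; \<beta> \<le> 1; 0 \<le> t\<rbrakk> \<Longrightarrow>
    \<bar>measure lborel ({\<alpha>..<\<beta>} \<inter> near_set N (t / real N)) - (\<beta> - \<alpha>) * integral {0..t} limit_density\<bar>
      \<le> C0 * t * (real N powr (\<delta> - 1/4) + (\<beta> - \<alpha>) * real N powr (-(1/8))) + 2 / real N"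
    using near_set_measure_asymp[OF \<delta>(1)] by blast
  \<comment> \<open>Bounds N * \<eta> for both choices of parameters: t + \<Delta> \<le> t + 2 * (2
    * t + 6).\<close>
  define M where "M = 5 * t + 12"
  define C1 where "C1 = C0 * M * ((t/4) powr (\<delta> - 1/4) + (t/4) powr (-(1/8))) + 8 / t"
  have C1: "C1 \<ge> 0" using C0 t by (simp add: C1_def M_def)
  show thesis
  proof (rule that[of "C1 + 8 * t + 12"])
    show "0 \<le> C1 + 8 * t + 12" using C1 t by simp
    fix \<epsilon> \<alpha> \<beta> :: real
    assume \<epsilon>: "0 < \<epsilon>" "\<epsilon> \<le> 1/16" "\<epsilon> \<le> t/16" and ab: "0 \<le> \<alpha>" "\<alpha> \<le> \<beta>" "\<beta> \<le> 1"
    define l where "l = \<beta> - \<alpha>"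
    define R where "R = \<epsilon> powr (1/4 - \<delta>) + l * \<epsilon> powr (1/8)"
    define D where "D = arctan \<beta> - arctan \<alpha>"
    define m where "m = measure lborel ({arctan \<alpha>..<arctan \<beta>} \<inter> exit_within \<epsilon> t)"
    define B where "B = {x \<in> {\<alpha>..\<beta>}. arctan x \<in> exit_within \<epsilon> t}"
    have [measurable]: "exit_within \<epsilon> t \<in> sets borel" using exit_within_borel \<epsilon> by simp
    have [measurable]: "arctan \<in> borel_measurable borel"
      by (intro borel_measurable_continuous_onI continuous_intros)
    have Bm: "B \<in> sets borel" unfolding B_def by measurable
    have l: "0 \<le> l" "l \<le> 1" using ab by (auto simp: l_def)
    have R0: "0 \<le> R" using l by (simp add: R_def)
    define \<Delta> where "\<Delta> = (2 * t + 6) * (l + \<epsilon>)"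
    have near: "\<bar>measure lborel ({\<alpha>..\<beta>} \<inter> near_set N \<eta>) - l * cumul (real N * \<eta>)\<bar> \<le> C1 * R"
      if N: "N \<ge> 1" "t / \<epsilon> \<le> 4 * real N" and \<eta>: "0 \<le> \<eta>" "real N * \<eta> \<le> M" for N \<eta>
    proof -
      have "real N * \<eta> / real N = \<eta>" using N by simp
      then have "\<bar>measure lborel ({\<alpha>..<\<beta>} \<inter> near_set N \<eta>) - l * cumul (real N * \<eta>)\<bar>
          \<le> C0 * (real N * \<eta>) * (real N powr (\<delta> - 1/4) + l * real N powr (-(1/8))) + 2 / real N"
        using C0(2)[OF N(1) ab, of "real N * \<eta>"] \<eta> by (simp add: l_def cumul_def)
      also have "\<dots> \<le> C1 * R"
        unfolding C1_def R_def using \<delta> \<epsilon> t N \<eta> l C0 by (intro error_term_bound) auto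
      finally show ?thesis by (simp add: measure_Icc_eq_Ico)
    qed
    have fmI: "{\<alpha>..\<beta>} \<inter> S \<in> fmeasurable lborel" if "S \<in> sets borel" for S
      using that by (intro fmeasurable_bounded_Int) auto
    have upper: "measure lborel B \<le> l * (cumul t + 2 * \<Delta>) + C1 * R"
    proof -
      obtain N where N: "N \<ge> 1" "(t / \<epsilon>) / sqrt (1 + \<alpha>\<^sup>2) + 1 \<le> real N" "t / \<epsilon> \<le> 4 * real N"
        "t \<le> real N * (\<epsilon> * (1 + \<epsilon>) * sqrt (1 + \<beta>\<^sup>2))"
        "real N * (\<epsilon> * (1 + \<epsilon>) * sqrt (1 + \<beta>\<^sup>2)) \<le> t + \<Delta>"
        using sandwich_upper_parameters[OF t \<epsilon> ab] unfolding \<Delta>_def l_def by blast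
      define \<eta> where "\<eta> = \<epsilon> * (1 + \<epsilon>) * sqrt (1 + \<beta>\<^sup>2)"
      have "B \<subseteq> {\<alpha>..\<beta>} \<inter> near_set N \<eta>"
        using exit_within_sandwich(2)[OF \<epsilon>(1,2) ab(1) _ _ ab(3) N(2) t] by (auto simp: B_def \<eta>_def)
      then have f1: "measure lborel B \<le> measure lborel ({\<alpha>..\<beta>} \<inter> near_set N \<eta>)"
        using Bm by (intro measure_mono_fmeasurable fmI near_set_borel) auto
      have "\<Delta> \<le> (2 * t + 6) * (1 + 1)" unfolding \<Delta>_def using l \<epsilon> t by (intro mult_left_mono) auto
      then have "real N * \<eta> \<le> M" using N(5) by (simp add: M_def \<eta>_def)
      then have f2: "\<bar>measure lborel ({\<alpha>..\<beta>} \<inter> near_set N \<eta>) - l * cumul (real N * \<eta>)\<bar> \<le> C1 * R"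
        using N \<epsilon> by (intro near) (auto simp: \<eta>_def)
      define S where "S = real N * \<eta>"
      have S: "t \<le> S" "S \<le> t + \<Delta>" using N(4,5) by (simp_all only: S_def \<eta>_def)
      have "cumul S \<le> cumul t + 2 * (S - t)" using t S(1) by (intro cumul_lipschitz) auto
      then have "cumul S \<le> cumul t + 2 * \<Delta>" using S(2) by argo
      then have "l * cumul S \<le> l * (cumul t + 2 * \<Delta>)" using l by (intro mult_left_mono)
      then show ?thesis using f1 f2 unfolding S_def[symmetric] by linarith
    qed
    have lower: "l * (cumul t - 2 * \<Delta>) - C1 * R \<le> measure lborel B"
    proof -
      obtain N where N: "N \<ge> 1" "(real N + \<epsilon>) * sqrt (1 + \<beta>\<^sup>2) \<le> t / \<epsilon>" "t / \<epsilon> \<le> 4 * real N"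
        "real N * (\<epsilon> * sqrt (1 + \<alpha>\<^sup>2)) \<le> t"
        "t - \<Delta> \<le> real N * (\<epsilon> * sqrt (1 + \<alpha>\<^sup>2))"
        using sandwich_lower_parameters[OF t \<epsilon> ab] unfolding \<Delta>_def l_def by blast
      define \<eta> where "\<eta> = \<epsilon> * sqrt (1 + \<alpha>\<^sup>2)"
      have "{\<alpha>..\<beta>} \<inter> near_set N \<eta> \<subseteq> B"
        using exit_within_sandwich(1)[OF \<epsilon>(1,2) ab(1) _ _ ab(3) N(2)] by (auto simp: B_def \<eta>_def)
      then have f1: "measure lborel ({\<alpha>..\<beta>} \<inter> near_set N \<eta>) \<le> measure lborel B"
      proof (rule measure_mono_fmeasurable)
        have "{\<alpha>..\<beta>} \<inter> B \<in> fmeasurable lborel" by (rule fmI[OF Bm])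
        moreover have "{\<alpha>..\<beta>} \<inter> B = B" by (auto simp: B_def)
        ultimately show "B \<in> fmeasurable lborel" by simp
      qed auto
      have "real N * \<eta> \<le> M" using N(4) t by (simp add: M_def \<eta>_def)
      then have f2: "\<bar>measure lborel ({\<alpha>..\<beta>} \<inter> near_set N \<eta>) - l * cumul (real N * \<eta>)\<bar> \<le> C1 * R"
        using N \<epsilon> by (intro near) (auto simp: \<eta>_def)
      define S where "S = real N * \<eta>"
      have S: "S \<le> t" "t - \<Delta> \<le> S" using N(4,5) by (simp_all only: S_def \<eta>_def)
      have "0 \<le> S" using \<epsilon> by (simp add: S_def \<eta>_def)
      then have "cumul t \<le> cumul S + 2 * (t - S)" using S(1) by (rule cumul_lipschitz)
      then have "cumul t - 2 * \<Delta> \<le> cumul S" using S(2) by argo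
      then have "l * (cumul t - 2 * \<Delta>) \<le> l * cumul S" using l by (intro mult_left_mono)
      then show ?thesis using f1 f2 unfolding S_def[symmetric] by linarith
    qed
    have meq: "m = measure lborel ({arctan \<alpha>..arctan \<beta>} \<inter> exit_within \<epsilon> t)"
      unfolding m_def by (simp add: measure_Icc_eq_Ico)
    define A where "A = 1 / (1 + \<alpha>\<^sup>2)"
    define G where "G = 1 / (1 + \<beta>\<^sup>2)"
    have p1: "1 \<le> 1 + \<alpha>\<^sup>2" "1 \<le> 1 + \<beta>\<^sup>2" by auto
    have pp: "0 < 1 + \<alpha>\<^sup>2" "0 < 1 + \<beta>\<^sup>2" using p1 by linarith+
    have AG: "0 \<le> G" "G \<le> A" "A \<le> 1"
    proof -
      show "0 \<le> G" using pp by (simp add: G_def)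
      show "G \<le> A" unfolding A_def G_def using ab by (intro divide_left_mono mult_pos_pos pp) (auto intro: power_mono)
      show "A \<le> 1" using pp by (simp add: A_def divide_le_eq)
    qed
    have AGd: "A - G \<le> 2 * l"
    proof -
      have "A - G = (\<beta>\<^sup>2 - \<alpha>\<^sup>2) / ((1 + \<alpha>\<^sup>2) * (1 + \<beta>\<^sup>2))"
        using pp by (simp add: A_def G_def field_simps)
      also have "\<dots> \<le> (\<beta>\<^sup>2 - \<alpha>\<^sup>2) / 1"
        using ab mult_mono[OF p1] by (intro divide_left_mono) (auto intro: power_mono)
      also have "\<dots> = (\<beta> + \<alpha>) * l" by (simp add: l_def power2_eq_square algebra_simps)
      also have "\<dots> \<le> 2 * l" using ab l by (intro mult_right_mono) auto
      finally show ?thesis .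
    qed
    have "{x \<in> {\<alpha>..\<beta>}. arctan x \<in> UNIV} = {\<alpha>..\<beta>}" by auto
    then have Dm: "G * l \<le> D" "D \<le> A * l"
      using arctan_measure_bounds[OF ab(1,2), of UNIV] ab by (simp_all add: D_def A_def G_def l_def arctan_le_iff)
    have c: "0 \<le> cumul t" "cumul t \<le> 2 * t" using t cumul_nonneg[of t] cumul_lipschitz[of 0 t] by (auto simp: cumul_def)
    have \<Delta>0: "0 \<le> \<Delta>" using l \<epsilon> t by (simp add: \<Delta>_def)
    have mu: "m \<le> A * measure lborel B" and ml: "G * measure lborel B \<le> m"
      using arctan_measure_bounds[OF ab(1,2), of "exit_within \<epsilon> t"] unfolding meq A_def G_def B_def by auto
    \<comment> \<open>Either endpoint density times l differs from the angle D by at most 2 *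
      l^2.\<close>
    have ll: "A * l \<le> D + 2 * l\<^sup>2" "D - 2 * l\<^sup>2 \<le> G * l"
      using Dm mult_right_mono[OF AGd l(1)] by (simp_all add: power2_eq_square algebra_simps)
    define W where "W = 2 * (l * \<Delta>) + C1 * R"
    have W0: "0 \<le> W" using l \<Delta>0 C1 R0 by (simp add: W_def)
    have "m \<le> A * (l * (cumul t + 2 * \<Delta>) + C1 * R)" using mu mult_left_mono[OF upper, of A] AG by linarith
    also have "\<dots> = (A * l) * cumul t + A * W" by (simp add: W_def algebra_simps)
    also have "\<dots> \<le> (D + 2 * l\<^sup>2) * cumul t + 1 * W" using ll AG W0 c by (intro add_mono mult_right_mono) auto
    also have "\<dots> \<le> D * cumul t + 2 * l\<^sup>2 * (2 * t) + W" using c mult_left_mono[OF c(2), of "2 * l\<^sup>2"] by (simp add: distrib_right)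
    finally have u: "m \<le> D * cumul t + 4 * t * l\<^sup>2 + W" by (simp add: mult_ac)
    have "D * cumul t - 2 * l\<^sup>2 * (2 * t) - W \<le> (D - 2 * l\<^sup>2) * cumul t - 1 * W"
      using mult_left_mono[OF c(2), of "2 * l\<^sup>2"] by (simp add: left_diff_distrib)
    also have "\<dots> \<le> (G * l) * cumul t - G * W" using ll AG W0 c by (intro diff_mono mult_right_mono) auto
    also have "\<dots> = G * (l * (cumul t - 2 * \<Delta>) - C1 * R)" by (simp add: W_def algebra_simps)
    also have "\<dots> \<le> m" using ml mult_left_mono[OF lower AG(1)] by linarith
    finally have v: "D * cumul t - 4 * t * l\<^sup>2 - W \<le> m" by (simp add: mult_ac)
    have "\<epsilon> = \<epsilon> powr 1" using \<epsilon> by simp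
    also have "\<dots> \<le> \<epsilon> powr (1/8)" using \<epsilon> by (intro powr_mono') auto
    finally have "l * \<epsilon> \<le> l * \<epsilon> powr (1/8)" using l(1) by (rule mult_left_mono)
    also have "\<dots> \<le> R" by (simp add: R_def)
    finally have "l * \<epsilon> \<le> R" .
    then have "(4 * t + 12) * (l * \<epsilon>) \<le> (4 * t + 12) * R" using t by (intro mult_left_mono) auto
    moreover have "2 * (l * \<Delta>) = (4 * t + 12) * l\<^sup>2 + (4 * t + 12) * (l * \<epsilon>)" by (simp add: \<Delta>_def power2_eq_square algebra_simps)
    ultimately have "4 * t * l\<^sup>2 + W \<le> (8 * t + 12) * l\<^sup>2 + (C1 + 4 * t + 12) * R"
      unfolding W_def by (simp add: algebra_simps)
    also have "\<dots> \<le> (C1 + 8 * t + 12) * l\<^sup>2 + (C1 + 8 * t + 12) * R"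
      using C1 t R0 by (intro add_mono mult_right_mono) auto
    also have "\<dots> = (C1 + 8 * t + 12) * (R + l\<^sup>2)" by (simp add: algebra_simps)
    finally have "\<bar>m - D * cumul t\<bar> \<le> (C1 + 8 * t + 12) * (R + l\<^sup>2)" using u v by linarith
    then show "\<bar>measure lborel ({arctan \<alpha>..<arctan \<beta>} \<inter> exit_within \<epsilon> t) - (arctan \<beta> - arctan \<alpha>) * cumul t\<bar>
      \<le> (C1 + 8 * t + 12) * (\<epsilon> powr (1/4 - \<delta>) + (\<beta> - \<alpha>) * \<epsilon> powr (1/8) + (\<beta> - \<alpha>)\<^sup>2)"
      unfolding m_def D_def R_def l_def .
  qed
qed

lemma exit_tail_eq:
  assumes "\<epsilon> > 0"
  shows "exit_tail \<epsilon> t = 1 - 4 / pi * measure lborel ({0..pi/4} \<inter> exit_within \<epsilon> t)"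
proof -
  have [measurable]: "exit_within \<epsilon> t \<in> sets borel" using exit_within_borel assms by simp
  have "{\<omega> \<in> {0..pi/4}. \<epsilon> * exit_time \<epsilon> \<omega> > t} = {0..pi/4} - ({0..pi/4} \<inter> exit_within \<epsilon> t)"
    using assms by (auto simp: exit_within_def divide_less_eq le_divide_eq not_le mult.commute)
  then have "measure lborel {\<omega> \<in> {0..pi/4}. \<epsilon> * exit_time \<epsilon> \<omega> > t}
      = measure lborel ({0..pi/4} - ({0..pi/4} \<inter> exit_within \<epsilon> t))" by simp
  also have "\<dots> = measure lborel {0..pi/4} - measure lborel ({0..pi/4} \<inter> exit_within \<epsilon> t)"
    by (rule measure_Diff) auto
  finally show ?thesis by (simp add: exit_tail_def right_diff_distrib)
qed

text \<open>The slices have equal length in x = tan \<omega> and are added up by induction. The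
  bound is explicit for small \<epsilon>, so that both the limit and the Landau form can be read
  off.\<close>

theorem exit_tail_asymp:
  assumes \<delta>: "0 < \<delta>" "\<delta> < 1/4" and t: "0 < t"
  obtains C where "C \<ge> 0" "\<And>\<epsilon>. 0 < \<epsilon> \<Longrightarrow> \<epsilon> \<le> 1/16 \<Longrightarrow> \<epsilon> \<le> t/16 \<Longrightarrow> \<bar>exit_tail \<epsilon> t - (1 - cumul t)\<bar> \<le> C * \<epsilon> powr (1/8 - \<delta>)"
proof -
  obtain C where C: "C \<ge> 0" "\<And>\<epsilon> \<alpha> \<beta>. \<lbrakk>0 < \<epsilon>; \<epsilon> \<le> 1/16; \<epsilon> \<le> t/16; 0 \<le> \<alpha>; \<alpha> \<le> \<beta>; \<beta> \<le> 1\<rbrakk> \<Longrightarrow>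
    \<bar>measure lborel ({arctan \<alpha>..<arctan \<beta>} \<inter> exit_within \<epsilon> t) - (arctan \<beta> - arctan \<alpha>) * cumul t\<bar>
      \<le> C * (\<epsilon> powr (1/4 - \<delta>) + (\<beta> - \<alpha>) * \<epsilon> powr (1/8) + (\<beta> - \<alpha>)\<^sup>2)"
    using slice_asymp[OF assms] by blast
  show thesis
  proof (rule that[of "4 / pi * (4 * C)"])
    show "0 \<le> 4 / pi * (4 * C)" using C by simp
    fix \<epsilon> :: real assume \<epsilon>: "0 < \<epsilon>" "\<epsilon> \<le> 1/16" "\<epsilon> \<le> t/16"
    define E where "E = exit_within \<epsilon> t"
    have [measurable]: "E \<in> sets borel" using exit_within_borel \<epsilon> by (simp add: E_def)
    define z where "z = \<epsilon> powr (-(1/8))"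
    have z1: "1 \<le> z"
      using \<epsilon> powr_mono2'[of "-(1/8)" \<epsilon> 1] by (simp add: z_def)
    define K where "K = nat \<lceil>z\<rceil>"
    have K: "z \<le> real K" "real K \<le> 2 * z" using z1 unfolding K_def by linarith+
    have K0: "real K > 0" using K z1 by linarith
    \<comment> \<open>The error of a single slice of length 1 / K. Multiplied by K, each of the
      three terms is at most a constant times \<epsilon> powr (1/8 - \<delta>).\<close>
    define P where "P = C * (\<epsilon> powr (1/4 - \<delta>) + (1 / real K) * \<epsilon> powr (1/8) + (1 / real K)\<^sup>2)"
    have ind: "\<bar>measure lborel ({0..<arctan (real n / real K)} \<inter> E) - arctan (real n / real K) * cumul t\<bar> \<le> real n * P" if "n \<le> K" for n
      using that
    proof (induction n)
      case (Suc n)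
      define a where "a = arctan (real n / real K)"
      define b where "b = arctan (real (Suc n) / real K)"
      have nk: "real n / real K \<le> real (Suc n) / real K" using K0 by (intro divide_right_mono) auto
      have a: "0 \<le> a" "a \<le> b" using nk K0 by (auto simp: a_def b_def arctan_le_iff)
      have split: "measure lborel ({0..<b} \<inter> E) = measure lborel ({0..<a} \<inter> E) + measure lborel ({a..<b} \<inter> E)"
        using a by (intro measure_Ico_split) auto
      have "real (Suc n) / real K - real n / real K = 1 / real K" using K0 by (simp add: diff_divide_distrib[symmetric])
      then have "\<bar>measure lborel ({a..<b} \<inter> E) - (b - a) * cumul t\<bar> \<le> P"
        using C(2)[OF \<epsilon>, of "real n / real K" "real (Suc n) / real K"] nk Suc.prems K0
        unfolding a_def b_def E_def P_def by simp
      moreover have "\<bar>measure lborel ({0..<a} \<inter> E) - a * cumul t\<bar> \<le> real n * P" using Suc unfolding a_def by simp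
      ultimately have "\<bar>measure lborel ({0..<b} \<inter> E) - b * cumul t\<bar> \<le> real n * P + P"
        unfolding split left_diff_distrib by linarith
      then show ?case unfolding b_def by (simp add: distrib_right)
    qed simp
    have "real K / real K = 1" using K0 by simp
    then have m: "\<bar>measure lborel ({0..<pi/4} \<inter> E) - pi/4 * cumul t\<bar> \<le> real K * P"
      using ind[of K] by (simp add: arctan_one)
    have "1 / real K \<le> 1 / z" using K z1 by (intro divide_left_mono) auto
    also have "1 / z = \<epsilon> powr (1/8)" by (simp add: z_def powr_minus_divide)
    finally have K1: "1 / real K \<le> \<epsilon> powr (1/8)" .
    have "real K * P = C * (real K * \<epsilon> powr (1/4 - \<delta>) + \<epsilon> powr (1/8) + 1 / real K)"
      using K0 unfolding P_def power2_eq_square by (simp add: field_simps)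
    also have "\<dots> \<le> C * (2 * z * \<epsilon> powr (1/4 - \<delta>) + \<epsilon> powr (1/8) + \<epsilon> powr (1/8))"
      using K K1 C by (intro mult_left_mono add_mono mult_right_mono) auto
    also have "2 * z * \<epsilon> powr (1/4 - \<delta>) = 2 * \<epsilon> powr (1/8 - \<delta>)"
      by (simp add: z_def powr_add[symmetric])
    also have "C * (2 * \<epsilon> powr (1/8 - \<delta>) + \<epsilon> powr (1/8) + \<epsilon> powr (1/8)) \<le> C * (2 * \<epsilon> powr (1/8 - \<delta>) + \<epsilon> powr (1/8 - \<delta>) + \<epsilon> powr (1/8 - \<delta>))"
      using C \<epsilon> \<delta> by (intro mult_left_mono add_mono powr_mono') auto
    finally have KP: "real K * P \<le> 4 * C * \<epsilon> powr (1/8 - \<delta>)" by (simp add: algebra_simps)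
    have "exit_tail \<epsilon> t - (1 - cumul t) = - (4 / pi * (measure lborel ({0..<pi/4} \<inter> E) - pi/4 * cumul t))"
      unfolding exit_tail_eq[OF \<epsilon>(1)] E_def by (simp add: right_diff_distrib measure_Icc_eq_Ico exit_within_borel \<epsilon>(1))
    then have "\<bar>exit_tail \<epsilon> t - (1 - cumul t)\<bar> = 4 / pi * \<bar>measure lborel ({0..<pi/4} \<inter> E) - pi/4 * cumul t\<bar>"
      by (simp only: abs_minus_cancel abs_mult) simp
    also have "\<dots> \<le> 4 / pi * (4 * C * \<epsilon> powr (1/8 - \<delta>))" using m KP by (intro mult_left_mono) auto
    finally show "\<bar>exit_tail \<epsilon> t - (1 - cumul t)\<bar> \<le> 4 / pi * (4 * C) * \<epsilon> powr (1/8 - \<delta>)" by (simp add: mult_ac)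
  qed
qed

lemma cumul_one: "cumul 1 = 1"
proof -
  \<comment> \<open>The choice \<delta> = 1/8 makes both powers of N equal to N powr (-
    1/8).\<close>
  have eighth: "(0::real) < 1/8" by simp
  obtain C0 where C0: "C0 \<ge> 0" "\<And>N \<alpha> \<beta> t. \<lbrakk>N \<ge> 1; 0 \<le> \<alpha>; \<alpha> \<le> \<beta>; \<beta> \<le> 1; 0 \<le> t\<rbrakk> \<Longrightarrow>
    \<bar>measure lborel ({\<alpha>..<\<beta>} \<inter> near_set N (t / real N)) - (\<beta> - \<alpha>) * integral {0..t} limit_density\<bar>
      \<le> C0 * t * (real N powr (1/8 - 1/4) + (\<beta> - \<alpha>) * real N powr (-(1/8))) + 2 / real N"
    using near_set_measure_asymp[OF eighth] by blast
  have "\<bar>1 - cumul 1\<bar> \<le> C0 * (2 * real N powr (-(1/8))) + 2 / real N" if N: "N \<ge> 1" for N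
  proof -
    have "near_set N (1 / real N) = UNIV"
    proof (intro equalityI subsetI)
      fix x :: real
      have "0 < N" using N by simp
      then obtain h k where hk: "0 < k" "k \<le> int N" "\<bar>of_int k * x - of_int h\<bar> < 1 / real N"
        using Dirichlet_approx by blast
      then have "\<bar>real (nat k) * x - of_int h\<bar> \<le> 1 / real N" "nat k \<in> {1..N}" by auto
      then show "x \<in> near_set N (1 / real N)" unfolding near_set_def by blast
    qed simp
    then show ?thesis using C0(2)[OF N, of 0 1 1] by (simp add: cumul_def)
  qed
  then have "eventually (\<lambda>N. \<bar>1 - cumul 1\<bar> \<le> C0 * (2 * real N powr (-(1/8))) + 2 / real N) sequentially"
    by (intro eventually_sequentiallyI[of 1]) auto
  moreover have "(\<lambda>N. C0 * (2 * real N powr (-(1/8))) + 2 / real N) \<longlonglongrightarrow> C0 * (2 * 0) + 0"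
    by (intro tendsto_intros; real_asymp)
  ultimately have "\<bar>1 - cumul 1\<bar> \<le> C0 * (2 * 0) + 0"
    by (intro tendsto_lowerbound[of _ _ sequentially]) auto
  then show ?thesis by simp
qed

section \<open>Symmetry and weak convergence\<close>

lemma infdist_isometry:
  fixes g :: "'a::metric_space \<Rightarrow> 'a"
  assumes "\<And>x y. dist (g x) (g y) = dist x y" "g ` L = L"
  shows "infdist (g x) L = infdist x L"
proof -
  have "infdist (g x) (g ` L) = infdist x L"
    unfolding infdist_def by (simp add: image_image assms(1))
  then show ?thesis by (simp only: assms(2))
qed

text \<open>Reflection in the first axis and the quarter turn below preserve the punctured lattice.
  Together they generate the eight symmetries that reduce the circle to {0..pi/4}.\<close>

lemma exit_time_minus: "exit_time \<epsilon> (- \<omega>) = exit_time \<epsilon> \<omega>"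
proof -
  let ?L = "\<int> \<times> \<int> - {(0, 0)} :: (real \<times> real) set"
  let ?g = "\<lambda>p::real \<times> real. (fst p, - snd p)"
  have "?g ` ?L = ?L"
  proof (intro equalityI subsetI)
    fix p assume "p \<in> ?L"
    then show "p \<in> ?g ` ?L" by (intro image_eqI[of _ _ "?g p"]) auto
  qed auto
  moreover have "dist (?g x) (?g y) = dist x y" for x y
    by (simp add: dist_prod_def dist_real_def abs_minus_commute power2_commute)
  ultimately have "infdist (?g x) ?L = infdist x ?L" for x by (intro infdist_isometry)
  from this[of "(\<tau> * cos \<omega>, \<tau> * sin \<omega>)" for \<tau>] show ?thesis
    by (simp add: exit_time_def)
qed

lemma exit_time_plus_half_pi: "exit_time \<epsilon> (\<omega> + pi/2) = exit_time \<epsilon> \<omega>"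
proof -
  let ?L = "\<int> \<times> \<int> - {(0, 0)} :: (real \<times> real) set"
  let ?g = "\<lambda>p::real \<times> real. (- snd p, fst p)"
  have "?g ` ?L = ?L"
  proof (intro equalityI subsetI)
    fix p assume "p \<in> ?L"
    then show "p \<in> ?g ` ?L" by (intro image_eqI[of _ _ "(snd p, - fst p)"]) auto
  qed auto
  moreover have "dist (?g x) (?g y) = dist x y" for x y
    by (simp add: dist_prod_def dist_real_def abs_minus_commute power2_commute add.commute)
  ultimately have "infdist (?g x) ?L = infdist x ?L" for x by (intro infdist_isometry)
  from this[of "(\<tau> * cos \<omega>, \<tau> * sin \<omega>)" for \<tau>] show ?thesis
    by (simp add: exit_time_def cos_add sin_add)
qed

lemma measure_lborel_shift:
  fixes a b c :: real
  assumes [measurable]: "S \<in> sets borel"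
  shows "measure lborel ({a + c..<b + c} \<inter> S) = measure lborel ({a..<b} \<inter> {x. c + x \<in> S})"
proof -
  have "measure (distr lborel borel ((+) c)) ({a + c..<b + c} \<inter> S) = measure lborel ((+) c -` ({a + c..<b + c} \<inter> S) \<inter> space lborel)"
    by (rule measure_distr) auto
  also have "(+) c -` ({a + c..<b + c} \<inter> S) \<inter> space lborel = {a..<b} \<inter> {x. c + x \<in> S}" by auto
  finally show ?thesis by (simp only: lborel_distr_plus)
qed

lemma measure_lborel_reflect:
  fixes a b :: real
  assumes [measurable]: "S \<in> sets borel"
  shows "measure lborel ({-b..-a} \<inter> S) = measure lborel ({a..b} \<inter> {x. - x \<in> S})"
proof -
  have "measure (distr lborel borel uminus) ({-b..-a} \<inter> S) = measure lborel (uminus -` ({-b..-a} \<inter> S) \<inter> space lborel)"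
    by (rule measure_distr) auto
  also have "uminus -` ({-b..-a} \<inter> S) \<inter> space lborel = {a..b} \<inter> {x. - x \<in> S}" by auto
  finally show ?thesis by (simp only: lborel_distr_uminus)
qed

text \<open>A quarter turn carries the reflected octant {-pi/4..<0} to {pi/4..<pi/2}, which settles
  the first quadrant; further quarter turns give the rest.\<close>

lemma measure_full_circle:
  assumes "\<epsilon> > 0"
  shows "measure lborel ({0..<2 * pi} \<inter> exit_within \<epsilon> t) = 8 * measure lborel ({0..pi/4} \<inter> exit_within \<epsilon> t)"
proof -
  define E where "E = exit_within \<epsilon> t"
  have [measurable]: "E \<in> sets borel" using exit_within_borel assms by (simp add: E_def)
  have inv: "pi/2 + x \<in> E \<longleftrightarrow> x \<in> E" "- x \<in> E \<longleftrightarrow> x \<in> E" for x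
    using exit_time_plus_half_pi[of \<epsilon> x] exit_time_minus[of \<epsilon> x] by (simp_all add: E_def exit_within_def add.commute)
  have sh: "measure lborel ({a + pi/2..<b + pi/2} \<inter> E) = measure lborel ({a..<b} \<inter> E)" for a b
    using measure_lborel_shift[of E a "pi/2" b] by (simp add: inv)
  have "measure lborel ({-(pi/4)..<0} \<inter> E) = measure lborel ({0..pi/4} \<inter> E)"
    using measure_lborel_reflect[of E "pi/4" 0] measure_Icc_eq_Ico[of E "-(pi/4)" 0] by (simp add: inv)
  then have q: "measure lborel ({pi/4..<pi/2} \<inter> E) = measure lborel ({0..pi/4} \<inter> E)"
    using sh[of "-(pi/4)" 0] by simp
  have e0: "measure lborel ({0..<pi/2} \<inter> E) = 2 * measure lborel ({0..pi/4} \<inter> E)"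
    using measure_Ico_split[of 0 "pi/4" "pi/2" E] q measure_Icc_eq_Ico[of E 0 "pi/4"] by simp
  have e1: "measure lborel ({pi/2..<pi} \<inter> E) = 2 * measure lborel ({0..pi/4} \<inter> E)"
    using sh[of 0 "pi/2"] e0 by simp
  have e2: "measure lborel ({pi..<3/2*pi} \<inter> E) = 2 * measure lborel ({0..pi/4} \<inter> E)"
    using sh[of "pi/2" "pi"] e1 by simp
  have e3: "measure lborel ({3/2*pi..<2*pi} \<inter> E) = 2 * measure lborel ({0..pi/4} \<inter> E)"
    using sh[of "pi" "3/2*pi"] e2 by simp
  have "measure lborel ({0..<2 * pi} \<inter> E) = measure lborel ({0..<pi/2} \<inter> E) + measure lborel ({pi/2..<pi} \<inter> E)
      + measure lborel ({pi..<3/2*pi} \<inter> E) + measure lborel ({3/2*pi..<2*pi} \<inter> E)"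
    using measure_Ico_split[of 0 "pi/2" "2*pi" E] measure_Ico_split[of "pi/2" pi "2*pi" E] measure_Ico_split[of pi "3/2*pi" "2*pi" E]
    by simp
  then show ?thesis using e0 e1 e2 e3 unfolding E_def by simp
qed

section \<open>Weak convergence through distribution functions\<close>

definition exit_distribution :: "real \<Rightarrow> real measure" where
  "exit_distribution \<epsilon> = distr (exit_measure \<epsilon>) borel (\<lambda>x. x)"

lemma id_measurable_exit: "(\<lambda>x. x) \<in> exit_measure \<epsilon> \<rightarrow>\<^sub>M borel"
  unfolding exit_measure_def by (simp add: measurable_restrict_space1)

lemma real_distribution_exit:
  assumes "\<epsilon> > 0"
  shows "real_distribution (exit_distribution \<epsilon>)"
  using prob_space.real_distribution_distr[OF prob_space_exit_measure[OF assms] id_measurable_exit]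
  by (simp add: exit_distribution_def)

lemma cdf_exit_distribution:
  assumes "\<epsilon> > 0"
  shows "cdf (exit_distribution \<epsilon>) x = (if x < 0 then 0 else 1 - exit_tail \<epsilon> x)"
proof -
  have [measurable]: "exit_within \<epsilon> x \<in> sets borel" using exit_within_borel assms by simp
  have "cdf (exit_distribution \<epsilon>) x = measure (exit_measure \<epsilon>) ((\<lambda>x. x) -` {..x} \<inter> space (exit_measure \<epsilon>))"
    unfolding cdf_def exit_distribution_def by (rule measure_distr[OF id_measurable_exit]) simp
  also have "(\<lambda>x. x) -` {..x} \<inter> space (exit_measure \<epsilon>) = {..x} \<inter> {0..}"
    by (simp add: exit_measure_def space_restrict_space)
  also have "measure (exit_measure \<epsilon>) ({..x} \<inter> {0..})
      = measure (uniform_measure lborel {0..<2*pi}) ((\<lambda>\<omega>. \<epsilon> * exit_time \<epsilon> \<omega>) -` ({..x} \<inter> {0..}) \<inter> space (uniform_measure lborel {0..<2*pi}))"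
    unfolding exit_measure_def by (rule measure_distr[OF scaled_exit_time_measurable[OF assms]]) (auto simp: sets_restrict_space)
  also have "(\<lambda>\<omega>. \<epsilon> * exit_time \<epsilon> \<omega>) -` ({..x} \<inter> {0..}) \<inter> space (uniform_measure lborel {0..<2*pi}) = exit_within \<epsilon> x"
    using exit_time_nonneg[OF assms] assms by (auto simp: exit_within_def le_divide_eq mult.commute)
  also have "measure (uniform_measure lborel {0..<2*pi}) (exit_within \<epsilon> x) = measure lborel ({0..<2*pi} \<inter> exit_within \<epsilon> x) / (2 * pi)"
    by (subst measure_uniform_measure) auto
  also have "\<dots> = 4 / pi * measure lborel ({0..pi/4} \<inter> exit_within \<epsilon> x)"
    unfolding measure_full_circle[OF assms] by simp
  finally have cdf: "cdf (exit_distribution \<epsilon>) x = 4 / pi * measure lborel ({0..pi/4} \<inter> exit_within \<epsilon> x)" .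
  show ?thesis
  proof (cases "x < 0")
    case True
    have "exit_within \<epsilon> x = {}"
      using True assms exit_time_nonneg[OF assms] by (auto simp: exit_within_def le_divide_eq not_le intro!: less_le_trans[of x 0])
    then show ?thesis using True cdf by simp
  next
    case False
    then show ?thesis using cdf exit_tail_eq[OF assms, of x] by simp
  qed
qed

definition limit_distribution :: "real measure" where
  "limit_distribution = distr limit_measure borel (\<lambda>x. x)"

lemma limit_density_borel [measurable]: "limit_density \<in> borel_measurable borel"
  using continuous_limit_density by (rule borel_measurable_continuous_onI)

lemma space_limit_measure: "space limit_measure = {0..}"
  by (simp add: limit_measure_def space_restrict_space)

lemma id_measurable_limit: "(\<lambda>x. x) \<in> limit_measure \<rightarrow>\<^sub>M borel"
  unfolding limit_measure_def by (simp add: measurable_restrict_space1)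

lemma emeasure_limit_measure:
  assumes "0 \<le> b"
  shows "emeasure limit_measure {0..b} = ennreal (cumul b)"
proof -
  have [measurable]: "limit_density \<in> borel_measurable (restrict_space lborel {0..})"
    by (rule measurable_restrict_space1) simp
  have "emeasure limit_measure {0..b} = (\<integral>\<^sup>+x. ennreal (limit_density x) * indicator {0..b} x \<partial>restrict_space lborel {0..})"
    unfolding limit_measure_def by (rule emeasure_density) (auto simp: sets_restrict_space image_iff intro!: exI[of _ "{0..b}"])
  also have "\<dots> = (\<integral>\<^sup>+x. ennreal (limit_density x) * indicator {0..b} x * indicator {0..} x \<partial>lborel)"
    by (rule nn_integral_restrict_space) simp
  also have "\<dots> = (\<integral>\<^sup>+x. ennreal (limit_density x * indicator {0..b} x) \<partial>lborel)"
    by (intro nn_integral_cong) (auto simp: indicator_def)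
  also have "\<dots> = ennreal (cumul b)"
  proof (rule nn_integral_has_integral_lborel)
    have "(limit_density has_integral cumul b) {0..b}" unfolding cumul_def by (intro integrable_integral) simp
    then have "((\<lambda>x. if x \<in> {0..b} then limit_density x else 0) has_integral cumul b) UNIV"
      by (simp only: has_integral_restrict_UNIV)
    then show "((\<lambda>x. limit_density x * indicator {0..b} x) has_integral cumul b) UNIV"
      by (rule has_integral_eq[rotated]) (auto simp: indicator_def)
  qed (auto simp: limit_density_nonneg)
  finally show ?thesis .
qed

lemma cumul_ge_1: "1 \<le> t \<Longrightarrow> cumul t = 1"
proof -
  assume t: "1 \<le> t"
  have "integral {1..t} limit_density = integral {1..t} (\<lambda>_. 0)"
    by (rule integral_cong) (auto simp: limit_density_def)
  then show ?thesis using cumul_diff[of 1 t] t cumul_one by simp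
qed

text \<open>The whole mass is already reached on {0..1}, by \<open>cumul_one\<close>.\<close>

lemma prob_space_limit_measure: "prob_space limit_measure"
proof
  have "emeasure limit_measure (\<Union>n. {0..real n}) = (SUP n. emeasure limit_measure {0..real n})"
    by (rule SUP_emeasure_incseq[symmetric])
       (auto simp: incseq_def limit_measure_def sets_restrict_space image_iff intro!: exI[of _ "{0..real _}"])
  also have "(\<Union>n. {0..real n}) = {0..}" by (auto intro: real_arch_simple)
  also have "(SUP n. emeasure limit_measure {0..real n}) = 1"
  proof (rule antisym)
    show "(SUP n. emeasure limit_measure {0..real n}) \<le> 1"
    proof (rule SUP_least)
      fix n
      have "cumul (real n) \<le> 1"
        using cumul_ge_1[of "real n"] cumul_mono[of "real n" 1] cumul_one by (cases "1 \<le> real n") auto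
      then show "emeasure limit_measure {0..real n} \<le> 1" by (simp add: emeasure_limit_measure)
    qed
    have "emeasure limit_measure {0..real 1} \<le> (SUP n. emeasure limit_measure {0..real n})" by (rule SUP_upper) simp
    then show "1 \<le> (SUP n. emeasure limit_measure {0..real n})" by (simp add: emeasure_limit_measure cumul_one)
  qed
  finally show "emeasure limit_measure (space limit_measure) = 1" by (simp add: space_limit_measure)
qed

lemma real_distribution_limit: "real_distribution limit_distribution"
  using prob_space.real_distribution_distr[OF prob_space_limit_measure id_measurable_limit]
  by (simp add: limit_distribution_def)

lemma cdf_limit_distribution: "cdf limit_distribution x = (if x < 0 then 0 else cumul x)"
proof -
  have "cdf limit_distribution x = measure limit_measure ((\<lambda>x. x) -` {..x} \<inter> space limit_measure)"
    unfolding cdf_def limit_distribution_def by (rule measure_distr[OF id_measurable_limit]) simp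
  also have "(\<lambda>x. x) -` {..x} \<inter> space limit_measure = {0..x}" by (auto simp: space_limit_measure)
  also have "measure limit_measure {0..x} = (if x < 0 then 0 else cumul x)"
    using emeasure_limit_measure[of x] cumul_nonneg[of x] by (auto simp: measure_def)
  finally show ?thesis .
qed

lemma exit_tail_tendsto:
  assumes "0 < t"
  shows "((\<lambda>\<epsilon>. exit_tail \<epsilon> t) \<longlongrightarrow> 1 - cumul t) (at_right 0)"
proof -
  \<comment> \<open>Any \<delta> below 1/8 leaves a positive exponent; 1/16 is one choice.\<close>
  have d: "(0::real) < 1/16" "(1/16::real) < 1/4" by auto
  obtain C where C: "C \<ge> 0" "\<And>\<epsilon>. 0 < \<epsilon> \<Longrightarrow> \<epsilon> \<le> 1/16 \<Longrightarrow> \<epsilon> \<le> t/16 \<Longrightarrow> \<bar>exit_tail \<epsilon> t - (1 - cumul t)\<bar> \<le> C * \<epsilon> powr (1/8 - 1/16)"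
    using exit_tail_asymp[OF d assms] by blast
  have "eventually (\<lambda>\<epsilon>. \<epsilon> \<in> {0<..<min (1/16) (t/16)}) (at_right 0)"
    using assms by (intro eventually_at_right_real) auto
  then have "eventually (\<lambda>\<epsilon>. norm (exit_tail \<epsilon> t - (1 - cumul t)) \<le> C * \<epsilon> powr (1/8 - 1/16)) (at_right 0)"
    by eventually_elim (use C(2) in auto)
  moreover have "((\<lambda>\<epsilon>. C * \<epsilon> powr (1/8 - 1/16)) \<longlongrightarrow> 0) (at_right 0)" by real_asymp
  ultimately have "((\<lambda>\<epsilon>. exit_tail \<epsilon> t - (1 - cumul t)) \<longlongrightarrow> 0) (at_right 0)"
    by (rule Lim_null_comparison)
  then show ?thesis by (simp add: LIM_zero_iff)
qed

lemma exit_tail_bigo: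
  assumes "0 < t" "0 < \<delta>"
  shows "(\<lambda>\<epsilon>. exit_tail \<epsilon> t - (1 - cumul t)) \<in> O[at_right 0](\<lambda>\<epsilon>. \<epsilon> powr (1/8 - \<delta>))"
proof -
  \<comment> \<open>\<open>exit_tail_asymp\<close> wants \<delta> < 1/4. For large \<delta> the
    claim is weaker, since \<epsilon> < 1, and follows from the exponent with 1/8.\<close>
  define d where "d = min \<delta> (1/8)"
  have d: "0 < d" "d < 1/4" using assms by (auto simp: d_def)
  obtain C where C: "C \<ge> 0" "\<And>\<epsilon>. 0 < \<epsilon> \<Longrightarrow> \<epsilon> \<le> 1/16 \<Longrightarrow> \<epsilon> \<le> t/16 \<Longrightarrow> \<bar>exit_tail \<epsilon> t - (1 - cumul t)\<bar> \<le> C * \<epsilon> powr (1/8 - d)"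
    using exit_tail_asymp[OF d assms(1)] by blast
  have "eventually (\<lambda>\<epsilon>. \<epsilon> \<in> {0<..<min (1/16) (t/16)}) (at_right 0)"
    using assms by (intro eventually_at_right_real) auto
  then have "eventually (\<lambda>\<epsilon>. norm (exit_tail \<epsilon> t - (1 - cumul t)) \<le> C * norm (\<epsilon> powr (1/8 - \<delta>))) (at_right 0)"
  proof eventually_elim
    case (elim \<epsilon>)
    then have "\<bar>exit_tail \<epsilon> t - (1 - cumul t)\<bar> \<le> C * \<epsilon> powr (1/8 - d)" by (intro C(2)) auto
    also have "\<dots> \<le> C * \<epsilon> powr (1/8 - \<delta>)"
      using elim C(1) by (intro mult_left_mono powr_mono') (auto simp: d_def)
    finally show ?case by simp
  qed
  then show ?thesis by (rule bigoI)
qed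

lemma exit_tail_zero_bounds:
  assumes "\<epsilon> > 0" "0 < s"
  shows "0 \<le> 1 - exit_tail \<epsilon> 0" "1 - exit_tail \<epsilon> 0 \<le> 1 - exit_tail \<epsilon> s"
proof -
  have [measurable]: "exit_within \<epsilon> t \<in> sets borel" for t using exit_within_borel assms by simp
  show "0 \<le> 1 - exit_tail \<epsilon> 0" by (simp add: exit_tail_eq[OF assms(1)])
  have "exit_within \<epsilon> 0 \<subseteq> exit_within \<epsilon> s"
    using assms by (auto simp: exit_within_def intro: order_trans)
  moreover have "{0..pi/4} \<inter> exit_within \<epsilon> s \<in> fmeasurable lborel"
    by (intro fmeasurable_bounded_Int) auto
  ultimately have "measure lborel ({0..pi/4} \<inter> exit_within \<epsilon> 0) \<le> measure lborel ({0..pi/4} \<inter> exit_within \<epsilon> s)"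
    by (intro measure_mono_fmeasurable) auto
  then have "4 / pi * measure lborel ({0..pi/4} \<inter> exit_within \<epsilon> 0) \<le> 4 / pi * measure lborel ({0..pi/4} \<inter> exit_within \<epsilon> s)"
    by (intro mult_left_mono) auto
  then show "1 - exit_tail \<epsilon> 0 \<le> 1 - exit_tail \<epsilon> s" by (simp add: exit_tail_eq[OF assms(1)])
qed

text \<open>The asymptotics assume t > 0, so t = 0 is reached by monotonicity: the mass at 0 is at
  most that on {0..s}, whose limit \<open>cumul s\<close> is at most 2 * s. Thus the distribution
  functions converge at 0 as well.\<close>

lemma exit_tail_zero_tendsto: "((\<lambda>\<epsilon>. 1 - exit_tail \<epsilon> 0) \<longlongrightarrow> 0) (at_right 0)"
proof (rule tendstoI)
  fix e :: real assume e: "e > 0"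
  define s where "s = e / 4"
  have s: "s > 0" using e by (simp add: s_def)
  have "cumul s \<le> 2 * s" using cumul_lipschitz[of 0 s] s by (simp add: cumul_def)
  then have cs: "cumul s < e" using e by (simp add: s_def)
  have "((\<lambda>\<epsilon>. 1 - exit_tail \<epsilon> s) \<longlongrightarrow> 1 - (1 - cumul s)) (at_right 0)"
    by (intro tendsto_intros exit_tail_tendsto s)
  then have "eventually (\<lambda>\<epsilon>. 1 - exit_tail \<epsilon> s < e) (at_right 0)"
    using cs by (intro order_tendstoD(2)) auto
  moreover have "eventually (\<lambda>\<epsilon>::real. \<epsilon> > 0) (at_right 0)" by (simp add: eventually_at_right_less)
  ultimately show "eventually (\<lambda>\<epsilon>. dist (1 - exit_tail \<epsilon> 0) 0 < e) (at_right 0)"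
  proof eventually_elim
    case (elim \<epsilon>)
    then show ?case using exit_tail_zero_bounds[OF elim(2) s] by (simp add: dist_real_def)
  qed
qed

lemma cdf_exit_tendsto:
  "((\<lambda>\<epsilon>. cdf (exit_distribution \<epsilon>) x) \<longlongrightarrow> cdf limit_distribution x) (at_right 0)"
proof -
  have "((\<lambda>\<epsilon>. if x < 0 then 0 else 1 - exit_tail \<epsilon> x) \<longlongrightarrow> cdf limit_distribution x) (at_right 0)"
  proof -
    consider "x < 0" | "x = 0" | "x > 0" by linarith
    then show ?thesis
    proof cases
      case 2
      then show ?thesis using exit_tail_zero_tendsto by (simp add: cdf_limit_distribution cumul_def)
    next
      case 3
      have "((\<lambda>\<epsilon>. 1 - exit_tail \<epsilon> x) \<longlongrightarrow> 1 - (1 - cumul x)) (at_right 0)"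
        by (intro tendsto_intros exit_tail_tendsto 3)
      then show ?thesis using 3 by (simp add: cdf_limit_distribution)
    qed (simp add: cdf_limit_distribution)
  qed
  moreover have "eventually (\<lambda>\<epsilon>. (if x < 0 then 0 else 1 - exit_tail \<epsilon> x) = cdf (exit_distribution \<epsilon>) x) (at_right 0)"
    using eventually_at_right_less[of 0] by eventually_elim (simp add: cdf_exit_distribution)
  ultimately show ?thesis by (rule Lim_transform_eventually)
qed

text \<open>The measures live on {0..}, while the criterion by distribution functions concerns the
  real line. So they are pushed forward to the line, and f is extended by its value at 0 to the
  left. The criterion speaks of sequences, hence the passage to sequences tending to 0 from the
  right.\<close>

theorem exit_measure_weakly_converges: "weakly_converges exit_measure limit_measure (at_right 0)"
  unfolding weakly_converges_def
proof (intro allI impI)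
  fix f :: "real \<Rightarrow> real"
  assume f: "continuous_on (space limit_measure) f \<and> bounded (f ` space limit_measure)"
  define g where "g x = f (max 0 x)" for x
  have cf: "continuous_on {0..} f" using f by (simp add: space_limit_measure)
  have cg: "continuous_on UNIV g" unfolding g_def
    by (rule continuous_on_compose2[OF cf]) (auto intro!: continuous_intros)
  then have cg': "isCont g x" for x by (simp add: continuous_on_eq_continuous_at)
  obtain B where B: "\<And>x. x \<ge> 0 \<Longrightarrow> norm (f x) \<le> B" using f by (auto simp: space_limit_measure bounded_iff)
  then have Bg: "norm (g x) \<le> B" for x by (simp add: g_def)
  have gm: "g \<in> borel_measurable borel" using cg by (rule borel_measurable_continuous_onI)
  have lim: "(\<integral>x. f x \<partial>limit_measure) = (\<integral>x. g x \<partial>limit_distribution)"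
  proof -
    have "(\<integral>x. g x \<partial>limit_distribution) = (\<integral>x. g x \<partial>limit_measure)"
      unfolding limit_distribution_def by (rule integral_distr[OF id_measurable_limit gm])
    also have "\<dots> = (\<integral>x. f x \<partial>limit_measure)"
      by (rule Bochner_Integration.integral_cong) (auto simp: g_def space_limit_measure)
    finally show ?thesis ..
  qed
  have ex: "(\<integral>x. f x \<partial>exit_measure \<epsilon>) = (\<integral>x. g x \<partial>exit_distribution \<epsilon>)" for \<epsilon>
  proof -
    have "(\<integral>x. g x \<partial>exit_distribution \<epsilon>) = (\<integral>x. g x \<partial>exit_measure \<epsilon>)"
      unfolding exit_distribution_def by (rule integral_distr[OF id_measurable_exit gm])
    also have "\<dots> = (\<integral>x. f x \<partial>exit_measure \<epsilon>)"
      by (rule Bochner_Integration.integral_cong) (auto simp: g_def exit_measure_def space_restrict_space)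
    finally show ?thesis ..
  qed
  have "((\<lambda>\<epsilon>. \<integral>x. g x \<partial>exit_distribution \<epsilon>) \<longlongrightarrow> (\<integral>x. g x \<partial>limit_distribution)) (at_right 0)"
    unfolding tendsto_at_iff_sequentially
  proof (intro allI impI)
    fix X :: "nat \<Rightarrow> real"
    assume X: "\<forall>i. X i \<in> {0<..} - {0}" "X \<longlonglongrightarrow> 0"
    have X0: "X i > 0" "X i \<noteq> 0" for i using X(1) by (auto dest: spec[of _ i])
    have Xr: "filterlim X (at_right 0) sequentially"
      using X(2) by (auto simp: filterlim_at X0 intro!: always_eventually)
    have "weak_conv_m (\<lambda>n. exit_distribution (X n)) limit_distribution"
      unfolding weak_conv_m_def weak_conv_def
    proof (intro allI impI)
      fix x
      show "(\<lambda>n. cdf (exit_distribution (X n)) x) \<longlonglongrightarrow> cdf limit_distribution x"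
        using filterlim_compose[OF cdf_exit_tendsto Xr] .
    qed
    then have "(\<lambda>n. integral\<^sup>L (exit_distribution (X n)) g) \<longlonglongrightarrow> integral\<^sup>L limit_distribution g"
      by (rule weak_conv_imp_integral_bdd_continuous_conv[OF real_distribution_exit[OF X0(1)] real_distribution_limit _ cg' Bg])
    then show "((\<lambda>\<epsilon>. \<integral>x. g x \<partial>exit_distribution \<epsilon>) \<circ> X) \<longlonglongrightarrow> (\<integral>x. g x \<partial>limit_distribution)"
      by (simp add: comp_def)
  qed
  then show "((\<lambda>i. \<integral>x. f x \<partial>exit_measure i) \<longlongrightarrow> (\<integral>x. f x \<partial>limit_measure)) (at_right 0)"
    by (simp only: lim ex)
qed

lemma cumul_has_derivative:
  assumes "0 < t"
  shows "(cumul has_real_derivative limit_density t) (at t)"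
proof -
  have "((\<lambda>x. integral {0..x} limit_density) has_real_derivative limit_density t) (at t within {0..t + 1})"
    using assms by (intro integral_has_real_derivative continuous_on_subset[OF continuous_limit_density]) auto
  moreover have "at t within {0..t + 1} = at t" using assms by (intro at_within_interior) auto
  ultimately show ?thesis by (simp add: cumul_def[abs_def])
qed

theorem theorem1p1:
  shows "\<exists>H :: real \<Rightarrow> real.
      (\<forall>t>0. ((\<lambda>\<epsilon>. exit_tail \<epsilon> t) \<longlongrightarrow> H t) (at_right 0))
    \<and> (\<forall>t>0. \<forall>\<delta>>0. (\<lambda>\<epsilon>. exit_tail \<epsilon> t - H t) \<in> O[at_right 0](\<lambda>\<epsilon>. \<epsilon> powr (1/8 - \<delta>)))
    \<and> (\<forall>t. 0 < t \<and> t \<le> 1/2 \<longrightarrow> H t = 1 - 2 * t / real_zeta 2)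
    \<and> (\<forall>t. 1/2 \<le> t \<and> t \<le> 1 \<longrightarrow> H t = 2 / real_zeta 2 * integral {t..1} psi)
    \<and> (\<forall>t\<ge>1. H t = 0)
    \<and> (\<forall>t>0. (H has_real_derivative - limit_density t) (at t))
    \<and> weakly_converges exit_measure limit_measure (at_right 0)"
proof (intro exI[of _ "\<lambda>t. 1 - cumul t"] conjI allI impI)
  fix t :: real
  show "1 - cumul t = 1 - 2 * t / real_zeta 2" if "0 < t \<and> t \<le> 1/2"
  proof -
    have "cumul t = integral {0..t} (\<lambda>_. 2 / real_zeta 2)"
      unfolding cumul_def using that by (intro integral_cong) (auto simp: limit_density_def)
    then show ?thesis using that by simp
  qed
  show "1 - cumul t = 2 / real_zeta 2 * integral {t..1} psi" if "1/2 \<le> t \<and> t \<le> 1"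
  proof -
    have "1 - cumul t = integral {t..1} limit_density"
      using cumul_diff[of t 1] that cumul_one by simp
    also have "\<dots> = integral {t..1} (\<lambda>x. 2 / real_zeta 2 * psi x)"
    proof (rule integral_cong)
      fix x assume x: "x \<in> {t..1}"
      show "limit_density x = 2 / real_zeta 2 * psi x"
      \<comment> \<open>At 1/2 the density takes its constant branch and agrees because
        \<open>psi (1/2)\<close> is 1; at 1 it is 0, and so is \<open>psi 1\<close> in HOL.\<close>
      proof (cases "x = 1/2")
        case True
        show ?thesis unfolding True psi_half by (simp add: limit_density_def)
      next
        case False
        then show ?thesis using x that by (cases "x = 1") (auto simp: limit_density_def psi_def)
      qed
    qed
    also have "\<dots> = 2 / real_zeta 2 * integral {t..1} psi" by (rule integral_mult_right)
    finally show ?thesis .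
  qed
  show "1 - cumul t = 0" if "1 \<le> t" using cumul_ge_1[OF that] by simp
  show "((\<lambda>t. 1 - cumul t) has_real_derivative - limit_density t) (at t)" if "0 < t"
    using DERIV_diff[OF DERIV_const cumul_has_derivative[OF that]] by simp
qed (use exit_tail_tendsto exit_tail_bigo exit_measure_weakly_converges in auto)

end
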